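(* Let $\phi=(1+\sqrt5)/2$ and let $X_{\mathrm{BH}}\subset\mathbb{P}^5(\mathbb{C})$ be the subscheme defined by $q_1=q_2=q_3=0$, where $$q_1=x_1^2+x_4^2-\phi x_5^2+\phi x_6^2,\quad q_2=x_2^2-\phi x_4^2+x_5^2-\phi x_6^2,\quad q_3=x_3^2+\phi x_4^2-\phi x_5^2+x_6^2.$$ Then the scheme $X_{\mathrm{BH}}$ is smooth, irreducible, of dimension $2$.
   Context: $[x_1:\cdots:x_6]$ are homogeneous coordinates on $\mathbb{P}^5(\mathbb{C})$. *)

theory Defs
  imports
    "HOL-Library.Poly_Mapping"
    "HOL-Library.Numeral_Type"
    "HOL-Library.Extended_Nat"
    "HOL-Computational_Algebra.Fraction_Field"
    "HOL-Algebra.Module"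
    "HOL-Algebra.QuotRing"
    "HOL-Algebra.Algebraic_Closure_Type"
    "HOL-Analysis.Abstract_Topology"
begin

section \<open>Irreducibility and dimension of topological spaces\<close>

definition irreducible_space :: "'a topology \<Rightarrow> bool" where
  "irreducible_space T \<longleftrightarrow> topspace T \<noteq> {} \<and>
     (\<forall>A B. closedin T A \<and> closedin T B \<and> A \<union> B = topspace T
        \<longrightarrow> A = topspace T \<or> B = topspace T)"

definition irreducible_subset :: "'a topology \<Rightarrow> 'a set \<Rightarrow> bool" where
  "irreducible_subset T S \<longleftrightarrow> S \<subseteq> topspace T \<and> irreducible_space (subtopology T S)"

definition irreducible_component :: "'a topology \<Rightarrow> 'a set \<Rightarrow> bool" where
  "irreducible_component T S \<longleftrightarrow> irreducible_subset T S \<and>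
     (\<forall>S'. irreducible_subset T S' \<and> S \<subseteq> S' \<longrightarrow> S' = S)"

text \<open>For the empty space this supremum is \<open>0\<close> rather than \<open>-\<infinity>\<close>; only nonempty
  spaces matter below.\<close>

definition krull_dim :: "'a topology \<Rightarrow> enat" where
  "krull_dim T = Sup {enat n | n. \<exists>Z.
     (\<forall>i\<le>n. closedin T (Z i) \<and> irreducible_subset T (Z i)) \<and>
     (\<forall>i<n. Z i \<subset> Z (Suc i))}"


section \<open>Kaehler differentials\<close>

text \<open>The fields \<open>mult\<close> and \<open>one\<close> of the record type of modules are irrelevant.\<close>

definition free_module :: "('r, 'm) ring_scheme \<Rightarrow> 'b set \<Rightarrow> ('r, 'b \<Rightarrow> 'r) module" where
  "free_module R B = \<lparr>
     carrier = {f. range f \<subseteq> carrier R \<and> finite {b. f b \<noteq> \<zero>\<^bsub>R\<^esub>} \<and> {b. f b \<noteq> \<zero>\<^bsub>R\<^esub>} \<subseteq> B},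
     monoid.mult = undefined, one = undefined,
     ring.zero = (\<lambda>_. \<zero>\<^bsub>R\<^esub>), add = (\<lambda>f g b. f b \<oplus>\<^bsub>R\<^esub> g b),
     module.smult = (\<lambda>r f b. r \<otimes>\<^bsub>R\<^esub> f b)\<rparr>"

definition free_gen :: "('r, 'm) ring_scheme \<Rightarrow> 'b \<Rightarrow> 'b \<Rightarrow> 'r" where
  "free_gen R a = (\<lambda>b. if b = a then \<one>\<^bsub>R\<^esub> else \<zero>\<^bsub>R\<^esub>)"

definition gen_submodule ::
  "('r, 'm) ring_scheme \<Rightarrow> ('r, 'a, 'n) module_scheme \<Rightarrow> 'a set \<Rightarrow> 'a set" where
  "gen_submodule R M G = \<Inter>{N. submodule N R M \<and> G \<subseteq> N}"

definition quotient_module :: "('r, 'a, 'n) module_scheme \<Rightarrow> 'a set \<Rightarrow> ('r, 'a set) module" where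
  "quotient_module M N = \<lparr>
     carrier = a_rcosets\<^bsub>M\<^esub> N, monoid.mult = undefined, one = undefined,
     ring.zero = N, add = set_add M,
     module.smult = (\<lambda>r C. \<Union>x\<in>C. N +>\<^bsub>M\<^esub> (r \<odot>\<^bsub>M\<^esub> x))\<rparr>"

text \<open>The module of differentials of a ring \<open>R\<close> over a field \<open>k\<close> along the structure map
  \<open>s: k \<rightarrow> R\<close>: generators \<open>d a\<close> for \<open>a \<in> R\<close>, subject to additivity,
  the Leibniz rule, and \<open>d (s c) = 0\<close>.\<close>

definition kaehler_relations :: "('r, 'm) ring_scheme \<Rightarrow> ('k \<Rightarrow> 'r) \<Rightarrow> ('r \<Rightarrow> 'r) set" where
  "kaehler_relations R s = (let F = free_module R (carrier R); d = free_gen R in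
     {d (a \<oplus>\<^bsub>R\<^esub> b) \<ominus>\<^bsub>F\<^esub> (d a \<oplus>\<^bsub>F\<^esub> d b) | a b. a \<in> carrier R \<and> b \<in> carrier R} \<union>
     {d (a \<otimes>\<^bsub>R\<^esub> b) \<ominus>\<^bsub>F\<^esub> ((a \<odot>\<^bsub>F\<^esub> d b) \<oplus>\<^bsub>F\<^esub> (b \<odot>\<^bsub>F\<^esub> d a)) | a b. a \<in> carrier R \<and> b \<in> carrier R} \<union>
     {d (s c) | c. True})"

definition kaehler_module ::
  "('r, 'm) ring_scheme \<Rightarrow> ('k \<Rightarrow> 'r) \<Rightarrow> ('r, ('r \<Rightarrow> 'r) set) module" where
  "kaehler_module R s = (let F = free_module R (carrier R) in
     quotient_module F (gen_submodule R F (kaehler_relations R s)))"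

text \<open>The maximal ideal of a local ring.\<close>

definition nonunits :: "('r, 'm) ring_scheme \<Rightarrow> 'r set" where
  "nonunits R = carrier R - Units R"

text \<open>For a local ring \<open>(R, m)\<close>: the module \<open>M \<otimes> R/m = M/mM\<close> has dimension \<open>n\<close> over the residue
  field \<open>R/m\<close>. Coefficients are taken in \<open>R\<close> and compared modulo \<open>m\<close>, which annihilates \<open>M/mM\<close>.\<close>

definition fibre_dim :: "('r, 'm) ring_scheme \<Rightarrow> ('r, 'a, 'n) module_scheme \<Rightarrow> nat \<Rightarrow> bool" where
  "fibre_dim R M n \<longleftrightarrow>
     (let V = quotient_module M (gen_submodule R M
                {r \<odot>\<^bsub>M\<^esub> x | r x. r \<in> nonunits R \<and> x \<in> carrier M})
      in \<exists>e \<in> {..<n} \<rightarrow> carrier V.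
        (\<forall>x \<in> carrier V. \<exists>r \<in> {..<n} \<rightarrow> carrier R. x = (\<Oplus>\<^bsub>V\<^esub>i\<in>{..<n}. r i \<odot>\<^bsub>V\<^esub> e i)) \<and>
        (\<forall>r \<in> {..<n} \<rightarrow> carrier R. (\<Oplus>\<^bsub>V\<^esub>i\<in>{..<n}. r i \<odot>\<^bsub>V\<^esub> e i) = \<zero>\<^bsub>V\<^esub>
           \<longrightarrow> (\<forall>i<n. r i \<in> nonunits R)))"


section \<open>Smooth schemes over a field\<close>

text \<open>The part of a scheme over a field \<open>k\<close> that enters into irreducibility, dimension and
  smoothness: the underlying space, the local rings, and their structure maps from \<open>k\<close>.\<close>

record ('k, 'p, 'r) scheme_data =
  space :: "'p topology"
  stalk :: "'p \<Rightarrow> 'r ring"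
  scalar :: "'p \<Rightarrow> 'k \<Rightarrow> 'r"

definition open_subscheme ::
  "('k, 'p, 'r) scheme_data \<Rightarrow> 'p set \<Rightarrow> ('k, 'p, 'r) scheme_data" where
  "open_subscheme Y U = Y\<lparr>space := subtopology (space Y) U\<rparr>"

text \<open>Smoothness of relative dimension \<open>n\<close> over \<open>k\<close> as in Hartshorne, III.10, for \<open>Y\<close> of finite
  type over a field \<open>k\<close> (flatness is then automatic): all irreducible components have dimension \<open>n\<close>,
  and \<open>\<Omega> \<otimes> \<kappa>(p)\<close> has dimension \<open>n\<close> at every point \<open>p\<close>, closed or not; here \<open>\<Omega>\<close> is the sheaf of
  differentials of \<open>Y\<close> over \<open>k\<close>, whose stalk at \<open>p\<close> is the module of differentials of the local ring.\<close>

definition smooth_of_rel_dim :: "('k, 'p, 'r) scheme_data \<Rightarrow> nat \<Rightarrow> bool" where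
  "smooth_of_rel_dim Y n \<longleftrightarrow>
     (\<forall>Z. irreducible_component (space Y) Z \<longrightarrow> krull_dim (subtopology (space Y) Z) = enat n) \<and>
     (\<forall>p \<in> topspace (space Y). fibre_dim (stalk Y p) (kaehler_module (stalk Y p) (scalar Y p)) n)"

definition smooth :: "('k, 'p, 'r) scheme_data \<Rightarrow> bool" where
  "smooth Y \<longleftrightarrow> (\<forall>p \<in> topspace (space Y). \<exists>U n.
     openin (space Y) U \<and> p \<in> U \<and> smooth_of_rel_dim (open_subscheme Y U) n)"


section \<open>Closed subschemes of projective space\<close>

text \<open>Polynomials over \<open>'k\<close> in variables indexed by the finite type \<open>'v\<close>. The order on \<open>'v\<close>
  is needed only for the instance \<open>idom\<close>. For \<open>'v = 6\<close> the indices are integers modulo 6, so the numerals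
  \<open>1\<close> to \<open>6\<close> denote the six distinct elements, with \<open>6 = 0\<close>.\<close>

type_synonym ('k, 'v) mpoly = "('v \<Rightarrow>\<^sub>0 nat) \<Rightarrow>\<^sub>0 'k"

definition Var :: "'v \<Rightarrow> ('k::zero_neq_one, 'v) mpoly" where
  "Var i = Poly_Mapping.single (Poly_Mapping.single i 1) 1"

definition Const :: "'k::zero \<Rightarrow> ('k, 'v) mpoly" where
  "Const c = Poly_Mapping.single 0 c"

definition homogeneous :: "nat \<Rightarrow> ('k::zero, 'v) mpoly \<Rightarrow> bool" where
  "homogeneous d f \<longleftrightarrow> (\<forall>m \<in> Poly_Mapping.keys f.
     (\<Sum>i\<in>Poly_Mapping.keys m. Poly_Mapping.lookup m i) = d)"

abbreviation poly_ring :: "('k::field, 'v::{finite,linorder}) mpoly ring" where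
  "poly_ring \<equiv> ring_of_type_algebra"

definition homogeneous_ideal :: "('k::field, 'v::{finite,linorder}) mpoly set \<Rightarrow> bool" where
  "homogeneous_ideal I \<longleftrightarrow> ideal I poly_ring \<and>
     I = Idl\<^bsub>poly_ring\<^esub> {f \<in> I. \<exists>d. homogeneous d f}"

text \<open>The points of \<open>Proj (S/I)\<close>, where \<open>S\<close> is the polynomial ring, as homogeneous primes of \<open>S\<close>.\<close>

definition proj_points ::
  "('k::field, 'v::{finite,linorder}) mpoly set \<Rightarrow> ('k, 'v) mpoly set set" where
  "proj_points I = {P. primeideal P poly_ring \<and> homogeneous_ideal P \<and> I \<subseteq> P \<and>
     \<not> range Var \<subseteq> P}"

text \<open>As the points are homogeneous ideals, arbitrary sets \<open>J\<close> cut out the same closed sets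
  as homogeneous ideals do.\<close>

definition zariski_topology ::
  "('k::field, 'v::{finite,linorder}) mpoly set \<Rightarrow> ('k, 'v) mpoly set topology" where
  "zariski_topology I = topology (\<lambda>U. \<exists>J. U = {P \<in> proj_points I. \<not> J \<subseteq> P})"

lemma istopology_zariski:
  fixes I :: "('k::field, 'v::{finite,linorder}) mpoly set"
  shows "istopology (\<lambda>U. \<exists>J. U = {P \<in> proj_points I. \<not> J \<subseteq> P})"
  unfolding istopology_def
proof (intro conjI allI impI; (elim exE)?)
  fix S T J K
  assume S: "S = {P \<in> proj_points I. \<not> J \<subseteq> P}" and T: "T = {P \<in> proj_points I. \<not> K \<subseteq> P}"
  have "(\<not> J \<subseteq> P \<and> \<not> K \<subseteq> P) \<longleftrightarrow> \<not> {f * g | f g. f \<in> J \<and> g \<in> K} \<subseteq> P" if "P \<in> proj_points I" for P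
  proof -
    interpret primeideal P "poly_ring :: ('k, 'v) mpoly ring"
      using that by (simp add: proj_points_def)
    show ?thesis
      using I_l_closed I_r_closed I_prime
      by (simp add: ring_of_type_algebra_def subset_iff) blast
  qed
  then have "S \<inter> T = {P \<in> proj_points I. \<not> {f * g | f g. f \<in> J \<and> g \<in> K} \<subseteq> P}"
    unfolding S T by blast
  then show "\<exists>L. S \<inter> T = {P \<in> proj_points I. \<not> L \<subseteq> P}" by blast
next
  fix \<K> :: "('k, 'v) mpoly set set set"
  assume "\<forall>U\<in>\<K>. \<exists>J. U = {P \<in> proj_points I. \<not> J \<subseteq> P}"
  then obtain J where J: "\<forall>U\<in>\<K>. U = {P \<in> proj_points I. \<not> J U \<subseteq> P}" by metis
  have "\<Union>\<K> = (\<Union>U\<in>\<K>. {P \<in> proj_points I. \<not> J U \<subseteq> P})"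
    using J by auto
  also have "\<dots> = {P \<in> proj_points I. \<not> (\<Union>U\<in>\<K>. J U) \<subseteq> P}"
    by auto
  finally show "\<exists>L. \<Union>\<K> = {P \<in> proj_points I. \<not> L \<subseteq> P}" by blast
qed

text \<open>The local ring of projective space at \<open>P\<close>: the fractions \<open>f/g\<close> with \<open>f\<close>, \<open>g\<close> homogeneous of the
  same degree and \<open>g \<notin> P\<close>, as a subring of the field of fractions of \<open>S\<close>.\<close>

definition homogeneous_localization ::
  "('k::field, 'v::{finite,linorder}) mpoly set \<Rightarrow> ('k, 'v) mpoly fract ring" where
  "homogeneous_localization P = ring_of_type_algebra
     \<lparr>carrier := {Fract f g | f g d. homogeneous d f \<and> homogeneous d g \<and> g \<notin> P}\<rparr>"

definition localized_ideal ::
  "('k::field, 'v::{finite,linorder}) mpoly set \<Rightarrow> ('k, 'v) mpoly set \<Rightarrow> ('k, 'v) mpoly fract set" where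
  "localized_ideal I P = {Fract f g | f g d. f \<in> I \<and> homogeneous d f \<and> homogeneous d g \<and> g \<notin> P}"

text \<open>The closed subscheme of projective space with homogeneous coordinates \<open>Var i\<close> given by the
  vanishing of a set \<open>Q\<close> of homogeneous polynomials.\<close>

definition proj_subscheme ::
  "('k::field, 'v::{finite,linorder}) mpoly set
    \<Rightarrow> ('k, ('k, 'v) mpoly set, ('k, 'v) mpoly fract set) scheme_data" where
  "proj_subscheme Q = (let I = Idl\<^bsub>poly_ring\<^esub> Q in \<lparr>
     space = zariski_topology I,
     stalk = (\<lambda>P. homogeneous_localization P Quot localized_ideal I P),
     scalar = (\<lambda>P c. localized_ideal I P +>\<^bsub>homogeneous_localization P\<^esub> Fract (Const c) 1)\<rparr>)"

end

theory Submission
  imports Defs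
begin

text \<open>All \<open>3 \<times> 3\<close> minors of the coefficient matrix of the three diagonal quadrics are nonzero, so any three of
  the squares \<open>x\<^sub>i\<^sup>2\<close> are linear combinations of the other three modulo the ideal \<open>I\<close> of the quadrics.

  Irreducibility: \<open>x\<^sub>1\<close>, \<open>x\<^sub>2\<close>, \<open>x\<^sub>3\<close> are square roots of quadratic forms in \<open>x\<^sub>4\<close>, \<open>x\<^sub>5\<close>, \<open>x\<^sub>6\<close>, no product of which is a
  square. By Kummer theory \<open>I\<close> is the kernel of a homomorphism to a field, hence prime.

  Dimension: the monomials that are squarefree in \<open>x\<^sub>1\<close>, \<open>x\<^sub>2\<close>, \<open>x\<^sub>3\<close> span the coordinate ring, and counting them
  shows that any four elements are algebraically dependent. A chain of four homogeneous primes inside the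
  irrelevant ideal would give four independent ones. Conversely, the curve \<open>x\<^sub>6 = 0\<close> gives a chain of length 2.

  Smoothness: at most two coordinates vanish at a point. So there are a nonvanishing coordinate \<open>x\<^sub>l\<close> and three
  other nonvanishing coordinates whose differentials are expressed by those of the remaining two affine
  coordinates \<open>x\<^sub>i / x\<^sub>l\<close>; two explicit derivations of the local ring show that the latter are independent.\<close>

section \<open>Ideals of a ring given by a type class\<close>

text \<open>The golden ratio enters through \<open>c * c = c + 1\<close>, which makes every 3 x 3
  minor equal to \<open>1\<close>, \<open>-1\<close>, \<open>c\<close> or \<open>-c\<close>. The
  obstacle in the dimension bound is that chains consist of arbitrary irreducible closed sets:
  intersecting the points of such a set gives a prime, and a lexicographically lowest term of a
  relation between elements chosen along the chain shows their independence. Against this stands a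
  count on the affine cone: four elements with exponents up to \<open>N\<close> have
  \<open>(N + 1)^4\<close> products, while the span available in degree proportional to
  \<open>N\<close> grows like \<open>N^3\<close>. The seven nonsquare conditions of Kummer theory
  are checked after setting \<open>x4 = 1\<close>, \<open>x6 = 0\<close>, where the three forms
  become polynomials in \<open>x5\<close> with simple and pairwise distinct roots. As the local
  rings consist of fractions of degree 0, the two derivations are first written on the polynomial
  ring with denominators cleared and then divided by the product of the pivot coordinates; this
  treats closed and nonclosed points alike.\<close>

lemma ideal_type_algebra_iff:
  fixes I :: "'a::comm_ring_1 set"
  shows "ideal I ring_of_type_algebra \<longleftrightarrow>
    0 \<in> I \<and> (\<forall>a\<in>I. \<forall>b\<in>I. a + b \<in> I) \<and> (\<forall>a\<in>I. \<forall>x. x * a \<in> I)"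
proof
  assume "ideal I ring_of_type_algebra"
  then interpret ideal I "ring_of_type_algebra :: 'a ring" .
  show "0 \<in> I \<and> (\<forall>a\<in>I. \<forall>b\<in>I. a + b \<in> I) \<and> (\<forall>a\<in>I. \<forall>x. x * a \<in> I)"
    using additive_subgroup.zero_closed[OF is_additive_subgroup]
      additive_subgroup.a_closed[OF is_additive_subgroup] I_l_closed
    by (simp add: ring_of_type_algebra_def)
next
  assume I: "0 \<in> I \<and> (\<forall>a\<in>I. \<forall>b\<in>I. a + b \<in> I) \<and> (\<forall>a\<in>I. \<forall>x. x * a \<in> I)"
  interpret cring "ring_of_type_algebra :: 'a ring" by (rule cring_from_type_algebra)
  \<comment> \<open>The additive part of an ideal is a subgroup, so negatives are required; they are
    multiples by \<open>-1\<close>.\<close>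
  have neg: "- a \<in> I" if "a \<in> I" for a
    using I that by (metis mult_minus1)
  have inv: "\<ominus>\<^bsub>(ring_of_type_algebra :: 'a ring)\<^esub> a = - a" for a
    using minus_equality[of "- a" a] by (simp add: ring_of_type_algebra_def)
  show "ideal I ring_of_type_algebra"
  proof (rule idealI[OF ring_from_type_algebra])
    show "subgroup I (add_monoid ring_of_type_algebra)"
    proof (rule add.subgroupI)
      show "\<ominus>\<^bsub>(ring_of_type_algebra :: 'a ring)\<^esub> a \<in> I" if "a \<in> I" for a
        using that inv neg by simp
    qed (use I in \<open>auto simp: ring_of_type_algebra_def\<close>)
  qed (use I in \<open>auto simp: ring_of_type_algebra_def mult.commute\<close>)
qed

lemma idealD:
  fixes I :: "'a::comm_ring_1 set"
  assumes "ideal I ring_of_type_algebra"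
  shows ideal_zero: "0 \<in> I" and ideal_add: "a \<in> I \<Longrightarrow> b \<in> I \<Longrightarrow> a + b \<in> I"
    and ideal_mult_left: "a \<in> I \<Longrightarrow> x * a \<in> I" and ideal_mult_right: "a \<in> I \<Longrightarrow> a * x \<in> I"
    and ideal_uminus: "a \<in> I \<Longrightarrow> - a \<in> I" and ideal_diff: "a \<in> I \<Longrightarrow> b \<in> I \<Longrightarrow> a - b \<in> I"
proof -
  have *: "0 \<in> I" "\<And>a b. a \<in> I \<Longrightarrow> b \<in> I \<Longrightarrow> a + b \<in> I" "\<And>a x. a \<in> I \<Longrightarrow> x * a \<in> I"
    using assms by (auto simp: ideal_type_algebra_iff)
  show "0 \<in> I" "a \<in> I \<Longrightarrow> b \<in> I \<Longrightarrow> a + b \<in> I" "a \<in> I \<Longrightarrow> x * a \<in> I" by (fact *)+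
  show "a \<in> I \<Longrightarrow> a * x \<in> I" using *(3) by (simp add: mult.commute)
  show m: "a \<in> I \<Longrightarrow> - a \<in> I" for a using *(3)[of a "-1"] by simp
  show "a \<in> I \<Longrightarrow> b \<in> I \<Longrightarrow> a - b \<in> I" using *(2)[of a "- b"] m by simp
qed

lemma ideal_sum:
  fixes I :: "'a::comm_ring_1 set"
  assumes "ideal I ring_of_type_algebra" "\<And>i. i \<in> A \<Longrightarrow> f i \<in> I"
  shows "sum f A \<in> I"
  using assms(2) by (induction A rule: infinite_finite_induct) (auto intro: idealD[OF assms(1)])

lemma primeideal_type_algebra_iff:
  fixes P :: "'a::comm_ring_1 set"
  shows "primeideal P ring_of_type_algebra \<longleftrightarrow>
    ideal P ring_of_type_algebra \<and> 1 \<notin> P \<and> (\<forall>a b. a * b \<in> P \<longrightarrow> a \<in> P \<or> b \<in> P)"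
proof
  assume "primeideal P ring_of_type_algebra"
  then interpret primeideal P "ring_of_type_algebra :: 'a ring" .
  have "1 \<notin> P"
    using I_notcarr ideal_mult_left[OF is_ideal, of 1]
    by (auto simp: ring_of_type_algebra_def)
  then show "ideal P ring_of_type_algebra \<and> 1 \<notin> P \<and> (\<forall>a b. a * b \<in> P \<longrightarrow> a \<in> P \<or> b \<in> P)"
    using is_ideal I_prime by (simp add: ring_of_type_algebra_def)
next
  assume "ideal P ring_of_type_algebra \<and> 1 \<notin> P \<and> (\<forall>a b. a * b \<in> P \<longrightarrow> a \<in> P \<or> b \<in> P)"
  then show "primeideal P ring_of_type_algebra"
    by (intro primeidealI cring_from_type_algebra) (auto simp: ring_of_type_algebra_def)
qed

lemma primeidealD:
  fixes P :: "'a::comm_ring_1 set"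
  assumes "primeideal P ring_of_type_algebra"
  shows prime_ideal: "ideal P ring_of_type_algebra" and prime_one: "1 \<notin> P"
    and prime_mult_iff: "a * b \<in> P \<longleftrightarrow> a \<in> P \<or> b \<in> P"
    and prime_power: "a ^ n \<in> P \<Longrightarrow> a \<in> P"
proof -
  have *: "ideal P ring_of_type_algebra" "1 \<notin> P" "\<And>a b. a * b \<in> P \<Longrightarrow> a \<in> P \<or> b \<in> P"
    using assms by (auto simp: primeideal_type_algebra_iff)
  show "ideal P ring_of_type_algebra" "1 \<notin> P" by (fact *)+
  show "a * b \<in> P \<longleftrightarrow> a \<in> P \<or> b \<in> P"
    using *(3) idealD(3,4)[OF *(1)] by blast
  show "a ^ n \<in> P \<Longrightarrow> a \<in> P"
    by (induction n) (use *(2,3) in auto)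
qed

lemma genideal_ideal_type: "ideal (genideal ring_of_type_algebra (Q :: 'a::comm_ring_1 set)) ring_of_type_algebra"
  by (rule ring.genideal_ideal[OF ring_from_type_algebra]) (simp add: ring_of_type_algebra_def)

lemma genideal_superset_type: "Q \<subseteq> genideal ring_of_type_algebra (Q :: 'a::comm_ring_1 set)"
  by (rule ring.genideal_self[OF ring_from_type_algebra]) (simp add: ring_of_type_algebra_def)

lemma genideal_least_type:
  fixes Q :: "'a::comm_ring_1 set"
  shows "ideal I ring_of_type_algebra \<Longrightarrow> Q \<subseteq> I \<Longrightarrow> genideal ring_of_type_algebra Q \<subseteq> I"
  by (rule ring.genideal_minimal[OF ring_from_type_algebra])

section \<open>Polynomials\<close>

lemma Const_add: "Const (a + b) = Const a + Const (b :: 'k::comm_ring_1)"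
  by (simp add: Const_def Poly_Mapping.single_add)

lemma Const_mult: "Const (a * b) = Const a * Const (b :: 'k::comm_ring_1)"
  by (simp add: Const_def Poly_Mapping.mult_single)

lemma Const_0 [simp]: "Const 0 = 0" and Const_1 [simp]: "Const (1 :: 'k::comm_ring_1) = 1"
  by (simp_all add: Const_def)

lemma Const_uminus: "Const (- a) = - Const (a :: 'k::comm_ring_1)"
  by (simp add: Const_def Poly_Mapping.single_uminus)

lemma Var_power: "Var i ^ n = Poly_Mapping.single (Poly_Mapping.single i n) (1 :: 'k::comm_ring_1)"
  by (induction n) (simp_all add: Var_def Poly_Mapping.mult_single flip: Poly_Mapping.single_add)

lemma prod_Var_power:
  "finite A \<Longrightarrow> (\<Prod>i\<in>A. Var i ^ e i) =
    Poly_Mapping.single (\<Sum>i\<in>A. Poly_Mapping.single i (e i)) (1 :: 'k::comm_ring_1)"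
  by (induction A rule: finite_induct) (simp_all add: Var_power Poly_Mapping.mult_single)

lemma sum_single_lookup:
  "(\<Sum>i\<in>UNIV. Poly_Mapping.single i (Poly_Mapping.lookup m i)) = (m :: 'v::finite \<Rightarrow>\<^sub>0 nat)"
  by (rule poly_mapping_eqI) (simp add: lookup_sum lookup_single when_def)

lemma single_eq_monomial:
  "Poly_Mapping.single m c =
    Const (c :: 'k::comm_ring_1) * (\<Prod>i\<in>UNIV. Var (i :: 'v::finite) ^ Poly_Mapping.lookup m i)"
  by (simp add: prod_Var_power sum_single_lookup Const_def Poly_Mapping.mult_single)

lemma sum_monomials:
  "(\<Sum>m\<in>Poly_Mapping.keys f. Poly_Mapping.single m (Poly_Mapping.lookup f m)) = f"
  by (rule poly_mapping_eqI)
    (simp add: lookup_sum lookup_single when_def in_keys_iff)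

text \<open>Constants and variables generate the ring, so identities between homomorphisms reduce to
  generators without mention of exponents or keys.\<close>

lemma mpoly_induct [case_names Const Var add mult]:
  fixes f :: "('k::comm_ring_1, 'v::finite) mpoly"
  assumes C: "\<And>c. P (Const c)" and V: "\<And>i. P (Var i)"
    and A: "\<And>f g. P f \<Longrightarrow> P g \<Longrightarrow> P (f + g)" and M: "\<And>f g. P f \<Longrightarrow> P g \<Longrightarrow> P (f * g)"
  shows "P f"
proof -
  have one: "P 1" and zero: "P 0" using C[of 1] C[of 0] by simp_all
  have pow: "P (Var i ^ n)" for i n by (induction n) (auto intro: one V M)
  have prod: "P (\<Prod>i\<in>B. Var i ^ e i)" for e B
    by (induction B rule: infinite_finite_induct) (auto intro: one pow M)
  have "P (\<Sum>m\<in>K. Poly_Mapping.single m (g m))" for K g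
    by (induction K rule: infinite_finite_induct) (auto simp: single_eq_monomial intro: zero A M C prod)
  from this[of "Poly_Mapping.lookup f" "Poly_Mapping.keys f"] show ?thesis by (simp add: sum_monomials)
qed

section \<open>Degree, homogeneity and homogeneous components\<close>

definition mdeg :: "('v \<Rightarrow>\<^sub>0 nat) \<Rightarrow> nat" where
  "mdeg m = (\<Sum>i\<in>Poly_Mapping.keys m. Poly_Mapping.lookup m i)"

lemma mdeg_eq: "mdeg m = (\<Sum>i\<in>UNIV. Poly_Mapping.lookup m (i :: 'v::finite))"
  unfolding mdeg_def by (rule sum.mono_neutral_left) (auto simp: in_keys_iff)

lemma mdeg_add: "mdeg (m + n) = mdeg m + mdeg (n :: 'v::finite \<Rightarrow>\<^sub>0 nat)"
  by (simp add: mdeg_eq lookup_add sum.distrib)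

lemma homogeneous_iff: "homogeneous d f \<longleftrightarrow> (\<forall>m\<in>Poly_Mapping.keys f. mdeg m = d)"
  by (simp add: homogeneous_def mdeg_def)

lemma homogeneous_0 [simp]: "homogeneous d 0"
  by (simp add: homogeneous_iff)

lemma homogeneous_add: "homogeneous d f \<Longrightarrow> homogeneous d g \<Longrightarrow> homogeneous d (f + g)"
  using keys_add[of f g] by (auto simp: homogeneous_iff)

lemma homogeneous_uminus: "homogeneous d f \<Longrightarrow> homogeneous d (- f :: ('k::comm_ring_1, 'v) mpoly)"
  by (auto simp: homogeneous_iff in_keys_iff)

lemma homogeneous_diff:
  "homogeneous d f \<Longrightarrow> homogeneous d g \<Longrightarrow> homogeneous d (f - g :: ('k::comm_ring_1, 'v) mpoly)"
  using homogeneous_add[of d f "- g"] homogeneous_uminus[of d g] by simp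

lemma homogeneous_sum: "(\<And>i. i \<in> A \<Longrightarrow> homogeneous d (f i)) \<Longrightarrow> homogeneous d (sum f A)"
  by (induction A rule: infinite_finite_induct) (auto intro: homogeneous_add)

lemma homogeneous_mult:
  fixes f g :: "('k::comm_ring_1, 'v::finite) mpoly"
  shows "homogeneous d f \<Longrightarrow> homogeneous e g \<Longrightarrow> homogeneous (d + e) (f * g)"
  using keys_mult[of f g] by (fastforce simp: homogeneous_iff mdeg_add)

lemma homogeneous_Const [simp]: "homogeneous 0 (Const c)"
  by (simp add: homogeneous_iff Const_def mdeg_def)

lemma homogeneous_1 [simp]: "homogeneous 0 (1 :: ('k::comm_ring_1, 'v) mpoly)"
  by (simp add: homogeneous_iff mdeg_def)

lemma homogeneous_Var [simp]: "homogeneous 1 (Var i :: ('k::comm_ring_1, 'v) mpoly)"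
  by (simp add: homogeneous_iff Var_def mdeg_def)

lemma homogeneous_power:
  fixes f :: "('k::comm_ring_1, 'v::finite) mpoly"
  shows "homogeneous d f \<Longrightarrow> homogeneous (n * d) (f ^ n)"
  by (induction n) (auto intro: homogeneous_mult)

text \<open>Zero is homogeneous of every degree, hence a case for all \<open>d\<close>. The cases
  \<open>add\<close> and \<open>mult\<close> supply only \<open>P\<close>; a proof that also needs
  homogeneity of the parts includes it in \<open>P\<close>.\<close>

lemma homogeneous_induct [consumes 1, case_names zero Const Var add mult]:
  fixes f :: "('k::comm_ring_1, 'v::finite) mpoly"
  assumes f: "homogeneous d f" and Z: "\<And>d. P d 0" and C: "\<And>c. P 0 (Const c)" and V: "\<And>i. P 1 (Var i)"
    and A: "\<And>d f g. P d f \<Longrightarrow> P d g \<Longrightarrow> P d (f + g)"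
    and M: "\<And>d e f g. P d f \<Longrightarrow> P e g \<Longrightarrow> P (d + e) (f * g)"
  shows "P d f"
proof -
  have one: "P 0 1" using C[of 1] by simp
  have pow: "P n (Var i ^ n)" for i n
  proof (induction n)
    case (Suc n)
    then show ?case using M[OF V Suc] by simp
  qed (simp add: one)
  have prod: "P (\<Sum>i\<in>B. e i) (\<Prod>i\<in>B. Var i ^ e i)" for e B
    by (induction B rule: infinite_finite_induct) (auto intro: one pow M)
  have single: "P (mdeg m) (Poly_Mapping.single m c)" for m c
    using M[OF C prod[of "Poly_Mapping.lookup m" UNIV]] by (simp add: single_eq_monomial mdeg_eq)
  have "P d (\<Sum>m\<in>K. Poly_Mapping.single m (g m))" if "\<And>m. m \<in> K \<Longrightarrow> mdeg m = d" for K g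
    using that
  proof (induction K rule: infinite_finite_induct)
    case (insert m K)
    then show ?case using single[of m "g m"] by (auto intro: A)
  qed (auto intro: Z)
  from this[of "Poly_Mapping.keys f" "Poly_Mapping.lookup f"] f show ?thesis
    by (simp add: sum_monomials homogeneous_iff)
qed

definition hcomp :: "nat \<Rightarrow> ('k::comm_ring_1, 'v) mpoly \<Rightarrow> ('k, 'v) mpoly" where
  "hcomp d f = (\<Sum>m | m \<in> Poly_Mapping.keys f \<and> mdeg m = d. Poly_Mapping.single m (Poly_Mapping.lookup f m))"

lemma homogeneous_hcomp: "homogeneous d (hcomp d f)"
  unfolding hcomp_def by (rule homogeneous_sum) (auto simp: homogeneous_iff)

lemma sum_hcomp: "\<exists>D. finite D \<and> (\<Sum>d\<in>D. hcomp d f) = f"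
proof -
  have "(\<Sum>d\<in>mdeg ` Poly_Mapping.keys f. hcomp d f) = f"
    unfolding hcomp_def using sum.group[of "Poly_Mapping.keys f" "mdeg ` Poly_Mapping.keys f" mdeg
      "\<lambda>m. Poly_Mapping.single m (Poly_Mapping.lookup f m)"]
    by (simp add: sum_monomials)
  then show ?thesis by (intro exI[of _ "mdeg ` Poly_Mapping.keys f"]) simp
qed

section \<open>Evaluation homomorphisms\<close>

locale comm_ring_hom1 =
  fixes h :: "'a::comm_ring_1 \<Rightarrow> 'b::comm_ring_1"
  assumes hom_add: "h (x + y) = h x + h y" and hom_mult: "h (x * y) = h x * h y" and hom_1: "h 1 = 1"
begin

lemma hom_0: "h 0 = 0"
  using hom_add[of 0 0] by simp

lemma hom_uminus: "h (- x) = - h x"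
  using hom_add[of x "- x"] by (simp add: hom_0 eq_neg_iff_add_eq_0 add.commute)

lemma hom_diff: "h (x - y) = h x - h y"
  using hom_add[of x "- y"] by (simp add: hom_uminus)

lemma hom_power: "h (x ^ n) = h x ^ n"
  by (induction n) (simp_all add: hom_1 hom_mult)

lemmas hom_simps = hom_add hom_mult hom_1 hom_0 hom_uminus hom_diff hom_power

end

text \<open>The coefficient map \<open>h\<close> is separate from the values \<open>a\<close>
  because points are taken in several rings: polynomials, power series and an algebraic
  closure.\<close>

definition meval :: "('k \<Rightarrow> 'b::comm_ring_1) \<Rightarrow> ('v \<Rightarrow> 'b) \<Rightarrow> ('k::comm_ring_1, 'v::finite) mpoly \<Rightarrow> 'b" where
  "meval h a f = (\<Sum>m\<in>Poly_Mapping.keys f. h (Poly_Mapping.lookup f m) * (\<Prod>i\<in>UNIV. a i ^ Poly_Mapping.lookup m i))"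

context comm_ring_hom1
begin

lemma meval_superset:
  assumes "finite K" "Poly_Mapping.keys f \<subseteq> K"
  shows "meval h a f = (\<Sum>m\<in>K. h (Poly_Mapping.lookup f m) * (\<Prod>i\<in>UNIV. a i ^ Poly_Mapping.lookup m i))"
  unfolding meval_def by (rule sum.mono_neutral_left) (use assms in \<open>auto simp: in_keys_iff hom_0\<close>)

lemma meval_add: "meval h a (f + g) = meval h a f + meval h a g"
proof -
  define K where "K = Poly_Mapping.keys f \<union> Poly_Mapping.keys g"
  have "finite K" "Poly_Mapping.keys f \<subseteq> K" "Poly_Mapping.keys g \<subseteq> K" "Poly_Mapping.keys (f + g) \<subseteq> K"
    using keys_add[of f g] by (auto simp: K_def)
  then show ?thesis by (simp add: meval_superset lookup_add hom_add distrib_right sum.distrib)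
qed

lemma meval_single: "meval h a (Poly_Mapping.single m c) = h c * (\<Prod>i\<in>UNIV. a i ^ Poly_Mapping.lookup m i)"
  by (simp add: meval_superset[of "{m}"])

lemma meval_0: "meval h a 0 = 0"
  by (simp add: meval_def)

lemma meval_sum: "meval h a (sum f A) = (\<Sum>x\<in>A. meval h a (f x))"
  by (induction A rule: infinite_finite_induct) (simp_all add: meval_0 meval_add)

lemma meval_mult: "meval h a (f * g) = meval h a f * meval h a g"
proof -
  have "meval h a (Poly_Mapping.single m c * Poly_Mapping.single n d) =
      meval h a (Poly_Mapping.single m c) * meval h a (Poly_Mapping.single n d)" for m n c d
    by (simp add: Poly_Mapping.mult_single meval_single hom_mult lookup_add power_add prod.distrib)
  then have "meval h a ((\<Sum>m\<in>A. Poly_Mapping.single m (p m)) * (\<Sum>n\<in>B. Poly_Mapping.single n (q n))) =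
     meval h a (\<Sum>m\<in>A. Poly_Mapping.single m (p m)) * meval h a (\<Sum>n\<in>B. Poly_Mapping.single n (q n))" for A B p q
    by (simp add: sum_product meval_sum)
  from this[of "Poly_Mapping.lookup f" "Poly_Mapping.keys f" "Poly_Mapping.lookup g" "Poly_Mapping.keys g"]
  show ?thesis by (simp add: sum_monomials)
qed

lemma meval_Const: "meval h a (Const c) = h c"
  by (simp add: Const_def meval_single)

lemma meval_Var: "meval h a (Var i) = a i"
  by (simp add: Var_def meval_single lookup_single when_def hom_1 power_0_left if_distrib[of "\<lambda>n. _ ^ n"] cong: if_cong)

lemma meval_hom: "comm_ring_hom1 (meval h a)"
  using meval_Const[of a 1] by unfold_locales (simp_all add: meval_add meval_mult hom_1)

lemma meval_uminus: "meval h a (- f) = - meval h a f"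
  by (rule comm_ring_hom1.hom_uminus[OF meval_hom])

lemma meval_diff: "meval h a (f - g) = meval h a f - meval h a g"
  by (rule comm_ring_hom1.hom_diff[OF meval_hom])

lemma meval_power: "meval h a (f ^ n) = meval h a f ^ n"
  by (rule comm_ring_hom1.hom_power[OF meval_hom])

lemmas meval_simps = meval_0 meval_Const meval_Var meval_add meval_mult meval_uminus meval_diff meval_power

end

section \<open>Irreducible closed sets and prime ideals\<close>

lemma openin_zariski:
  "openin (zariski_topology I) U \<longleftrightarrow> (\<exists>J. U = {P \<in> proj_points I. \<not> J \<subseteq> P})"
  unfolding zariski_topology_def by (simp add: topology_inverse'[OF istopology_zariski])

lemma topspace_zariski: "topspace (zariski_topology I) = proj_points I"
proof
  show "topspace (zariski_topology I) \<subseteq> proj_points I"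
    by (auto simp: topspace_def openin_zariski)
  have "openin (zariski_topology I) (proj_points I)"
    unfolding openin_zariski
    by (intro exI[of _ "{1}"]) (auto simp: proj_points_def primeideal_type_algebra_iff)
  then show "proj_points I \<subseteq> topspace (zariski_topology I)"
    by (rule openin_subset)
qed

lemma closedin_zariski:
  "closedin (zariski_topology I) Z \<longleftrightarrow> (\<exists>J. Z = {P \<in> proj_points I. J \<subseteq> P})"
proof -
  have "proj_points I - Z = {P \<in> proj_points I. \<not> J \<subseteq> P} \<longleftrightarrow> Z = {P \<in> proj_points I. J \<subseteq> P}"
    if "Z \<subseteq> proj_points I" for J using that by blast
  then have "(\<exists>J. proj_points I - Z = {P \<in> proj_points I. \<not> J \<subseteq> P}) \<longleftrightarrow>
      (\<exists>J. Z = {P \<in> proj_points I. J \<subseteq> P})" if "Z \<subseteq> proj_points I"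
    using that by simp
  then show ?thesis
    unfolding closedin_def topspace_zariski openin_zariski by (cases "Z \<subseteq> proj_points I") auto
qed

text \<open>\<open>P\<close> is a generic point of this set: a relatively closed subset that
  contains \<open>P\<close> is everything, and of two closed sets that cover the space one contains
  \<open>P\<close>.\<close>

lemma irreducible_closure_point:
  assumes P: "P \<in> proj_points I"
  shows "irreducible_subset (zariski_topology I) {Q \<in> proj_points I. P \<subseteq> Q}" (is "irreducible_subset ?T ?S")
proof -
  have top: "topspace (subtopology ?T ?S) = ?S"
    by (auto simp: topspace_zariski)
  have gen: "A = ?S" if "closedin (subtopology ?T ?S) A" "P \<in> A" for A
  proof -
    from that(1)[unfolded closedin_subtopology]
    obtain C where "closedin ?T C" and A: "A = C \<inter> ?S"
      by (elim exE conjE) (rule that)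
    then obtain J where "C = {Q \<in> proj_points I. J \<subseteq> Q}"
      by (auto simp: closedin_zariski)
    then show ?thesis using A that(2) by auto
  qed
  show ?thesis
    unfolding irreducible_subset_def irreducible_space_def top
  proof (intro conjI allI impI)
    fix A B
    assume AB: "closedin (subtopology ?T ?S) A \<and> closedin (subtopology ?T ?S) B \<and> A \<union> B = ?S"
    then have "P \<in> A \<or> P \<in> B" using P by blast
    then show "A = ?S \<or> B = ?S" using gen[of A] gen[of B] AB by blast
  qed (use P in \<open>auto simp: topspace_zariski\<close>)
qed

text \<open>Polynomials without constant term, written as a kernel so that the ideal property comes
  from evaluation at the origin.\<close>

definition irrelevant_ideal :: "('k::field, 'v::{finite,linorder}) mpoly set" where
  "irrelevant_ideal = {f. meval (\<lambda>c. c) (\<lambda>_. 0) f = 0}"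

lemma homogeneous_0_Const:
  fixes f :: "('k::comm_ring_1, 'v::finite) mpoly"
  assumes "homogeneous 0 f"
  shows "\<exists>c. f = Const c"
proof -
  have "d = 0 \<longrightarrow> (\<exists>c. f = Const c)" if "homogeneous d f" for d
    using that
  proof (induction rule: homogeneous_induct)
    case (zero d)
    then show ?case by (metis Const_0)
  qed (auto simp flip: Const_add Const_mult)
  then show ?thesis using assms by blast
qed

lemma homogeneous_pos_irrelevant:
  fixes f :: "('k::field, 'v::{finite,linorder}) mpoly"
  assumes "homogeneous d f" "d > 0"
  shows "f \<in> irrelevant_ideal"
proof -
  interpret comm_ring_hom1 "\<lambda>c::'k. c" by unfold_locales simp_all
  have "d > 0 \<longrightarrow> meval (\<lambda>c. c) (\<lambda>_. 0) f = 0"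
    using assms(1) by (induction rule: homogeneous_induct) (auto simp: meval_simps)
  then show ?thesis using assms(2) by (simp add: irrelevant_ideal_def)
qed

lemma irrelevant_ideal_props:
  shows ideal_irrelevant: "ideal (irrelevant_ideal :: ('k::field, 'v::{finite,linorder}) mpoly set) poly_ring"
    and Const_irrelevant: "Const c \<in> (irrelevant_ideal :: ('k, 'v) mpoly set) \<longleftrightarrow> c = 0"
proof -
  interpret comm_ring_hom1 "\<lambda>c::'k. c" by unfold_locales simp_all
  show "ideal (irrelevant_ideal :: ('k, 'v) mpoly set) poly_ring"
    by (auto simp: ideal_type_algebra_iff irrelevant_ideal_def meval_simps)
  show "Const c \<in> (irrelevant_ideal :: ('k, 'v) mpoly set) \<longleftrightarrow> c = 0"
    by (simp add: irrelevant_ideal_def meval_Const)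
qed

text \<open>It suffices to look at homogeneous generators. Those of positive degree vanish at the
  origin; one of degree 0 is a constant, and a nonzero constant would put \<open>1\<close> into
  \<open>P\<close>.\<close>

lemma homogeneous_ideal_irrelevant:
  fixes P :: "('k::field, 'v::{finite,linorder}) mpoly set"
  assumes "homogeneous_ideal P" "1 \<notin> P"
  shows "P \<subseteq> irrelevant_ideal"
proof -
  have id: "ideal P poly_ring" and P: "P = Idl\<^bsub>poly_ring\<^esub> {f \<in> P. \<exists>d. homogeneous d f}"
    using assms(1) by (auto simp: homogeneous_ideal_def)
  have "f \<in> irrelevant_ideal" if f: "f \<in> P" "homogeneous d f" for f d
  proof (cases "d = 0")
    case True
    then obtain c where c: "f = Const c" using homogeneous_0_Const f(2) by blast
    have "c = 0"
    proof (rule ccontr)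
      assume "c \<noteq> 0"
      then have "1 = Const (inverse c) * f" by (simp add: c flip: Const_mult)
      then show False using ideal_mult_left[OF id f(1)] assms(2) by metis
    qed
    then show ?thesis using ideal_zero[OF ideal_irrelevant] by (simp add: c)
  qed (use f homogeneous_pos_irrelevant in blast)
  then have "Idl\<^bsub>poly_ring\<^esub> {f \<in> P. \<exists>d. homogeneous d f} \<subseteq> irrelevant_ideal"
    by (intro genideal_least_type ideal_irrelevant) blast
  then show ?thesis using P by simp
qed

lemma proj_pointsD:
  assumes "P \<in> proj_points I"
  shows "primeideal P poly_ring" "homogeneous_ideal P" "I \<subseteq> P" "\<not> range Var \<subseteq> P"
    "P \<subseteq> irrelevant_ideal"
  using assms homogeneous_ideal_irrelevant[of P] by (auto simp: proj_points_def primeideal_type_algebra_iff)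

text \<open>If \<open>f * g\<close> lies in every point of \<open>Z\<close>, the closed subsets of
  \<open>Z\<close> where \<open>f\<close> and where \<open>g\<close> vanishes cover
  \<open>Z\<close>, so one of them is \<open>Z\<close>. The last claim recovers \<open>Z\<close>
  from its prime, which keeps strict inclusions strict.\<close>

lemma irreducible_closed_prime:
  fixes I :: "('k::field, 'v::{finite,linorder}) mpoly set"
  assumes Z: "closedin (zariski_topology I) Z" "irreducible_subset (zariski_topology I) Z"
  shows "primeideal (\<Inter>Z) poly_ring" "I \<subseteq> \<Inter>Z" "\<Inter>Z \<subseteq> irrelevant_ideal" "\<not> range Var \<subseteq> \<Inter>Z"
    "Z = {P \<in> proj_points I. \<Inter>Z \<subseteq> P}"
proof -
  have sub: "Z \<subseteq> proj_points I"
    using Z(1) closedin_subset by (fastforce simp: topspace_zariski)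
  then have top: "topspace (subtopology (zariski_topology I) Z) = Z"
    by (auto simp: topspace_zariski)
  have ne: "Z \<noteq> {}"
    using Z(2) unfolding irreducible_subset_def irreducible_space_def top by blast
  have irr: "\<forall>A B. closedin (subtopology (zariski_topology I) Z) A \<and>
      closedin (subtopology (zariski_topology I) Z) B \<and> A \<union> B = Z \<longrightarrow> A = Z \<or> B = Z"
    using Z(2) unfolding irreducible_subset_def irreducible_space_def top by simp
  obtain Q where Q: "Q \<in> Z" using ne by blast
  note Q' = proj_pointsD[OF subsetD[OF sub Q]]
  show "\<Inter>Z \<subseteq> irrelevant_ideal" "\<not> range Var \<subseteq> \<Inter>Z"
    using Q Q'(4,5) by blast+
  show "I \<subseteq> \<Inter>Z" using sub by (auto simp: proj_points_def)
  show "Z = {P \<in> proj_points I. \<Inter>Z \<subseteq> P}"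
  proof -
    obtain J where J: "Z = {P \<in> proj_points I. J \<subseteq> P}" using Z(1) by (auto simp: closedin_zariski)
    then have "J \<subseteq> \<Inter>Z" by blast
    then show ?thesis using J sub by blast
  qed
  show "primeideal (\<Inter>Z) poly_ring"
    unfolding primeideal_type_algebra_iff
  proof (intro conjI allI impI)
    have "ideal P poly_ring" if "P \<in> Z" for P
      using that sub proj_pointsD(1) prime_ideal by blast
    then show "ideal (\<Inter>Z) poly_ring"
      unfolding ideal_type_algebra_iff by blast
    show "1 \<notin> \<Inter>Z" using Q Q'(1) prime_one by blast
    fix f g assume fg: "f * g \<in> \<Inter>Z"
    have cl: "closedin (subtopology (zariski_topology I) Z) {P \<in> Z. x \<in> P}" for x
    proof -
      have "closedin (zariski_topology I) {P \<in> proj_points I. {x} \<subseteq> P}"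
        unfolding closedin_zariski by (rule exI[of _ "{x}"]) (rule refl)
      moreover have "{P \<in> Z. x \<in> P} = {P \<in> proj_points I. {x} \<subseteq> P} \<inter> Z" using sub by blast
      ultimately show ?thesis unfolding closedin_subtopology by metis
    qed
    have "f \<in> P \<or> g \<in> P" if "P \<in> Z" for P
      using fg that prime_mult_iff[OF proj_pointsD(1)[OF subsetD[OF sub that]]] by blast
    then have "{P \<in> Z. f \<in> P} \<union> {P \<in> Z. g \<in> P} = Z" by blast
    then have "{P \<in> Z. f \<in> P} = Z \<or> {P \<in> Z. g \<in> P} = Z"
      using irr[rule_format, of "{P \<in> Z. f \<in> P}" "{P \<in> Z. g \<in> P}"] cl[of f] cl[of g] by blast
    then show "f \<in> \<Inter>Z \<or> g \<in> \<Inter>Z" by blast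
  qed
qed

section \<open>Chains of primes and algebraic dependence\<close>

text \<open>Dividing a relation by the lowest power of \<open>f\<close> and reducing modulo \<open>f\<close>.\<close>

lemma lowest_power_relation:
  fixes f :: "'a::comm_ring_1"
  assumes P: "primeideal P ring_of_type_algebra" and P': "ideal P' ring_of_type_algebra" "P \<subseteq> P'"
    and f: "f \<in> P'" "f \<notin> P"
    and A: "finite A" "A \<noteq> {}" "(\<Sum>a\<in>A. f ^ e a * h a) \<in> P"
  obtains B where "B \<subseteq> A" "B \<noteq> {}" "(\<Sum>a\<in>B. h a) \<in> P'" "\<And>a b. a \<in> B \<Longrightarrow> b \<in> B \<Longrightarrow> e a = e b"
proof -
  define n where "n = Min (e ` A)"
  define B where "B = {a \<in> A. e a = n}"
  have n: "n \<in> e ` A" "\<And>a. a \<in> A \<Longrightarrow> n \<le> e a"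
    using A by (auto simp: n_def)
  have "(\<Sum>a\<in>A. f ^ e a * h a) = f ^ n * (\<Sum>a\<in>A. f ^ (e a - n) * h a)"
    unfolding sum_distrib_left
    by (rule sum.cong) (use n(2) in \<open>simp_all add: mult.assoc[symmetric] flip: power_add\<close>)
  then have "(\<Sum>a\<in>A. f ^ (e a - n) * h a) \<in> P'"
    using A(3) prime_mult_iff[OF P] prime_power[OF P] f(2) P'(2) by (metis subsetD)
  moreover have "(\<Sum>a\<in>A. f ^ (e a - n) * h a) = (\<Sum>a\<in>B. h a) + (\<Sum>a\<in>A - B. f ^ (e a - n) * h a)"
  proof -
    have "(\<Sum>a\<in>A. f ^ (e a - n) * h a) = (\<Sum>a\<in>A - B. f ^ (e a - n) * h a) + (\<Sum>a\<in>B. f ^ (e a - n) * h a)"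
      by (rule sum.subset_diff) (use A in \<open>auto simp: B_def\<close>)
    moreover have "(\<Sum>a\<in>B. f ^ (e a - n) * h a) = (\<Sum>a\<in>B. h a)"
      by (rule sum.cong) (auto simp: B_def)
    ultimately show ?thesis by simp
  qed
  moreover have "(\<Sum>a\<in>A - B. f ^ (e a - n) * h a) \<in> P'"
  proof (rule ideal_sum[OF P'(1)])
    fix a assume "a \<in> A - B"
    then have "e a - n = Suc (e a - n - 1)" using n(2)[of a] by (auto simp: B_def)
    then have "f ^ (e a - n) * h a = f * (f ^ (e a - n - 1) * h a)"
      by (metis mult.assoc power_Suc)
    then show "f ^ (e a - n) * h a \<in> P'" using ideal_mult_right[OF P'(1) f(1)] by simp
  qed
  ultimately have "(\<Sum>a\<in>B. h a) \<in> P'"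
    using ideal_diff[OF P'(1)] by (metis add_diff_cancel_right')
  moreover have "B \<noteq> {}" "B \<subseteq> A" using n(1) by (auto simp: B_def)
  moreover have "e a = e b" if "a \<in> B" "b \<in> B" for a b using that by (simp add: B_def)
  ultimately show ?thesis using that by blast
qed

text \<open>Dividing out \<open>f0\<close>, \<open>f1\<close>, \<open>f2\<close>, \<open>f3\<close>
  in turn keeps only the terms with the least exponent and moves the relation one step up the chain.
  In the end one coefficient remains, and it would lie in \<open>M\<close>.\<close>

lemma prime_chain_independent:
  fixes P0 :: "'a::comm_ring_1 set" and A :: "(nat \<times> nat \<times> nat \<times> nat) set"
  assumes P: "primeideal P0 ring_of_type_algebra" "primeideal P1 ring_of_type_algebra"
      "primeideal P2 ring_of_type_algebra" "primeideal P3 ring_of_type_algebra"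
      "ideal M ring_of_type_algebra"
    and sub: "P0 \<subseteq> P1" "P1 \<subseteq> P2" "P2 \<subseteq> P3" "P3 \<subseteq> M"
    and f: "f0 \<in> P1 - P0" "f1 \<in> P2 - P1" "f2 \<in> P3 - P2" "f3 \<in> M - P3"
    and A: "finite A" "A \<noteq> {}" "\<And>a. a \<in> A \<Longrightarrow> c a \<notin> M"
  shows "(\<Sum>(i, j, k, l)\<in>A. c (i, j, k, l) * f0 ^ i * f1 ^ j * f2 ^ k * f3 ^ l) \<notin> P0"
proof
  assume rel: "(\<Sum>(i, j, k, l)\<in>A. c (i, j, k, l) * f0 ^ i * f1 ^ j * f2 ^ k * f3 ^ l) \<in> P0"
  let ?e0 = fst and ?e1 = "\<lambda>a. fst (snd a)" and ?e2 = "\<lambda>a. fst (snd (snd a))"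
  let ?e3 = "\<lambda>a :: nat \<times> nat \<times> nat \<times> nat. snd (snd (snd a))"
  note id = P(2,3,4)[THEN prime_ideal] P(5)
  have nf: "f0 \<notin> P0" "f1 \<notin> P1" "f2 \<notin> P2" "f3 \<notin> P3" using f by auto
  have rel': "(\<Sum>a\<in>A. f0 ^ ?e0 a * (f1 ^ ?e1 a * (f2 ^ ?e2 a * (f3 ^ ?e3 a * c a)))) \<in> P0"
    using rel by (simp add: case_prod_beta mult_ac)
  obtain B0 where B0: "B0 \<subseteq> A" "B0 \<noteq> {}" "(\<Sum>a\<in>B0. f1 ^ ?e1 a * (f2 ^ ?e2 a * (f3 ^ ?e3 a * c a))) \<in> P1"
      "\<And>a b. a \<in> B0 \<Longrightarrow> b \<in> B0 \<Longrightarrow> ?e0 a = ?e0 b"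
    by (rule lowest_power_relation[OF P(1) id(1) sub(1) DiffD1[OF f(1)] nf(1) A(1,2) rel']) (rule that)
  have fin0: "finite B0" using B0(1) A(1) finite_subset by blast
  obtain B1 where B1: "B1 \<subseteq> B0" "B1 \<noteq> {}" "(\<Sum>a\<in>B1. f2 ^ ?e2 a * (f3 ^ ?e3 a * c a)) \<in> P2"
      "\<And>a b. a \<in> B1 \<Longrightarrow> b \<in> B1 \<Longrightarrow> ?e1 a = ?e1 b"
    by (rule lowest_power_relation[OF P(2) id(2) sub(2) DiffD1[OF f(2)] nf(2) fin0 B0(2,3)]) (rule that)
  have fin1: "finite B1" using B1(1) fin0 finite_subset by blast
  obtain B2 where B2: "B2 \<subseteq> B1" "B2 \<noteq> {}" "(\<Sum>a\<in>B2. f3 ^ ?e3 a * c a) \<in> P3"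
      "\<And>a b. a \<in> B2 \<Longrightarrow> b \<in> B2 \<Longrightarrow> ?e2 a = ?e2 b"
    by (rule lowest_power_relation[OF P(3) id(3) sub(3) DiffD1[OF f(3)] nf(3) fin1 B1(2,3)]) (rule that)
  have fin2: "finite B2" using B2(1) fin1 finite_subset by blast
  obtain B3 where B3: "B3 \<subseteq> B2" "B3 \<noteq> {}" "(\<Sum>a\<in>B3. c a) \<in> M"
      "\<And>a b. a \<in> B3 \<Longrightarrow> b \<in> B3 \<Longrightarrow> ?e3 a = ?e3 b"
    by (rule lowest_power_relation[OF P(4) id(4) sub(4) DiffD1[OF f(4)] nf(4) fin2 B2(2,3)]) (rule that)
  obtain a where a: "a \<in> B3" using B3(2) by blast
  \<comment> \<open>Each reduction made one of the four exponents constant, so a single tuple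
    survives.\<close>
  have "b = a" if "b \<in> B3" for b
  proof -
    have "a \<in> B2" "b \<in> B2" using a that B3(1) by blast+
    moreover from this have "a \<in> B1" "b \<in> B1" using B2(1) by blast+
    moreover from this have "a \<in> B0" "b \<in> B0" using B1(1) by blast+
    ultimately have "?e0 b = ?e0 a" "?e1 b = ?e1 a" "?e2 b = ?e2 a" "?e3 b = ?e3 a"
      using B0(4) B1(4) B2(4) B3(4) a that by metis+
    then show ?thesis by (simp add: prod_eq_iff)
  qed
  then have "B3 = {a}" using a by blast
  moreover have "a \<in> A" using a B3(1) B2(1) B1(1) B0(1) by blast
  ultimately show False using B3(3) A(3)[of a] by simp
qed

text \<open>The library notion \<open>dependent\<close> concerns sets of vectors. A family with a
  repeated vector is dependent for a different reason: the difference of the two equal members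
  vanishes.\<close>

lemma dependent_family:
  fixes scale :: "'a::field \<Rightarrow> 'b::ab_group_add \<Rightarrow> 'b"
  assumes "vector_space scale"
    and E: "finite E" and W: "finite W" "\<And>x. x \<in> E \<Longrightarrow> w x \<in> module.span scale W" "card W < card E"
  shows "\<exists>c. (\<exists>x\<in>E. c x \<noteq> 0) \<and> (\<Sum>x\<in>E. scale (c x) (w x)) = 0"
proof -
  interpret vector_space scale by fact
  show ?thesis
  proof (cases "inj_on w E")
    case True
    have "dependent (w ` E)"
    proof (rule ccontr)
      assume ind: "\<not> dependent (w ` E)"
      have "card (w ` E) \<le> card W"
        using independent_span_bound[OF W(1) ind] image_subsetI[of E w "span W", OF W(2)] by simp
      then show False using W(3) card_image[OF True] by simp
    qed
    then obtain u where "\<exists>v\<in>w ` E. u v \<noteq> 0" "(\<Sum>v\<in>w ` E. scale (u v) v) = 0"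
      using dependent_finite[OF finite_imageI[OF E]] by blast
    then have "(\<exists>x\<in>E. (u \<circ> w) x \<noteq> 0) \<and> (\<Sum>x\<in>E. scale ((u \<circ> w) x) (w x)) = 0"
      by (simp add: sum.reindex[OF True])
    then show ?thesis by (rule exI[of _ "u \<circ> w"])
  next
    case False
    then obtain x y where xy: "x \<in> E" "y \<in> E" "x \<noteq> y" "w x = w y" by (auto simp: inj_on_def)
    let ?c = "\<lambda>z. if z = x then 1 else if z = y then - 1 else (0 :: 'a)"
    have "(\<Sum>z\<in>E. scale (?c z) (w z)) = (\<Sum>z\<in>{x, y}. scale (?c z) (w z))"
      by (rule sum.mono_neutral_right) (use E xy in auto)
    also have "\<dots> = 0" using xy by simp
    finally have "(\<Sum>z\<in>E. scale (?c z) (w z)) = 0" .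
    moreover have "\<exists>z\<in>E. ?c z \<noteq> 0" using xy(1) by (intro bexI[of _ x]) simp_all
    ultimately show ?thesis by (intro exI[of _ ?c] conjI)
  qed
qed

section \<open>Degree bounds, monomial counting and chains of closed sets\<close>

lemma mdeg_single: "mdeg (Poly_Mapping.single v n) = n"
  by (simp add: mdeg_def)

text \<open>An upper bound instead of a grading, because the elements chosen from the primes of a
  chain are arbitrary polynomials.\<close>

definition mdeg_le :: "nat \<Rightarrow> ('k::zero, 'v) mpoly \<Rightarrow> bool" where
  "mdeg_le d f \<longleftrightarrow> (\<forall>m\<in>Poly_Mapping.keys f. mdeg m \<le> d)"

lemma mdeg_le_mono: "mdeg_le d f \<Longrightarrow> d \<le> e \<Longrightarrow> mdeg_le e f"
  by (auto simp: mdeg_le_def)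

lemma mdeg_le_mult:
  fixes f g :: "('k::comm_ring_1, 'v::finite) mpoly"
  shows "mdeg_le d f \<Longrightarrow> mdeg_le e g \<Longrightarrow> mdeg_le (d + e) (f * g)"
  using keys_mult[of f g] by (fastforce simp: mdeg_le_def mdeg_add intro: add_mono)

lemma mdeg_le_power:
  fixes f :: "('k::comm_ring_1, 'v::finite) mpoly"
  shows "mdeg_le d f \<Longrightarrow> mdeg_le (n * d) (f ^ n)"
proof (induction n)
  case 0
  then show ?case by (simp add: mdeg_le_def mdeg_def)
qed (auto intro: mdeg_le_mult)

lemma mdeg_le_exists: "\<exists>d. mdeg_le d f"
  \<comment> \<open>For the zero polynomial this is \<open>Max\<close> of the empty set, but then
    the bound is vacuous.\<close>
  by (intro exI[of _ "Max (mdeg ` Poly_Mapping.keys f)"]) (simp add: mdeg_le_def)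

text \<open>Modulo \<open>I\<close>, a square \<open>x\<^sub>j\<^sup>2\<close> with \<open>j \<in> J\<close> is a quadratic form in the remaining variables, so the
  monomials that are squarefree in the variables from \<open>J\<close> span the quotient by \<open>I\<close>.\<close>

definition reduced_exponents :: "'v set \<Rightarrow> nat \<Rightarrow> ('v \<Rightarrow>\<^sub>0 nat) set" where
  "reduced_exponents J d = {m. mdeg m \<le> d \<and> (\<forall>j\<in>J. Poly_Mapping.lookup m j \<le> 1)}"

text \<open>Such exponents lie in a box with sides \<open>{..1}\<close> in the directions of
  \<open>J\<close> and \<open>{..d}\<close> in the others. The growth in \<open>d\<close> is thus
  governed by the number of variables outside \<open>J\<close>.\<close>

lemma reduced_exponents_card:
  fixes J :: "'v::finite set"
  shows "finite (reduced_exponents J d)"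
    and "card (reduced_exponents J d) \<le> 2 ^ card J * (d + 1) ^ card (- J)"
proof -
  let ?S = "PiE UNIV (\<lambda>i. if i \<in> J then {..1} else {..d})"
  have le: "Poly_Mapping.lookup m i \<le> mdeg m" for m and i :: 'v
    unfolding mdeg_eq by (rule member_le_sum) auto
  have img: "Poly_Mapping.lookup ` reduced_exponents J d \<subseteq> ?S"
    using le order_trans by (fastforce simp: reduced_exponents_def)
  have inj: "inj_on Poly_Mapping.lookup (reduced_exponents J d)"
    by (auto intro: inj_onI poly_mapping_eqI)
  have fin: "finite ?S" by (intro finite_PiE) auto
  show "finite (reduced_exponents J d)"
    using finite_imageD[OF finite_subset[OF img fin] inj] .
  have "card (reduced_exponents J d) \<le> card ?S"
    using card_inj_on_le[OF inj img fin] .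
  also have "card ?S = (\<Prod>i\<in>UNIV. if i \<in> J then 2 else d + 1)"
    by (simp add: card_PiE if_distrib numeral_2_eq_2 cong: if_cong)
  also have "\<dots> = 2 ^ card J * (d + 1) ^ card (- J)"
    by (subst prod.If_cases) (simp_all add: Compl_eq)
  finally show "card (reduced_exponents J d) \<le> 2 ^ card J * (d + 1) ^ card (- J)" .
qed

text \<open>Modulo \<open>I\<close>, squares of variables in \<open>J\<close> can be traded for
  squares of the others. This is used twice: for counting monomials and for finding nonvanishing
  coordinates.\<close>

locale eliminable =
  fixes I :: "('k::field, 'v::{finite,linorder}) mpoly set" and J :: "'v set"
  assumes ideal_I: "ideal I poly_ring"
    and eliminate: "j \<in> J \<Longrightarrow> \<exists>b. Var j ^ 2 - (\<Sum>k\<in>-J. Const (b k) * Var k ^ 2) \<in> I"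
begin

interpretation V: vector_space "\<lambda>c f. Const c * f :: ('k, 'v) mpoly"
  by unfold_locales (simp_all add: Const_add Const_mult algebra_simps)

text \<open>A degree filtration of the quotient by \<open>I\<close>, expressed by congruences so
  that all vectors stay in the polynomial ring.\<close>

definition reduced :: "nat \<Rightarrow> ('k, 'v) mpoly set" where
  "reduced d = {f. \<exists>g\<in>V.span ((\<lambda>m. Poly_Mapping.single m 1) ` reduced_exponents J d). f - g \<in> I}"

lemma reduced_mono:
  assumes "d \<le> e"
  shows "reduced d \<subseteq> reduced e"
proof -
  have "reduced_exponents J d \<subseteq> reduced_exponents J e"
    using assms by (auto simp: reduced_exponents_def)
  then show ?thesis
    unfolding reduced_def by (auto dest: subsetD[OF V.span_mono[OF image_mono]])
qed

lemma reduced_add: "f \<in> reduced d \<Longrightarrow> g \<in> reduced d \<Longrightarrow> f + g \<in> reduced d"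
  unfolding reduced_def
proof clarify
  fix f' g' assume "f' \<in> V.span ((\<lambda>m. Poly_Mapping.single m 1) ` reduced_exponents J d)" "f - f' \<in> I"
    "g' \<in> V.span ((\<lambda>m. Poly_Mapping.single m 1) ` reduced_exponents J d)" "g - g' \<in> I"
  then show "\<exists>h\<in>V.span ((\<lambda>m. Poly_Mapping.single m 1) ` reduced_exponents J d). f + g - h \<in> I"
    using ideal_add[OF ideal_I, of "f - f'" "g - g'"]
    by (intro bexI[of _ "f' + g'"] V.span_add) (auto simp: algebra_simps)
qed

lemma reduced_Const: "f \<in> reduced d \<Longrightarrow> Const c * f \<in> reduced d"
  unfolding reduced_def
proof clarify
  fix f' assume "f' \<in> V.span ((\<lambda>m. Poly_Mapping.single m 1) ` reduced_exponents J d)" "f - f' \<in> I"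
  then show "\<exists>h\<in>V.span ((\<lambda>m. Poly_Mapping.single m 1) ` reduced_exponents J d). Const c * f - h \<in> I"
    using ideal_mult_left[OF ideal_I, of "f - f'" "Const c"]
    by (intro bexI[of _ "Const c * f'"] V.span_scale) (auto simp: algebra_simps)
qed

lemma reduced_0: "0 \<in> reduced d"
  using ideal_zero[OF ideal_I] V.span_zero unfolding reduced_def by (auto intro!: bexI[of _ 0])

lemma reduced_sum: "(\<And>i. i \<in> A \<Longrightarrow> f i \<in> reduced d) \<Longrightarrow> sum f A \<in> reduced d"
  by (induction A rule: infinite_finite_induct) (auto intro: reduced_0 reduced_add)

lemma reduced_cong: "f - g \<in> I \<Longrightarrow> g \<in> reduced d \<Longrightarrow> f \<in> reduced d"
  unfolding reduced_def
proof clarify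
  fix h assume "f - g \<in> I" "g - h \<in> I" "h \<in> V.span ((\<lambda>m. Poly_Mapping.single m 1) ` reduced_exponents J d)"
  then show "\<exists>h\<in>V.span ((\<lambda>m. Poly_Mapping.single m 1) ` reduced_exponents J d). f - h \<in> I"
    using ideal_add[OF ideal_I, of "f - g" "g - h"] by (intro bexI[of _ h]) auto
qed

lemma reduced_base: "m \<in> reduced_exponents J d \<Longrightarrow> Poly_Mapping.single m 1 \<in> reduced d"
  using ideal_zero[OF ideal_I] unfolding reduced_def
  by (auto intro!: bexI[of _ "Poly_Mapping.single m 1"] V.span_base)

text \<open>If the product stops being squarefree in \<open>v\<close>, the factor
  \<open>Var v ^ 2\<close> is replaced by squares \<open>Var k ^ 2\<close> of the same degree. One
  replacement suffices: \<open>k\<close> lies outside \<open>J\<close>, where exponents are bounded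
  only by the degree.\<close>

lemma Var_mult_base:
  assumes m: "m \<in> reduced_exponents J d"
  shows "Var v * Poly_Mapping.single m 1 \<in> reduced (Suc d)"
proof (cases "v \<in> J \<and> Poly_Mapping.lookup m v = 1")
  case False
  then have "Poly_Mapping.single v 1 + m \<in> reduced_exponents J (Suc d)"
    using m by (auto simp: reduced_exponents_def mdeg_add mdeg_single lookup_add lookup_single when_def le_Suc_eq)
  then show ?thesis
    using reduced_base by (simp add: Var_def Poly_Mapping.mult_single)
next
  case True
  define m' where "m' = m - Poly_Mapping.single v 1"
  have m': "m = Poly_Mapping.single v 1 + m'"
    by (rule poly_mapping_eqI) (use True in \<open>auto simp: m'_def lookup_add lookup_minus lookup_single when_def\<close>)
  have deg: "mdeg m = Suc (mdeg m')"
    by (subst m') (simp add: mdeg_add mdeg_single)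
  obtain b where b: "Var v ^ 2 - (\<Sum>k\<in>-J. Const (b k) * Var k ^ 2) \<in> I"
    using eliminate True by blast
  have eq: "Var v * Poly_Mapping.single m 1 = Var v ^ 2 * (Poly_Mapping.single m' 1 :: ('k, 'v) mpoly)"
    unfolding m' by (simp add: Var_def power2_eq_square Poly_Mapping.mult_single add_ac)
  have "Poly_Mapping.single (Poly_Mapping.single k 2 + m') (1 :: 'k) \<in> reduced (Suc d)" if "k \<in> -J" for k
    using m True that deg unfolding m' reduced_exponents_def
    by (intro reduced_base) (fastforce simp: reduced_exponents_def mdeg_add mdeg_single lookup_add lookup_single when_def)
  then have red: "(\<Sum>k\<in>-J. Const (b k) * Poly_Mapping.single (Poly_Mapping.single k 2 + m') 1) \<in> reduced (Suc d)"
    by (intro reduced_sum reduced_Const)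
  have eq': "(\<Sum>k\<in>-J. Const (b k) * Poly_Mapping.single (Poly_Mapping.single k 2 + m') 1) =
      (\<Sum>k\<in>-J. Const (b k) * Var k ^ 2) * (Poly_Mapping.single m' 1 :: ('k, 'v) mpoly)"
    by (simp add: Var_power sum_distrib_right mult.assoc Poly_Mapping.mult_single)
  have "Var v * Poly_Mapping.single m 1 -
      (\<Sum>k\<in>-J. Const (b k) * Var k ^ 2) * (Poly_Mapping.single m' 1 :: ('k, 'v) mpoly) \<in> I"
    unfolding eq using ideal_mult_right[OF ideal_I b] by (simp add: left_diff_distrib)
  then show ?thesis by (rule reduced_cong) (use red eq' in simp)
qed

lemma reduced_Var:
  assumes "f \<in> reduced d"
  shows "Var v * f \<in> reduced (Suc d)"
proof -
  obtain g where g: "g \<in> V.span ((\<lambda>m. Poly_Mapping.single m 1) ` reduced_exponents J d)" "f - g \<in> I"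
    using assms by (auto simp: reduced_def)
  have "Var v * g \<in> reduced (Suc d)"
    using g(1)
  proof (induction rule: V.span_induct_alt)
    case base
    then show ?case by (simp add: reduced_0)
  next
    case (step c x y)
    then obtain m where "m \<in> reduced_exponents J d" "x = Poly_Mapping.single m 1" by blast
    then have "Const c * (Var v * x) + Var v * y \<in> reduced (Suc d)"
      using step(2) Var_mult_base by (intro reduced_add reduced_Const) simp_all
    then show ?case by (simp add: algebra_simps)
  qed
  moreover have "Var v * f - Var v * g \<in> I"
    using ideal_mult_left[OF ideal_I g(2)] by (simp add: right_diff_distrib)
  ultimately show ?thesis by (rule reduced_cong[rotated])
qed

lemma reduced_single: "mdeg m \<le> d \<Longrightarrow> Poly_Mapping.single m c \<in> reduced d"
proof -
  have one: "1 \<in> reduced 0"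
    using reduced_base[of 0 0] unfolding reduced_exponents_def mdeg_def by simp
  have pow: "f \<in> reduced d \<Longrightarrow> Var i ^ n * f \<in> reduced (n + d)" for i n f d
  proof (induction n)
    case (Suc n)
    then show ?case using reduced_Var[of "Var i ^ n * f" "n + d" i] by (simp add: mult.assoc)
  qed simp
  have "(\<Prod>i\<in>B. Var i ^ e i) \<in> reduced (\<Sum>i\<in>B. e i)" if "finite B" for B e
    using that by (induction B) (simp_all add: one pow)
  then have "Poly_Mapping.single m c \<in> reduced (mdeg m)"
    unfolding single_eq_monomial mdeg_eq by (intro reduced_Const) simp
  then show "mdeg m \<le> d \<Longrightarrow> Poly_Mapping.single m c \<in> reduced d"
    using reduced_mono by blast
qed

lemma mdeg_le_reduced: "mdeg_le d f \<Longrightarrow> f \<in> reduced d"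
  using reduced_sum[of "Poly_Mapping.keys f" "\<lambda>m. Poly_Mapping.single m (Poly_Mapping.lookup f m)" d]
  by (simp add: sum_monomials mdeg_le_def reduced_single)

text \<open>A dimension count: there are \<open>(N + 1)^4\<close> products with exponents up to
  \<open>N\<close>, all of degree at most \<open>d = 4 * N * e\<close>, and they lie, modulo
  \<open>I\<close>, in a space spanned by at most \<open>2 ^ card J * (d + 1)^3\<close>
  monomials.\<close>

lemma algebraic_relation:
  assumes J: "card (- J) = 3"
  obtains A :: "(nat \<times> nat \<times> nat \<times> nat) set" and c where "finite A" "A \<noteq> {}"
    "\<And>a. a \<in> A \<Longrightarrow> c a \<noteq> 0"
    "(\<Sum>(i, j, k, l)\<in>A. Const (c (i, j, k, l)) * f0 ^ i * f1 ^ j * f2 ^ k * f3 ^ l) \<in> I"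
proof -
  obtain e0 e1 e2 e3 where e': "mdeg_le e0 f0" "mdeg_le e1 f1" "mdeg_le e2 f2" "mdeg_le e3 f3"
    using mdeg_le_exists by metis
  define e where "e = e0 + e1 + e2 + e3"
  have e: "mdeg_le e f0" "mdeg_le e f1" "mdeg_le e f2" "mdeg_le e f3"
    using e'[THEN mdeg_le_mono, of e] by (simp_all add: e_def)
  \<comment> \<open>Chosen so that \<open>d + 1 \<le> (4 * e + 1) * (N + 1)\<close> bounds the
    number of spanning monomials by \<open>N * (N + 1)^3\<close>, which is less than
    \<open>(N + 1)^4\<close>.\<close>
  define N where "N = 2 ^ card J * (4 * e + 1) ^ 3"
  define d where "d = 4 * (N * e)"
  define E where "E = {..N} \<times> {..N} \<times> {..N} \<times> {..N}"
  define W where "W = (\<lambda>m. Poly_Mapping.single m (1 :: 'k)) ` reduced_exponents J d"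
  let ?F = "\<lambda>(i, j, k, l). f0 ^ i * f1 ^ j * f2 ^ k * f3 ^ l"
  have "mdeg_le d (?F a)" if aE: "a \<in> E" for a
  proof -
    obtain i j k l where a: "a = (i, j, k, l)" "i \<le> N" "j \<le> N" "k \<le> N" "l \<le> N"
      using aE unfolding E_def by blast
    have "mdeg_le (i * e + j * e + k * e + l * e) (?F a)"
      unfolding a prod.case by (intro mdeg_le_mult mdeg_le_power e)
    moreover have "i * e + j * e + k * e + l * e \<le> d"
      using mult_le_mono1[OF a(2), of e] mult_le_mono1[OF a(3), of e] mult_le_mono1[OF a(4), of e]
        mult_le_mono1[OF a(5), of e] unfolding d_def by linarith
    ultimately show ?thesis by (rule mdeg_le_mono)
  qed
  then have ex: "\<forall>a\<in>E. \<exists>g. g \<in> V.span W \<and> ?F a - g \<in> I"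
    using mdeg_le_reduced unfolding reduced_def W_def mem_Collect_eq Bex_def by blast
  from bchoice[OF ex] obtain w where w': "\<forall>a\<in>E. w a \<in> V.span W \<and> ?F a - w a \<in> I"
    by (elim exE) (rule that)
  then have w: "\<And>a. a \<in> E \<Longrightarrow> w a \<in> V.span W" "\<And>a. a \<in> E \<Longrightarrow> ?F a - w a \<in> I"
    by blast+
  have "card W \<le> 2 ^ card J * (d + 1) ^ 3"
    using reduced_exponents_card[of J d] card_image_le[of "reduced_exponents J d"]
    unfolding W_def J by (meson order_trans)
  also have "d + 1 \<le> (4 * e + 1) * (N + 1)" by (simp add: d_def algebra_simps)
  then have "2 ^ card J * (d + 1) ^ 3 \<le> 2 ^ card J * ((4 * e + 1) * (N + 1)) ^ 3"
    by (intro mult_le_mono2 power_mono) auto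
  also have "\<dots> = N * (N + 1) ^ 3" unfolding N_def by (simp only: power_mult_distrib mult.assoc)
  also have "\<dots> < (N + 1) * (N + 1) ^ 3" by (intro mult_strict_right_mono) auto
  also have "\<dots> = card E" by (simp add: E_def power3_eq_cube)
  finally have lt: "card W < card E" .
  have "finite E" "finite W" by (simp_all add: E_def W_def reduced_exponents_card)
  then obtain c where c: "\<exists>a\<in>E. c a \<noteq> 0" "(\<Sum>a\<in>E. Const (c a) * w a) = 0"
    using dependent_family[OF V.vector_space_axioms, of E W w] w(1) lt by blast
  have "(\<Sum>a\<in>E. Const (c a) * (?F a - w a)) \<in> I"
    by (intro ideal_sum[OF ideal_I] ideal_mult_left[OF ideal_I] w(2))
  then have "(\<Sum>a\<in>E. Const (c a) * ?F a) \<in> I"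
    by (simp add: right_diff_distrib sum_subtractf c(2))
  \<comment> \<open>Terms with zero coefficient are dropped, because the lowest term must have a
    coefficient outside the irrelevant ideal.\<close>
  also have "(\<Sum>a\<in>E. Const (c a) * ?F a) = (\<Sum>a\<in>{a\<in>E. c a \<noteq> 0}. Const (c a) * ?F a)"
    by (rule sum.mono_neutral_right) (use \<open>finite E\<close> in auto)
  also have "\<dots> = (\<Sum>(i, j, k, l)\<in>{a\<in>E. c a \<noteq> 0}. Const (c (i, j, k, l)) * f0 ^ i * f1 ^ j * f2 ^ k * f3 ^ l)"
    by (simp add: case_prod_beta mult.assoc)
  finally show ?thesis by (rule that[rotated 3]) (use c(1) \<open>finite E\<close> in auto)
qed

text \<open>A chain of length 3 gives four primes in reverse order. Together with the irrelevant
  ideal above them there are four strict steps; one element from each step contradicts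
  \<open>algebraic_relation\<close>.\<close>

lemma chain_length_le:
  assumes J: "card (- J) = 3"
    and Z: "\<And>i. i \<le> n \<Longrightarrow> closedin (zariski_topology I) (Z i) \<and> irreducible_subset (zariski_topology I) (Z i)"
      "\<And>i. i < n \<Longrightarrow> Z i \<subset> Z (Suc i)"
  shows "n \<le> 2"
proof (rule ccontr)
  assume "\<not> n \<le> 2"
  then have n: "3 \<le> n" by simp
  have props: "primeideal (\<Inter>(Z i)) poly_ring" "I \<subseteq> \<Inter>(Z i)" "\<Inter>(Z i) \<subseteq> irrelevant_ideal"
    "\<not> range Var \<subseteq> \<Inter>(Z i)" "Z i = {P \<in> proj_points I. \<Inter>(Z i) \<subseteq> P}" if "i \<le> n" for i
    using irreducible_closed_prime[of I "Z i"] Z(1)[OF that] by blast+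
  have less: "\<Inter>(Z (Suc i)) \<subset> \<Inter>(Z i)" if "i < n" for i
  proof
    show "\<Inter>(Z (Suc i)) \<subseteq> \<Inter>(Z i)" using Z(2)[OF that] by (intro Inter_anti_mono) blast
    show "\<Inter>(Z (Suc i)) \<noteq> \<Inter>(Z i)"
      using Z(2)[OF that] props(5)[of i] props(5)[of "Suc i"] that by (metis Suc_leI less_imp_le psubsetE)
  qed
  \<comment> \<open>The last step, from the largest prime to the irrelevant ideal, is strict because
    a point of projective space misses some variable.\<close>
  obtain v where v: "Var v \<notin> \<Inter>(Z 0)" using props(4)[of 0] by blast
  have v': "Var v \<in> irrelevant_ideal - \<Inter>(Z 0)"
    using homogeneous_pos_irrelevant[OF homogeneous_Var] v by simp
  have l: "\<Inter>(Z 3) \<subset> \<Inter>(Z 2)" "\<Inter>(Z 2) \<subset> \<Inter>(Z 1)" "\<Inter>(Z 1) \<subset> \<Inter>(Z 0)"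
    using less[of 0] less[of 1] less[of 2] n by (simp_all add: numeral_2_eq_2 numeral_3_eq_3)
  obtain f0 where f0: "f0 \<in> \<Inter>(Z 2) - \<Inter>(Z 3)" using psubset_imp_ex_mem[OF l(1)] ..
  obtain f1 where f1: "f1 \<in> \<Inter>(Z 1) - \<Inter>(Z 2)" using psubset_imp_ex_mem[OF l(2)] ..
  obtain f2 where f2: "f2 \<in> \<Inter>(Z 0) - \<Inter>(Z 1)" using psubset_imp_ex_mem[OF l(3)] ..
  obtain A c where A: "finite A" "A \<noteq> {}" "\<And>a. a \<in> A \<Longrightarrow> c a \<noteq> 0"
    "(\<Sum>(i, j, k, l)\<in>A. Const (c (i, j, k, l)) * f0 ^ i * f1 ^ j * f2 ^ k * Var v ^ l) \<in> I"
    by (rule algebraic_relation[OF J, of f0 f1 f2 "Var v"]) (rule that)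
  have "(\<Sum>(i, j, k, l)\<in>A. Const (c (i, j, k, l)) * f0 ^ i * f1 ^ j * f2 ^ k * Var v ^ l) \<notin> \<Inter>(Z 3)"
  proof (rule prime_chain_independent[of "\<Inter>(Z 3)" "\<Inter>(Z 2)" "\<Inter>(Z 1)" "\<Inter>(Z 0)" irrelevant_ideal
      f0 f1 f2 "Var v" A "\<lambda>a. Const (c a)"])
    show "primeideal (\<Inter>(Z 3)) poly_ring" "primeideal (\<Inter>(Z 2)) poly_ring"
      "primeideal (\<Inter>(Z 1)) poly_ring" "primeideal (\<Inter>(Z 0)) poly_ring"
      by (rule props(1); use n in simp)+
    show "\<Inter>(Z 3) \<subseteq> \<Inter>(Z 2)" "\<Inter>(Z 2) \<subseteq> \<Inter>(Z 1)" "\<Inter>(Z 1) \<subseteq> \<Inter>(Z 0)"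
      using l by auto
    show "Const (c a) \<notin> irrelevant_ideal" if "a \<in> A" for a
      using A(3)[OF that] by (simp add: Const_irrelevant)
  qed (use props(3) f0 f1 f2 v' A(1,2) ideal_irrelevant in simp_all)
  then show False using A(4) props(2)[of 3] n by blast
qed

end

section \<open>Points with coordinates in a domain\<close>

context comm_ring_hom1
begin

lemma hom_const_poly: "comm_ring_hom1 (\<lambda>c. [:h c:])"
  by unfold_locales (simp_all add: hom_simps mult.commute)

lemma meval_comp:
  assumes "comm_ring_hom1 g"
  shows "g (meval h a f) = meval (\<lambda>c. g (h c)) (\<lambda>i. g (a i)) f"
proof -
  interpret g: comm_ring_hom1 g by fact
  interpret gh: comm_ring_hom1 "\<lambda>c. g (h c)" by unfold_locales (simp_all add: hom_simps g.hom_simps)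
  show ?thesis
    by (induction f rule: mpoly_induct) (simp_all add: meval_simps gh.meval_simps g.hom_simps)
qed

text \<open>Every coordinate carries one factor of the formal variable, so a form of degree
  \<open>d\<close> picks up its \<open>d\<close>-th power.\<close>

lemma meval_graded:
  assumes "homogeneous d f"
  shows "meval (\<lambda>c. [:h c:]) (\<lambda>i. monom (a i) 1) f = monom (meval h a f) d"
proof -
  interpret p: comm_ring_hom1 "\<lambda>c. [:h c:]" by (rule hom_const_poly)
  show ?thesis
    using assms
    by (induction rule: homogeneous_induct)
      (simp_all add: meval_simps p.meval_simps monom_0 add_monom mult_monom)
qed

end

text \<open>The homogeneous prime of the point with homogeneous coordinates \<open>a\<close> in a domain: attaching a
  formal variable to each coordinate makes the vanishing ideal homogeneous.\<close>

definition point_ideal :: "('k::field \<Rightarrow> 'b::idom) \<Rightarrow> ('v \<Rightarrow> 'b) \<Rightarrow> ('k, 'v::{finite,linorder}) mpoly set" where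
  "point_ideal h a = {f. meval (\<lambda>c. [:h c:]) (\<lambda>i. monom (a i) 1) f = 0}"

lemma point_ideal_homogeneous_iff:
  assumes "comm_ring_hom1 h" "homogeneous d f"
  shows "f \<in> point_ideal h a \<longleftrightarrow> meval h a f = 0"
  using comm_ring_hom1.meval_graded[OF assms] by (simp add: point_ideal_def)

lemma primeideal_meval_kernel:
  fixes h :: "'k::field \<Rightarrow> 'b::idom" and a :: "'v::{finite,linorder} \<Rightarrow> 'b"
  assumes "comm_ring_hom1 h"
  shows "primeideal {f. meval h a f = 0} ring_of_type_algebra"
proof -
  interpret comm_ring_hom1 h by fact
  show ?thesis
    using meval_Const[of a 1]
    by (auto simp: primeideal_type_algebra_iff ideal_type_algebra_iff meval_simps hom_1)
qed

text \<open>The coefficient of the formal variable in degree \<open>e\<close> is the value of the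
  component of degree \<open>e\<close>. If the total vanishes, so does every component, hence the
  kernel is generated by homogeneous elements.\<close>

lemma point_ideal_proj_points:
  fixes a :: "'v::{finite,linorder} \<Rightarrow> 'b::idom"
  assumes h: "comm_ring_hom1 (h :: 'k::field \<Rightarrow> 'b)" and I: "I \<subseteq> point_ideal h a" and a: "a i \<noteq> 0"
  shows "point_ideal h a \<in> proj_points I"
proof -
  interpret comm_ring_hom1 h by fact
  interpret p: comm_ring_hom1 "\<lambda>c. [:h c:]" by (rule hom_const_poly)
  let ?K = "point_ideal h a :: ('k, 'v) mpoly set"
  have prime: "primeideal ?K poly_ring"
    unfolding point_ideal_def by (rule primeideal_meval_kernel[OF hom_const_poly])
  note id = prime_ideal[OF prime]
  have gen: "?K \<subseteq> Idl\<^bsub>poly_ring\<^esub> {f \<in> ?K. \<exists>d. homogeneous d f}"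
  proof
    fix f :: "('k, 'v) mpoly" assume f: "f \<in> ?K"
    obtain D where D: "finite D" "(\<Sum>d\<in>D. hcomp d f) = f" using sum_hcomp[of f] by blast
    have "0 = meval (\<lambda>c. [:h c:]) (\<lambda>i. monom (a i) 1) f" using f by (simp add: point_ideal_def)
    also have "\<dots> = (\<Sum>d\<in>D. monom (meval h a (hcomp d f)) d)"
      by (subst D(2)[symmetric]) (simp only: p.meval_sum meval_graded[OF homogeneous_hcomp])
    finally have z: "(\<Sum>d\<in>D. monom (meval h a (hcomp d f)) d) = 0" by simp
    have K: "hcomp e f \<in> ?K" if "e \<in> D" for e
    proof -
      have "0 = coeff (\<Sum>d\<in>D. monom (meval h a (hcomp d f)) d) e" by (simp add: z)
      also have "\<dots> = meval h a (hcomp e f)"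
        using D(1) that by (simp add: coeff_sum)
      finally show ?thesis
        using point_ideal_homogeneous_iff[OF h homogeneous_hcomp] by metis
    qed
    have "hcomp e f \<in> Idl\<^bsub>poly_ring\<^esub> {f \<in> ?K. \<exists>d. homogeneous d f}" if "e \<in> D" for e
      by (intro subsetD[OF genideal_superset_type] CollectI conjI exI[of _ e] homogeneous_hcomp K that)
    then have "(\<Sum>d\<in>D. hcomp d f) \<in> Idl\<^bsub>poly_ring\<^esub> {f \<in> ?K. \<exists>d. homogeneous d f}"
      by (rule ideal_sum[OF genideal_ideal_type])
    then show "f \<in> Idl\<^bsub>poly_ring\<^esub> {f \<in> ?K. \<exists>d. homogeneous d f}" by (simp add: D(2))
  qed
  moreover have "Idl\<^bsub>poly_ring\<^esub> {f \<in> ?K. \<exists>d. homogeneous d f} \<subseteq> ?K"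
    by (rule genideal_least_type[OF id]) blast
  ultimately have "homogeneous_ideal ?K" using id by (simp add: homogeneous_ideal_def)
  moreover have "Var i \<notin> ?K"
    using a point_ideal_homogeneous_iff[OF h homogeneous_Var, of i a] by (simp add: meval_Var)
  ultimately show ?thesis using prime I by (auto simp: proj_points_def)
qed

text \<open>A form that vanishes at \<open>a\<close> also vanishes at the image of \<open>a\<close>
  under \<open>g\<close>; forms suffice since the smaller ideal is homogeneous.\<close>

lemma point_ideal_specialize:
  fixes a :: "'v::{finite,linorder} \<Rightarrow> 'b::idom" and h :: "'k::field \<Rightarrow> 'b"
  assumes h: "comm_ring_hom1 h" and g: "comm_ring_hom1 (g :: 'b \<Rightarrow> 'c::idom)" and a: "a i \<noteq> 0"
  shows "point_ideal h a \<subseteq> point_ideal (\<lambda>c. g (h c)) (\<lambda>i. g (a i))"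
proof -
  interpret h: comm_ring_hom1 h by fact
  interpret g: comm_ring_hom1 g by fact
  have gh: "comm_ring_hom1 (\<lambda>c. g (h c))" by unfold_locales (simp_all add: h.hom_simps g.hom_simps)
  \<comment> \<open>The empty set of equations is used to obtain homogeneity of the ideal.\<close>
  have "point_ideal h a \<in> proj_points {}"
    using h a by (intro point_ideal_proj_points) auto
  then have "homogeneous_ideal (point_ideal h a)" by (rule proj_pointsD(2))
  then have "point_ideal h a = Idl\<^bsub>poly_ring\<^esub> {f \<in> point_ideal h a. \<exists>d. homogeneous d f}"
    unfolding homogeneous_ideal_def by blast
  also have "\<dots> \<subseteq> point_ideal (\<lambda>c. g (h c)) (\<lambda>i. g (a i))"
  proof (rule genideal_least_type)
    show "ideal (point_ideal (\<lambda>c. g (h c)) (\<lambda>i. g (a i))) poly_ring"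
      unfolding point_ideal_def
      by (rule prime_ideal[OF primeideal_meval_kernel[OF comm_ring_hom1.hom_const_poly[OF gh]]])
    have "f \<in> point_ideal (\<lambda>c. g (h c)) (\<lambda>i. g (a i))" if "f \<in> point_ideal h a" "homogeneous d f" for f d
      using that point_ideal_homogeneous_iff[OF h] point_ideal_homogeneous_iff[OF gh]
        h.meval_comp[OF g, of a f] g.hom_0 by metis
    then show "{f \<in> point_ideal h a. \<exists>d. homogeneous d f} \<subseteq> point_ideal (\<lambda>c. g (h c)) (\<lambda>i. g (a i))" by blast
  qed
  finally show ?thesis .
qed

text \<open>The chain consists of the closures of the three points. Closures reverse inclusion, so
  \<open>Z 0\<close> belongs to the largest prime \<open>P2\<close>.\<close>

lemma krull_dim_ge_2:
  assumes P: "P0 \<in> proj_points I" "P1 \<in> proj_points I" "P2 \<in> proj_points I" "P0 \<subset> P1" "P1 \<subset> P2"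
  shows "enat 2 \<le> krull_dim (zariski_topology I)"
proof -
  define Z where "Z n = {Q \<in> proj_points I. (if n = 0 then P2 else if n = 1 then P1 else P0) \<subseteq> Q}" for n :: nat
  have "closedin (zariski_topology I) (Z i)" for i
    unfolding closedin_zariski Z_def by (rule exI) (rule refl)
  moreover have "irreducible_subset (zariski_topology I) (Z i)" for i
    unfolding Z_def by (rule irreducible_closure_point) (simp add: P)
  moreover have "Z i \<subset> Z (Suc i)" if "i < 2" for i
  proof -
    have "i = 0 \<or> i = 1" using that by auto
    then show ?thesis
    proof
      assume "i = 0"
      then show ?thesis using P by (auto simp: Z_def)
    next
      assume "i = 1"
      then show ?thesis using P by (auto simp: Z_def)
    qed
  qed
  ultimately have "\<exists>Z. (\<forall>i\<le>2. closedin (zariski_topology I) (Z i) \<and> irreducible_subset (zariski_topology I) (Z i)) \<and>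
      (\<forall>i<2. Z i \<subset> Z (Suc i))"
    by (intro exI[of _ Z] conjI allI impI)
  then show ?thesis
    unfolding krull_dim_def by (intro Sup_upper CollectI exI[of _ 2] conjI refl)
qed

text \<open>Such an \<open>I\<close> is the generic point of the scheme that it defines, from which
  irreducibility of the whole space follows.\<close>

lemma generated_proj_points:
  assumes I: "I = Idl\<^bsub>poly_ring\<^esub> Q" and Q: "\<And>q. q \<in> Q \<Longrightarrow> \<exists>d. homogeneous d q"
    and prime: "primeideal I poly_ring" and V: "Var i \<notin> I"
  shows "I \<in> proj_points I"
proof -
  have Q_sub: "Q \<subseteq> I" unfolding I by (rule genideal_superset_type)
  have "I \<subseteq> Idl\<^bsub>poly_ring\<^esub> {f \<in> I. \<exists>d. homogeneous d f}"
    by (subst I) (intro genideal_least_type genideal_ideal_type subset_trans[OF _ genideal_superset_type],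
        use Q Q_sub in blast)
  moreover have "Idl\<^bsub>poly_ring\<^esub> {f \<in> I. \<exists>d. homogeneous d f} \<subseteq> I"
    by (rule genideal_least_type[OF prime_ideal[OF prime]]) blast
  ultimately have "homogeneous_ideal I"
    using prime_ideal[OF prime] by (simp add: homogeneous_ideal_def)
  then show ?thesis using prime V by (auto simp: proj_points_def)
qed

lemma irreducible_space_zariski:
  assumes "I \<in> proj_points I"
  shows "irreducible_space (zariski_topology I)"
proof -
  have "{Q \<in> proj_points I. I \<subseteq> Q} = topspace (zariski_topology I)"
    by (auto simp: topspace_zariski proj_points_def)
  then show ?thesis
    using irreducible_closure_point[OF assms] by (simp add: irreducible_subset_def subtopology_topspace)
qed

lemma irreducible_component_irreducible_space:
  assumes T: "irreducible_space T"
  shows "irreducible_component T Z \<longleftrightarrow> Z = topspace T"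
proof -
  have top: "irreducible_subset T (topspace T)"
    using T by (simp add: irreducible_subset_def subtopology_topspace)
  show ?thesis
    using top unfolding irreducible_component_def by (metis irreducible_subset_def subset_antisym)
qed

section \<open>Adjoining square roots\<close>

text \<open>A predicate on subsets, since the tower of square roots is built twice inside fixed
  rings: in the polynomial ring and in its image in a field.\<close>

definition subring_set :: "'a::comm_ring_1 set \<Rightarrow> bool" where
  "subring_set T \<longleftrightarrow> 1 \<in> T \<and> (\<forall>a\<in>T. \<forall>b\<in>T. a + b \<in> T \<and> a - b \<in> T \<and> a * b \<in> T)"

lemma subring_setD:
  assumes "subring_set T"
  shows "1 \<in> T" "0 \<in> T" "a \<in> T \<Longrightarrow> b \<in> T \<Longrightarrow> a + b \<in> T" "a \<in> T \<Longrightarrow> b \<in> T \<Longrightarrow> a - b \<in> T"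
    "a \<in> T \<Longrightarrow> b \<in> T \<Longrightarrow> a * b \<in> T" "a \<in> T \<Longrightarrow> a ^ n \<in> T" "a \<in> T \<Longrightarrow> - a \<in> T"
proof -
  have *: "1 \<in> T" "\<And>a b. a \<in> T \<Longrightarrow> b \<in> T \<Longrightarrow> a + b \<in> T" "\<And>a b. a \<in> T \<Longrightarrow> b \<in> T \<Longrightarrow> a - b \<in> T"
    "\<And>a b. a \<in> T \<Longrightarrow> b \<in> T \<Longrightarrow> a * b \<in> T"
    using assms by (auto simp: subring_set_def)
  show "1 \<in> T" "a \<in> T \<Longrightarrow> b \<in> T \<Longrightarrow> a + b \<in> T" "a \<in> T \<Longrightarrow> b \<in> T \<Longrightarrow> a - b \<in> T"
    "a \<in> T \<Longrightarrow> b \<in> T \<Longrightarrow> a * b \<in> T" by (fact *)+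
  show z: "0 \<in> T" using *(3)[OF *(1,1)] by simp
  show "a \<in> T \<Longrightarrow> a ^ n \<in> T" by (induction n) (auto intro: *)
  show "a \<in> T \<Longrightarrow> - a \<in> T" using *(3)[OF z] by force
qed

lemma subring_set_image:
  assumes "comm_ring_hom1 h" "subring_set T"
  shows "subring_set (h ` T)"
proof -
  interpret comm_ring_hom1 h by fact
  show ?thesis
    using assms(2) unfolding subring_set_def
    by (auto simp flip: hom_add hom_diff hom_mult) (metis hom_1 imageI)
qed

text \<open>This is the ring generated by \<open>T\<close> and \<open>s\<close> as soon as
  \<open>s ^ 2\<close> lies in the ring \<open>T\<close>.\<close>

definition quad_ext :: "'a::comm_ring_1 set \<Rightarrow> 'a \<Rightarrow> 'a set" where
  "quad_ext T s = {a + b * s | a b. a \<in> T \<and> b \<in> T}"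

lemma quad_ext_image:
  assumes "comm_ring_hom1 h"
  shows "h ` quad_ext T s = quad_ext (h ` T) (h s)"
proof -
  interpret comm_ring_hom1 h by fact
  show ?thesis by (force simp: quad_ext_def hom_add hom_mult)
qed

lemma quad_ext_superset: "subring_set T \<Longrightarrow> T \<subseteq> quad_ext T s"
  unfolding quad_ext_def using subring_setD(2) by force

lemma quad_ext_root: "subring_set T \<Longrightarrow> s \<in> quad_ext T s"
  unfolding quad_ext_def using subring_setD(1,2) by force

lemma subring_quad_ext:
  assumes T: "subring_set T" and s: "s ^ 2 \<in> T"
  shows "subring_set (quad_ext T s)"
  unfolding subring_set_def
proof (intro conjI ballI)
  show "1 \<in> quad_ext T s" using quad_ext_superset[OF T] subring_setD(1)[OF T] by blast
  fix x y assume "x \<in> quad_ext T s" "y \<in> quad_ext T s"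
  then obtain a b c d where x: "x = a + b * s" and y: "y = c + d * s" and T': "a \<in> T" "b \<in> T" "c \<in> T" "d \<in> T"
    by (auto simp: quad_ext_def)
  note cl = subring_setD[OF T]
  have "x + y = (a + c) + (b + d) * s" "x - y = (a - c) + (b - d) * s"
    by (simp_all add: x y algebra_simps)
  moreover have "x * y = (a * c + b * d * s ^ 2) + (a * d + b * c) * s"
    by (simp add: x y algebra_simps power2_eq_square)
  ultimately show "x + y \<in> quad_ext T s" "x - y \<in> quad_ext T s" "x * y \<in> quad_ext T s"
    unfolding quad_ext_def using T' s by (blast intro: cl)+
qed

text \<open>In a domain, \<open>l\<close> is not a square in the field of fractions of \<open>T\<close>.\<close>

definition nonsquare :: "'a::comm_ring_1 set \<Rightarrow> 'a \<Rightarrow> bool" where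
  "nonsquare T l \<longleftrightarrow> (\<forall>a\<in>T. \<forall>b\<in>T. a ^ 2 = l * b ^ 2 \<longrightarrow> b = 0)"

lemma nonsquareD:
  fixes l :: "'a::idom"
  assumes "nonsquare T l" "a \<in> T" "b \<in> T" "a ^ 2 = l * b ^ 2"
  shows "b = 0" "a = 0"
proof -
  show "b = 0" using assms unfolding nonsquare_def by blast
  then show "a = 0" using assms(4) by simp
qed

lemma nonsquare_nonzero:
  fixes l :: "'a::idom"
  assumes "nonsquare T l" "subring_set T"
  shows "l \<noteq> 0"
  using nonsquareD(1)[OF assms(1), of 0 1] subring_setD(1,2)[OF assms(2)] by auto

text \<open>Squaring \<open>a = - (b * s)\<close> turns a linear relation into an equation that
  \<open>nonsquare\<close> excludes.\<close>

lemma quad_ext_independent: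
  fixes s :: "'a::idom"
  assumes l: "nonsquare T (s ^ 2)" and T: "a \<in> T" "b \<in> T" and z: "a + b * s = 0"
  shows "a = 0" "b = 0"
proof -
  have "a = - (b * s)" using z by (simp add: eq_neg_iff_add_eq_0)
  then have "a ^ 2 = s ^ 2 * b ^ 2" by (simp add: power_mult_distrib)
  then show "a = 0" "b = 0" using nonsquareD[OF l T] by auto
qed

text \<open>The induction step of Kummer theory: with \<open>k = s ^ 2\<close>, an element
  \<open>l\<close> that becomes a square after adjoining the root of \<open>k\<close> is, up to
  squares, \<open>1\<close> or \<open>k\<close> already below. The proof compares the coefficients
  of \<open>1\<close> and \<open>s\<close> in \<open>x ^ 2 = l * y ^ 2\<close>; characteristic 0
  allows cancelling 2.\<close>

lemma nonsquare_quad_ext: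
  fixes s l :: "'a::{idom,ring_char_0}"
  assumes T: "subring_set T" and mem: "s ^ 2 \<in> T" "l \<in> T"
    and nsq: "nonsquare T (s ^ 2)" "nonsquare T l" "nonsquare T (s ^ 2 * l)"
  shows "nonsquare (quad_ext T s) l"
  unfolding nonsquare_def
proof (intro ballI impI)
  note cl = subring_setD[OF T]
  fix x y assume "x \<in> quad_ext T s" "y \<in> quad_ext T s" and eq: "x ^ 2 = l * y ^ 2"
  then obtain a b c d where x: "x = a + b * s" and y: "y = c + d * s" and T': "a \<in> T" "b \<in> T" "c \<in> T" "d \<in> T"
    by (auto simp: quad_ext_def)
  define k where "k = s ^ 2"
  let ?A = "a ^ 2 + k * b ^ 2 - l * (c ^ 2 + k * d ^ 2)" and ?B = "2 * a * b - l * (2 * c * d)"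
  have "?A + ?B * s = x ^ 2 - l * y ^ 2"
    by (simp add: x y k_def algebra_simps power2_eq_square)
  then have z: "?A + ?B * s = 0" using eq by simp
  have two: "2 \<in> T" using cl(3)[OF cl(1,1)] by simp
  have in_T: "?A \<in> T" "?B \<in> T"
    by (intro cl(3,4,5,6) mem[folded k_def] T' two)+
  have "?A = 0" "?B = 0"
    using quad_ext_independent[OF nsq(1) in_T z] by auto
  then have A: "l * (c ^ 2 + k * d ^ 2) = a ^ 2 + k * b ^ 2" and "2 * (a * b) = 2 * (l * c * d)"
    by (simp_all add: algebra_simps)
  then have B: "a * b = l * c * d" by simp
  \<comment> \<open>Eliminating \<open>b\<close> between \<open>A\<close> and \<open>B\<close> gives
    a product with one factor for \<open>l\<close> and one for \<open>k * l\<close>, so one of the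
    two forbidden equations holds over \<open>T\<close>.\<close>
  have "(a ^ 2 - l * c ^ 2) * (a ^ 2 - l * k * d ^ 2) =
      a ^ 2 * a ^ 2 - a ^ 2 * (l * (c ^ 2 + k * d ^ 2)) + k * (l * c * d) ^ 2"
    by (simp add: algebra_simps power2_eq_square)
  also have "\<dots> = 0" unfolding A B[symmetric] by (simp add: algebra_simps power2_eq_square)
  finally consider "a ^ 2 = l * c ^ 2" | "a ^ 2 = (k * l) * d ^ 2" by (auto simp: mult_ac)
  then have "c = 0 \<and> d = 0"
  proof cases
    case 1
    then have ac: "c = 0" "a = 0" using nonsquareD[OF nsq(2) T'(1,3)] by auto
    then have "l * (k * d ^ 2) = k * b ^ 2" using A by simp
    then have "k * b ^ 2 = k * (l * d ^ 2)" by (metis mult.left_commute)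
    then have "b ^ 2 = l * d ^ 2"
      using nonsquare_nonzero[OF nsq(1) T] by (simp add: k_def)
    then show ?thesis using ac nonsquareD[OF nsq(2) T'(2,4)] by auto
  next
    case 2
    then have ad: "d = 0" "a = 0" using nonsquareD[OF nsq(3) T'(1,4)] by (auto simp: k_def)
    then have kb: "k * b ^ 2 = l * c ^ 2" using A by simp
    \<comment> \<open>Multiplying \<open>kb\<close> by \<open>k\<close> makes its left side a square
      and exhibits \<open>k * l\<close> on the right.\<close>
    have "(k * b) ^ 2 = k * (k * b ^ 2)" by (simp add: power2_eq_square mult_ac)
    then have "(k * b) ^ 2 = (s ^ 2 * l) * c ^ 2" unfolding kb by (simp add: k_def)
    moreover have "k * b \<in> T" using T' mem by (auto simp: k_def intro: cl)
    ultimately show ?thesis using ad nonsquareD[OF nsq(3) _ T'(3), of "k * b"] by auto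
  qed
  then show "y = 0" by (simp add: y)
qed

lemma kernel_quad_ext:
  fixes h :: "'a::comm_ring_1 \<Rightarrow> 'b::idom"
  assumes h: "comm_ring_hom1 h" and I: "ideal I ring_of_type_algebra"
    and ker: "\<And>f. f \<in> T \<Longrightarrow> h f = 0 \<Longrightarrow> f \<in> I" and nsq: "nonsquare (h ` T) (h x ^ 2)"
    and f: "f \<in> quad_ext T x" "h f = 0"
  shows "f \<in> I"
proof -
  interpret comm_ring_hom1 h by fact
  obtain a b where ab: "f = a + b * x" "a \<in> T" "b \<in> T" using f(1) by (auto simp: quad_ext_def)
  have "h a + h b * h x = 0" using f(2) by (simp add: ab hom_simps)
  then have "h a = 0" "h b = 0" using quad_ext_independent[OF nsq] ab(2,3) by blast+
  then show ?thesis using ker ab ideal_add[OF I] ideal_mult_right[OF I] by simp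
qed

text \<open>The seven conditions are those for all nonempty products of the three squares. Adjoining
  \<open>x\<close> turns them into the three conditions for \<open>y\<close>, \<open>z\<close> and
  \<open>y z\<close>, and adjoining \<open>y\<close> leaves the one for \<open>z\<close>.\<close>

lemma kernel_three_square_roots:
  fixes h :: "'a::comm_ring_1 \<Rightarrow> 'b::{idom,ring_char_0}"
  assumes h: "comm_ring_hom1 h" and I: "ideal I ring_of_type_algebra" and T: "subring_set T"
    and sq: "x ^ 2 \<in> T" "y ^ 2 \<in> T" "z ^ 2 \<in> T"
    and nsq: "nonsquare (h ` T) (h (x ^ 2))" "nonsquare (h ` T) (h (y ^ 2))" "nonsquare (h ` T) (h (z ^ 2))"
      "nonsquare (h ` T) (h (x ^ 2 * y ^ 2))" "nonsquare (h ` T) (h (x ^ 2 * z ^ 2))"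
      "nonsquare (h ` T) (h (y ^ 2 * z ^ 2))" "nonsquare (h ` T) (h (x ^ 2 * y ^ 2 * z ^ 2))"
    and ker: "\<And>f. f \<in> T \<Longrightarrow> h f = 0 \<Longrightarrow> f \<in> I"
    and f: "f \<in> quad_ext (quad_ext (quad_ext T x) y) z" "h f = 0"
  shows "f \<in> I"
proof -
  interpret comm_ring_hom1 h by fact
  define U where "U = quad_ext T x"
  define W where "W = quad_ext U y"
  have T': "subring_set (h ` T)" by (rule subring_set_image[OF h T])
  have U: "subring_set U" unfolding U_def by (rule subring_quad_ext[OF T sq(1)])
  have hU: "subring_set (h ` U)" by (rule subring_set_image[OF h U])
  have img: "h ` U = quad_ext (h ` T) (h x)" "h ` W = quad_ext (h ` U) (h y)"
    unfolding U_def W_def by (simp_all add: quad_ext_image[OF h])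
  have mem: "h x ^ 2 \<in> h ` T" "h y ^ 2 \<in> h ` T" "h z ^ 2 \<in> h ` T"
    using sq by (simp_all flip: hom_power)
  have mem_U: "h y ^ 2 \<in> h ` U" "h z ^ 2 \<in> h ` U"
    using mem quad_ext_superset[OF T'] img(1) by auto
  note n = nsq[unfolded hom_mult hom_power]
  have nU: "nonsquare (h ` U) (h y ^ 2)" "nonsquare (h ` U) (h z ^ 2)" "nonsquare (h ` U) (h y ^ 2 * h z ^ 2)"
    unfolding img(1) by (intro nonsquare_quad_ext T' mem n subring_setD(5)[OF T']; (simp add: n mult.assoc[symmetric])?)+
  have nW: "nonsquare (h ` W) (h z ^ 2)"
    unfolding img(2) by (intro nonsquare_quad_ext hU mem_U nU)
  have "f \<in> I" if "f \<in> U" "h f = 0" for f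
    using kernel_quad_ext[OF h I ker n(1), of f] that by (simp add: U_def)
  then have "f \<in> I" if "f \<in> W" "h f = 0" for f
    using kernel_quad_ext[OF h I _ nU(1), of f] that by (simp add: W_def)
  then show ?thesis
    using kernel_quad_ext[OF h I _ nW, of f] f by (simp add: W_def U_def)
qed

section \<open>Nonsquares in polynomial rings\<close>

text \<open>As \<open>l\<close> does not vanish at \<open>c\<close>, both sides of
  \<open>a ^ 2 = l * b ^ 2\<close> show that \<open>a\<close> and \<open>b\<close> have the same
  order at \<open>c\<close>. After division by that power of the linear factor, evaluation at
  \<open>c\<close> no longer kills \<open>b\<close>.\<close>

lemma nonsquare_poly_eval:
  fixes l :: "'a::idom poly"
  assumes "nonsquare UNIV (poly l c)"
  shows "nonsquare UNIV l"
  unfolding nonsquare_def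
proof (intro ballI impI, rule ccontr)
  fix a b assume eq: "a ^ 2 = l * b ^ 2" and b: "b \<noteq> 0"
  have l: "poly l c \<noteq> 0"
    using nonsquare_nonzero[OF assms] by (simp add: subring_set_def)
  then have "l \<noteq> 0" by auto
  then have a: "a \<noteq> 0" using eq b by auto
  have "order c (a ^ 2) = order c (l * b ^ 2)" by (simp add: eq)
  then have ord: "order c a = order c b"
    using a b \<open>l \<noteq> 0\<close> order_0I[OF l] by (simp add: power2_eq_square order_mult)
  obtain a' where a': "a = [:- c, 1:] ^ order c a * a'" using order_decomp[OF a] by blast
  obtain b' where b': "b = [:- c, 1:] ^ order c b * b'" "\<not> [:- c, 1:] dvd b'"
    using order_decomp[OF b] by blast
  define t where "t = [:- c, 1:] ^ order c b"
  have t: "t \<noteq> 0" by (simp add: t_def)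
  have "t ^ 2 * a' ^ 2 = t ^ 2 * (l * b' ^ 2)"
    using eq a' b'(1) unfolding ord t_def[symmetric] by (simp add: power_mult_distrib mult_ac)
  then have "a' ^ 2 = l * b' ^ 2" using t by simp
  then have "poly a' c ^ 2 = poly l c * poly b' c ^ 2" by (metis poly_mult poly_power)
  then have "poly b' c = 0" using nonsquareD(1)[OF assms] by simp
  then show False using b'(2) by (simp add: poly_eq_0_iff_dvd)
qed

text \<open>Parity of the order at \<open>r\<close>: it is even for \<open>a ^ 2\<close> and odd for
  the right side.\<close>

lemma nonsquare_simple_root:
  fixes k :: "'a::idom poly"
  assumes "poly k r \<noteq> 0"
  shows "nonsquare UNIV ([:- r, 1:] * k)"
  unfolding nonsquare_def
proof (intro ballI impI, rule ccontr)
  fix a b assume eq: "a ^ 2 = [:- r, 1:] * k * b ^ 2" and b: "b \<noteq> 0"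
  have k: "k \<noteq> 0" using assms by auto
  then have nz: "[:- r, 1:] * k * b ^ 2 \<noteq> 0" using b by (simp del: mult_pCons_left)
  then have a: "a \<noteq> 0" using eq by auto
  have "order r (a ^ 2) = order r ([:- r, 1:] * k * b ^ 2)" by (simp add: eq)
  moreover have "order r (a ^ 2) = 2 * order r a"
    using a by (simp add: power2_eq_square order_mult)
  moreover have "order r ([:- r, 1:] * k * b ^ 2) = 1 + 2 * order r b"
    using nz b k order_0I[OF assms] order_power_n_n[of r 1]
    by (simp add: order_mult power2_eq_square del: mult_pCons_left)
  ultimately have "2 * order r a = 1 + 2 * order r b" by simp
  then show False by presburger
qed

lemma nonsquare_image:
  assumes "comm_ring_hom1 h" "inj h" "nonsquare UNIV l"
  shows "nonsquare (range h) (h l)"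
proof -
  interpret comm_ring_hom1 h by fact
  show ?thesis
    unfolding nonsquare_def
  proof (clarify)
    fix a b assume "h a ^ 2 = h l * h b ^ 2"
    then have "a ^ 2 = l * b ^ 2" using injD[OF assms(2)] by (simp flip: hom_power hom_mult)
    then have "b = 0" using assms(3) unfolding nonsquare_def by blast
    then show "h b = 0" by (simp add: hom_0)
  qed
qed

text \<open>Extends \<open>h\<close> by choosing an image of the variable. Three iterations map the
  nested polynomial ring to polynomials in \<open>x4\<close>, \<open>x5\<close>,
  \<open>x6\<close>.\<close>

lemma poly_eval_hom:
  assumes "comm_ring_hom1 (h :: 'a::comm_ring_1 \<Rightarrow> 'b::comm_ring_1)"
  shows "comm_ring_hom1 (\<lambda>p. poly (map_poly h p) x)"
proof -
  interpret comm_ring_hom1 h by fact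
  have pC: "map_poly h (pCons a p) = pCons (h a) (map_poly h p)" for a p
    by (rule map_poly_pCons) (simp add: hom_0)
  have add: "map_poly h (p + q) = map_poly h p + map_poly h q" for p q
    by (rule poly_eqI) (simp add: coeff_map_poly hom_simps)
  have smult: "map_poly h (smult a p) = smult (h a) (map_poly h p)" for a p
    by (rule poly_eqI) (simp add: coeff_map_poly hom_simps)
  have mult: "map_poly h (p * q) = map_poly h p * map_poly h q" for p q
    by (induction p) (simp_all add: pC add smult mult_pCons_left hom_0)
  show ?thesis
    by unfold_locales (simp_all add: add mult map_poly_1' hom_1)
qed

lemma poly_hom_eqI:
  fixes g1 g2 :: "'a::comm_ring_1 poly \<Rightarrow> 'b::comm_ring_1"
  assumes "comm_ring_hom1 g1" "comm_ring_hom1 g2" "\<And>c. g1 [:c:] = g2 [:c:]" "g1 [:0, 1:] = g2 [:0, 1:]"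
  shows "g1 p = g2 p"
proof -
  interpret g1: comm_ring_hom1 g1 by fact
  interpret g2: comm_ring_hom1 g2 by fact
  show ?thesis
  proof (induction p)
    case 0
    then show ?case by (simp add: g1.hom_0 g2.hom_0)
  next
    case (pCons a p)
    have "pCons a p = [:a:] + [:0, 1:] * p" by simp
    then show ?case using pCons by (simp only: g1.hom_add g1.hom_mult g2.hom_add g2.hom_mult assms(3,4))
  qed
qed

section \<open>Quotient modules and derivations\<close>

lemma gen_submodule:
  fixes M (structure)
  assumes "module R M" "G \<subseteq> carrier M"
  shows "submodule (gen_submodule R M G) R M" "G \<subseteq> gen_submodule R M G"
    "submodule N R M \<Longrightarrow> G \<subseteq> N \<Longrightarrow> gen_submodule R M G \<subseteq> N"
proof -
  interpret module R M by fact
  show "G \<subseteq> gen_submodule R M G" "submodule N R M \<Longrightarrow> G \<subseteq> N \<Longrightarrow> gen_submodule R M G \<subseteq> N"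
    unfolding gen_submodule_def by blast+
  let ?S = "{N. submodule N R M \<and> G \<subseteq> N}"
  \<comment> \<open>The intersected family is nonempty, so the intersection stays inside the
    carrier.\<close>
  have mem: "carrier M \<in> ?S" using carrier_is_submodule assms(2) by simp
  have E: "N \<subseteq> carrier M" "\<zero> \<in> N" "a \<in> N \<Longrightarrow> \<ominus> a \<in> N" "a \<in> N \<Longrightarrow> b \<in> N \<Longrightarrow> a \<oplus> b \<in> N"
    "r \<in> carrier R \<Longrightarrow> a \<in> N \<Longrightarrow> r \<odot> a \<in> N" if "N \<in> ?S" for N a b r
    using that submoduleE[of N] subgroup.one_closed[of N "add_monoid M"] submodule.axioms(1)[of N R M] by auto
  show "submodule (gen_submodule R M G) R M"
    unfolding gen_submodule_def
    by (rule submoduleI) (use mem E in \<open>auto 4 3\<close>)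
qed

section \<open>Quotients of modules and bases of the fibre\<close>

locale module_quotient = module R M for R (structure) and M (structure) +
  fixes N
  assumes submodule_N: "submodule N R M"
begin

lemma subgroup_N: "subgroup N (add_monoid M)"
  by (rule submodule.axioms(1)[OF submodule_N])

sublocale N: abelian_subgroup N M
  by (intro abelian_subgroupI3 additive_subgroupI subgroup_N abelian_group_axioms)

abbreviation (input) quot where "quot \<equiv> quotient_module M N"

definition proj where "proj x = N +>\<^bsub>M\<^esub> x"

lemma proj_eq_iff:
  assumes "x \<in> carrier M" "y \<in> carrier M"
  shows "proj x = proj y \<longleftrightarrow> x \<ominus>\<^bsub>M\<^esub> y \<in> N"
proof
  assume "proj x = proj y"
  then have "x \<in> N +>\<^bsub>M\<^esub> y" using N.a_rcos_self[OF assms(1)] by (simp add: proj_def)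
  then obtain n where "n \<in> N" "x = n \<oplus>\<^bsub>M\<^esub> y" by (auto simp: a_r_coset_def')
  then show "x \<ominus>\<^bsub>M\<^esub> y \<in> N"
    using assms N.a_subset by (metis M.add.inv_solve_right' a_minus_def subsetD)
next
  assume n: "x \<ominus>\<^bsub>M\<^esub> y \<in> N"
  have "x = (x \<ominus>\<^bsub>M\<^esub> y) \<oplus>\<^bsub>M\<^esub> y"
    using assms by (simp add: a_minus_def M.a_assoc M.l_neg)
  then have "x \<in> N +>\<^bsub>M\<^esub> y" using n by (auto simp: a_r_coset_def')
  then show "proj x = proj y"
    unfolding proj_def using M.a_repr_independence[OF _ assms(2) subgroup_N] by simp
qed

lemma carrier_quot: "carrier quot = proj ` carrier M"
  by (auto simp: quotient_module_def A_RCOSETS_def' proj_def)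

lemma add_proj:
  "x \<in> carrier M \<Longrightarrow> y \<in> carrier M \<Longrightarrow> proj x \<oplus>\<^bsub>quot\<^esub> proj y = proj (x \<oplus>\<^bsub>M\<^esub> y)"
  by (simp add: quotient_module_def proj_def N.a_rcos_sum)

lemma zero_quot: "\<zero>\<^bsub>quot\<^esub> = proj \<zero>\<^bsub>M\<^esub>"
  by (simp add: quotient_module_def proj_def N.a_subset)

lemma proj_eq_zero_iff: "x \<in> carrier M \<Longrightarrow> proj x = \<zero>\<^bsub>quot\<^esub> \<longleftrightarrow> x \<in> N"
  using M.a_coset_join1[OF _ _ subgroup_N] M.a_coset_join2[OF _ subgroup_N]
  by (auto simp: quotient_module_def proj_def)

text \<open>\<open>quotient_module\<close> takes a union over all representatives of the coset;
  every representative contributes the same coset.\<close>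

lemma smult_proj:
  assumes r: "r \<in> carrier R" and x: "x \<in> carrier M"
  shows "r \<odot>\<^bsub>quot\<^esub> proj x = proj (r \<odot>\<^bsub>M\<^esub> x)"
proof -
  have "proj (r \<odot>\<^bsub>M\<^esub> y) = proj (r \<odot>\<^bsub>M\<^esub> x)" if y: "y \<in> proj x" for y
  proof -
    have yM: "y \<in> carrier M"
      using y x M.a_r_coset_subset_G[OF N.a_subset x] by (auto simp: proj_def)
    have "proj y = proj x"
      using y M.a_repr_independence[OF _ x subgroup_N] by (simp add: proj_def)
    then have "y \<ominus>\<^bsub>M\<^esub> x \<in> N" using proj_eq_iff yM x by blast
    then have "r \<odot>\<^bsub>M\<^esub> (y \<ominus>\<^bsub>M\<^esub> x) \<in> N" using r submodule.smult_closed[OF submodule_N] by blast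
    also have "r \<odot>\<^bsub>M\<^esub> (y \<ominus>\<^bsub>M\<^esub> x) = (r \<odot>\<^bsub>M\<^esub> y) \<ominus>\<^bsub>M\<^esub> (r \<odot>\<^bsub>M\<^esub> x)"
      using r x yM by (simp add: a_minus_def smult_r_distr smult_r_minus)
    finally show ?thesis using proj_eq_iff r x yM by simp
  qed
  moreover have "x \<in> proj x" using N.a_rcos_self[OF x] by (simp add: proj_def)
  ultimately have "(\<Union>y\<in>proj x. proj (r \<odot>\<^bsub>M\<^esub> y)) = proj (r \<odot>\<^bsub>M\<^esub> x)" by blast
  then show ?thesis by (simp add: quotient_module_def proj_def)
qed

lemma module_quot: "module R quot"
proof (rule moduleI)
  show "abelian_group quot"
  proof (rule abelian_groupI)
    show "\<exists>y\<in>carrier quot. y \<oplus>\<^bsub>quot\<^esub> x = \<zero>\<^bsub>quot\<^esub>" if x: "x \<in> carrier quot" for x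
    proof -
      obtain x' where x': "x = proj x'" "x' \<in> carrier M" using x by (auto simp: carrier_quot)
      then have "proj (\<ominus>\<^bsub>M\<^esub> x') \<oplus>\<^bsub>quot\<^esub> x = \<zero>\<^bsub>quot\<^esub>"
        by (simp add: add_proj zero_quot M.l_neg)
      then show ?thesis using x' by (auto simp: carrier_quot)
    qed
  qed (auto simp: carrier_quot add_proj zero_quot M.a_ac)
qed (auto simp: carrier_quot add_proj smult_proj smult_l_distr smult_r_distr smult_assoc1 R.is_cring)

end

text \<open>\<open>M\<close> is free with basis \<open>e0\<close>, \<open>e1\<close> and coordinate
  functions \<open>co\<close>. These are linear, so they send \<open>mM\<close> into the ideal
  \<open>m\<close> of nonunits; a relation in \<open>M/mM\<close> therefore has coefficients in
  \<open>m\<close>.\<close>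

lemma fibre_dim_free_2:
  fixes R (structure) and M (structure)
  assumes "module R M" and nonunits: "ideal (nonunits R) R"
    and e: "e0 \<in> carrier M" "e1 \<in> carrier M"
    and span: "\<And>x. x \<in> carrier M \<Longrightarrow> \<exists>r\<in>carrier R. \<exists>s\<in>carrier R. x = r \<odot>\<^bsub>M\<^esub> e0 \<oplus>\<^bsub>M\<^esub> s \<odot>\<^bsub>M\<^esub> e1"
    and coord: "\<And>i. i < 2 \<Longrightarrow> co i \<in> carrier M \<rightarrow> carrier R"
      "\<And>i x y. i < 2 \<Longrightarrow> x \<in> carrier M \<Longrightarrow> y \<in> carrier M \<Longrightarrow> co i (x \<oplus>\<^bsub>M\<^esub> y) = co i x \<oplus> co i y"
      "\<And>i r x. i < 2 \<Longrightarrow> r \<in> carrier R \<Longrightarrow> x \<in> carrier M \<Longrightarrow> co i (r \<odot>\<^bsub>M\<^esub> x) = r \<otimes> co i x"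
    and dual: "co 0 e0 = \<one>" "co 0 e1 = \<zero>" "co (1::nat) e0 = \<zero>" "co 1 e1 = \<one>"
  shows "fibre_dim R M 2"
proof -
  interpret module R M by fact
  let ?G = "{r \<odot>\<^bsub>M\<^esub> x | r x. r \<in> nonunits R \<and> x \<in> carrier M}"
  define W where "W = gen_submodule R M ?G"
  have nR: "nonunits R \<subseteq> carrier R" by (auto simp: nonunits_def)
  then have G: "?G \<subseteq> carrier M" by auto
  have subW: "submodule W R M" unfolding W_def by (rule gen_submodule(1)[OF module_axioms G])
  interpret W: module_quotient R M W
    by (intro module_quotient.intro module_quotient_axioms.intro module_axioms subW)
  let ?V = "quotient_module M W"
  interpret V: module R ?V by (rule W.module_quot)
  interpret I: ideal "nonunits R" R by fact
  have lam_W: "co i x \<in> nonunits R" if i: "i < 2" and x: "x \<in> W" for i x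
  proof -
    let ?H = "{x \<in> carrier M. co i x \<in> nonunits R}"
    have zero: "co i \<zero>\<^bsub>M\<^esub> = \<zero>"
      using coord(3)[OF i R.zero_closed M.zero_closed] coord(1)[OF i] by (simp add: Pi_iff)
    have neg: "\<ominus>\<^bsub>M\<^esub> x = (\<ominus> \<one>) \<odot>\<^bsub>M\<^esub> x" if "x \<in> carrier M" for x
      using that by (simp add: smult_l_minus)
    have "submodule ?H R M"
    proof (rule submoduleI)
      show "\<ominus>\<^bsub>M\<^esub> a \<in> ?H" if "a \<in> ?H" for a
        using that neg[of a] coord(3)[OF i, of "\<ominus> \<one>" a] I.I_l_closed[of "co i a" "\<ominus> \<one>"] by simp
    qed (use zero coord[OF i] I.I_l_closed in auto)
    moreover have "?G \<subseteq> ?H"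
      using nR coord(1,3)[OF i] I.I_r_closed by (auto simp: Pi_iff)
    ultimately have "W \<subseteq> ?H" unfolding W_def by (rule gen_submodule(3)[OF module_axioms G])
    then show ?thesis using x by auto
  qed
  define e where "e i = (if i = (0::nat) then W.proj e0 else W.proj e1)" for i
  have eV: "e i \<in> carrier ?V" for i using e(1) assms(4) by (simp add: e_def W.carrier_quot)
  have sum: "(\<Oplus>\<^bsub>?V\<^esub>i\<in>{..<2}. r i \<odot>\<^bsub>?V\<^esub> e i) = W.proj (r 0 \<odot>\<^bsub>M\<^esub> e0 \<oplus>\<^bsub>M\<^esub> r 1 \<odot>\<^bsub>M\<^esub> e1)"
    if r: "r \<in> {..<2} \<rightarrow> carrier R" for r :: "nat \<Rightarrow> _"
  proof -
    have two: "{..<2::nat} = {0, 1}" by auto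
    have r': "r 0 \<in> carrier R" "r 1 \<in> carrier R" using r by (auto simp: Pi_iff)
    have "(\<Oplus>\<^bsub>?V\<^esub>i\<in>{..<2}. r i \<odot>\<^bsub>?V\<^esub> e i) = r 0 \<odot>\<^bsub>?V\<^esub> e 0 \<oplus>\<^bsub>?V\<^esub> r 1 \<odot>\<^bsub>?V\<^esub> e 1"
      unfolding two using r' eV by (subst V.M.finsum_insert) (auto simp: Pi_iff)
    then show ?thesis
      using r' assms(3,4) by (simp add: e_def W.smult_proj W.add_proj)
  qed
  show ?thesis
    unfolding fibre_dim_def Let_def W_def[symmetric]
  proof (intro bexI[of _ e] conjI ballI impI allI)
    fix x assume "x \<in> carrier ?V"
    then obtain m where m: "x = W.proj m" "m \<in> carrier M" by (auto simp: W.carrier_quot)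
    obtain r s where rs: "r \<in> carrier R" "s \<in> carrier R" "m = r \<odot>\<^bsub>M\<^esub> e0 \<oplus>\<^bsub>M\<^esub> s \<odot>\<^bsub>M\<^esub> e1"
      using span[OF m(2)] by blast
    let ?r = "\<lambda>i::nat. if i = 0 then r else s"
    have "?r \<in> {..<2} \<rightarrow> carrier R" using rs by auto
    then show "\<exists>r\<in>{..<2} \<rightarrow> carrier R. x = (\<Oplus>\<^bsub>?V\<^esub>i\<in>{..<2}. r i \<odot>\<^bsub>?V\<^esub> e i)"
      using sum[of ?r] rs(3) m(1) by (intro bexI[of _ ?r]) auto
  next
    fix r :: "nat \<Rightarrow> _" and i :: nat
    assume r: "r \<in> {..<2} \<rightarrow> carrier R" and z: "(\<Oplus>\<^bsub>?V\<^esub>i\<in>{..<2}. r i \<odot>\<^bsub>?V\<^esub> e i) = \<zero>\<^bsub>?V\<^esub>" and i: "i < 2"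
    have r': "r 0 \<in> carrier R" "r 1 \<in> carrier R" using r by (auto simp: Pi_iff)
    let ?m = "r 0 \<odot>\<^bsub>M\<^esub> e0 \<oplus>\<^bsub>M\<^esub> r 1 \<odot>\<^bsub>M\<^esub> e1"
    have "?m \<in> W" using z sum[OF r] W.proj_eq_zero_iff[of ?m] r' assms(3,4) by simp
    then have "co i ?m \<in> nonunits R" using lam_W i by blast
    moreover have "co i ?m = r 0 \<otimes> co i e0 \<oplus> r 1 \<otimes> co i e1"
      using coord(2,3)[OF i] r' assms(3,4) by simp
    moreover have "i = 0 \<or> i = 1" using i by auto
    ultimately show "r i \<in> nonunits R" using dual r' by auto
  qed (use eV in auto)
qed

section \<open>Kaehler differentials\<close>

text \<open>Kept apart from \<open>derivation\<close> so that \<open>R\<close> need not be packaged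
  as a module over itself.\<close>

definition ring_derivation :: "('r, 'm) ring_scheme \<Rightarrow> ('r \<Rightarrow> 'r) \<Rightarrow> bool" where
  "ring_derivation R D \<longleftrightarrow> D \<in> carrier R \<rightarrow> carrier R \<and>
    (\<forall>x\<in>carrier R. \<forall>y\<in>carrier R. D (x \<oplus>\<^bsub>R\<^esub> y) = D x \<oplus>\<^bsub>R\<^esub> D y \<and>
      D (x \<otimes>\<^bsub>R\<^esub> y) = x \<otimes>\<^bsub>R\<^esub> D y \<oplus>\<^bsub>R\<^esub> y \<otimes>\<^bsub>R\<^esub> D x)"

definition derivation :: "('r, 'm) ring_scheme \<Rightarrow> ('r, 'a, 'n) module_scheme \<Rightarrow> ('r \<Rightarrow> 'a) \<Rightarrow> bool" where
  "derivation R M D \<longleftrightarrow> D \<in> carrier R \<rightarrow> carrier M \<and>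
    (\<forall>x\<in>carrier R. \<forall>y\<in>carrier R. D (x \<oplus>\<^bsub>R\<^esub> y) = D x \<oplus>\<^bsub>M\<^esub> D y \<and>
      D (x \<otimes>\<^bsub>R\<^esub> y) = x \<odot>\<^bsub>M\<^esub> D y \<oplus>\<^bsub>M\<^esub> y \<odot>\<^bsub>M\<^esub> D x)"

section \<open>Derivations with values in a module\<close>

context module
begin

lemma derivation_add:
  assumes "derivation R M D" "derivation R M E"
  shows "derivation R M (\<lambda>x. D x \<oplus>\<^bsub>M\<^esub> E x)"
  using assms unfolding derivation_def by (auto simp: smult_r_distr M.a_ac Pi_iff)

lemma derivation_smult:
  assumes "ring_derivation R D" "e \<in> carrier M"
  shows "derivation R M (\<lambda>x. D x \<odot>\<^bsub>M\<^esub> e)"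
  using assms unfolding derivation_def ring_derivation_def
  by (auto simp: smult_l_distr smult_assoc1[symmetric] Pi_iff)

text \<open>The kernel of a derivation is closed under the ring operations and inverses, the latter
  because \<open>x\<close> annihilates \<open>D y\<close> and is a unit. In the last claim
  \<open>y\<close> is an inverse of \<open>2x\<close>, which cancels from
  \<open>D (x^2) = 2x D x\<close>.\<close>

lemma derivation_kernel:
  assumes D: "derivation R M D"
  shows "D \<one> = \<zero>\<^bsub>M\<^esub>"
    and "x \<in> carrier R \<Longrightarrow> y \<in> carrier R \<Longrightarrow> D x = \<zero>\<^bsub>M\<^esub> \<Longrightarrow> D y = \<zero>\<^bsub>M\<^esub> \<Longrightarrow> D (x \<oplus> y) = \<zero>\<^bsub>M\<^esub>"
    and "x \<in> carrier R \<Longrightarrow> y \<in> carrier R \<Longrightarrow> D x = \<zero>\<^bsub>M\<^esub> \<Longrightarrow> D y = \<zero>\<^bsub>M\<^esub> \<Longrightarrow> D (x \<otimes> y) = \<zero>\<^bsub>M\<^esub>"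
    and "x \<in> carrier R \<Longrightarrow> y \<in> carrier R \<Longrightarrow> x \<otimes> y = \<one> \<Longrightarrow> D x = \<zero>\<^bsub>M\<^esub> \<Longrightarrow> D y = \<zero>\<^bsub>M\<^esub>"
    and "x \<in> carrier R \<Longrightarrow> y \<in> carrier R \<Longrightarrow> (x \<oplus> x) \<otimes> y = \<one> \<Longrightarrow> D (x \<otimes> x) = \<zero>\<^bsub>M\<^esub> \<Longrightarrow> D x = \<zero>\<^bsub>M\<^esub>"
proof -
  have cl: "D x \<in> carrier M" if "x \<in> carrier R" for x using D that by (auto simp: derivation_def)
  have add: "D (x \<oplus> y) = D x \<oplus>\<^bsub>M\<^esub> D y" and mult: "D (x \<otimes> y) = x \<odot>\<^bsub>M\<^esub> D y \<oplus>\<^bsub>M\<^esub> y \<odot>\<^bsub>M\<^esub> D x"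
    if "x \<in> carrier R" "y \<in> carrier R" for x y
    using D that by (auto simp: derivation_def)
  have "D \<one> = D \<one> \<oplus>\<^bsub>M\<^esub> D \<one>" using mult[of \<one> \<one>] cl by simp
  then show one: "D \<one> = \<zero>\<^bsub>M\<^esub>" using cl[of \<one>] by (metis M.add.r_cancel_one' R.one_closed)
  show "x \<in> carrier R \<Longrightarrow> y \<in> carrier R \<Longrightarrow> D x = \<zero>\<^bsub>M\<^esub> \<Longrightarrow> D y = \<zero>\<^bsub>M\<^esub> \<Longrightarrow> D (x \<oplus> y) = \<zero>\<^bsub>M\<^esub>"
    by (simp add: add)
  show "x \<in> carrier R \<Longrightarrow> y \<in> carrier R \<Longrightarrow> D x = \<zero>\<^bsub>M\<^esub> \<Longrightarrow> D y = \<zero>\<^bsub>M\<^esub> \<Longrightarrow> D (x \<otimes> y) = \<zero>\<^bsub>M\<^esub>"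
    by (simp add: mult)
  show "D y = \<zero>\<^bsub>M\<^esub>" if xy: "x \<in> carrier R" "y \<in> carrier R" "x \<otimes> y = \<one>" "D x = \<zero>\<^bsub>M\<^esub>"
  proof -
    have "x \<odot>\<^bsub>M\<^esub> D y = \<zero>\<^bsub>M\<^esub>" using mult[OF xy(1,2)] xy cl one by simp
    then have "(y \<otimes> x) \<odot>\<^bsub>M\<^esub> D y = \<zero>\<^bsub>M\<^esub>" using xy cl by (simp add: smult_assoc1)
    then show ?thesis using xy cl by (simp add: R.m_comm)
  qed
  show "D x = \<zero>\<^bsub>M\<^esub>" if xy: "x \<in> carrier R" "y \<in> carrier R" "(x \<oplus> x) \<otimes> y = \<one>" "D (x \<otimes> x) = \<zero>\<^bsub>M\<^esub>"
  proof -
    have "(x \<oplus> x) \<odot>\<^bsub>M\<^esub> D x = \<zero>\<^bsub>M\<^esub>" using mult[OF xy(1,1)] xy cl by (simp add: smult_l_distr)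
    then have "(y \<otimes> (x \<oplus> x)) \<odot>\<^bsub>M\<^esub> D x = \<zero>\<^bsub>M\<^esub>" using xy cl by (simp add: smult_assoc1)
    then show ?thesis using xy cl by (simp add: R.m_comm)
  qed
qed

end

section \<open>Free modules and linear extension\<close>

context cring
begin

lemma free_module: "module R (free_module R B)"
proof (rule moduleI)
  let ?F = "free_module R B"
  have sub: "{b. f b \<oplus> g b \<noteq> \<zero>} \<subseteq> {b. f b \<noteq> \<zero>} \<union> {b. g b \<noteq> \<zero>}" for f g :: "'c \<Rightarrow> 'a" by auto
  have add_cl: "f \<oplus>\<^bsub>?F\<^esub> g \<in> carrier ?F" if "f \<in> carrier ?F" "g \<in> carrier ?F" for f g
    using that finite_subset[OF sub[of f g]] sub[of f g]
    by (auto simp: free_module_def image_subset_iff)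
  show "abelian_group ?F"
  proof (rule abelian_groupI)
    show "\<exists>g\<in>carrier ?F. g \<oplus>\<^bsub>?F\<^esub> f = \<zero>\<^bsub>?F\<^esub>" if f: "f \<in> carrier ?F" for f
    proof (rule bexI[of _ "\<lambda>b. \<ominus> f b"])
      have cl: "f b \<in> carrier R" for b using f by (auto simp: free_module_def image_subset_iff)
      show "(\<lambda>b. \<ominus> f b) \<oplus>\<^bsub>?F\<^esub> f = \<zero>\<^bsub>?F\<^esub>" using cl by (simp add: free_module_def l_neg)
      have "{b. \<ominus> f b \<noteq> \<zero>} = {b. f b \<noteq> \<zero>}" using cl by auto
      then show "(\<lambda>b. \<ominus> f b) \<in> carrier ?F" using f cl by (auto simp: free_module_def image_subset_iff)
    qed
    fix f g h assume "f \<in> carrier ?F" "g \<in> carrier ?F" "h \<in> carrier ?F"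
    then have cl: "f b \<in> carrier R" "g b \<in> carrier R" "h b \<in> carrier R" for b
      by (auto simp: free_module_def image_subset_iff)
    show "f \<oplus>\<^bsub>?F\<^esub> g \<oplus>\<^bsub>?F\<^esub> h = f \<oplus>\<^bsub>?F\<^esub> (g \<oplus>\<^bsub>?F\<^esub> h)"
      using cl by (simp add: free_module_def a_assoc)
  next
    fix f g assume "f \<in> carrier ?F" "g \<in> carrier ?F"
    then have cl: "f b \<in> carrier R" "g b \<in> carrier R" for b
      by (auto simp: free_module_def image_subset_iff)
    show "f \<oplus>\<^bsub>?F\<^esub> g = g \<oplus>\<^bsub>?F\<^esub> f" using cl by (simp add: free_module_def a_comm)
  next
    fix f assume "f \<in> carrier ?F"
    then have cl: "f b \<in> carrier R" for b
      by (auto simp: free_module_def image_subset_iff)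
    show "\<zero>\<^bsub>?F\<^esub> \<oplus>\<^bsub>?F\<^esub> f = f" using cl by (simp add: free_module_def)
  qed (use add_cl in \<open>auto simp: free_module_def\<close>)
  have sm: "r \<odot>\<^bsub>?F\<^esub> f \<in> carrier ?F" if "r \<in> carrier R" "f \<in> carrier ?F" for r f
  proof -
    have cl: "f b \<in> carrier R" for b using that by (auto simp: free_module_def image_subset_iff)
    have "{b. r \<otimes> f b \<noteq> \<zero>} \<subseteq> {b. f b \<noteq> \<zero>}" using that(1) by auto
    then show ?thesis using that cl finite_subset by (fastforce simp: free_module_def image_subset_iff)
  qed
  show "r \<odot>\<^bsub>?F\<^esub> f \<in> carrier ?F" if "r \<in> carrier R" "f \<in> carrier ?F" for r f by (rule sm[OF that])
  fix r s f g assume rs: "r \<in> carrier R" and fg: "f \<in> carrier ?F" "g \<in> carrier ?F"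
  have cl: "f b \<in> carrier R" "g b \<in> carrier R" for b using fg by (auto simp: free_module_def image_subset_iff)
  show "r \<odot>\<^bsub>?F\<^esub> (f \<oplus>\<^bsub>?F\<^esub> g) = r \<odot>\<^bsub>?F\<^esub> f \<oplus>\<^bsub>?F\<^esub> r \<odot>\<^bsub>?F\<^esub> g"
    using cl rs by (simp add: free_module_def r_distr)
next
  let ?F = "free_module R B"
  fix r s f assume rs: "r \<in> carrier R" "s \<in> carrier R" and f: "f \<in> carrier ?F"
  have cl: "f b \<in> carrier R" for b using f by (auto simp: free_module_def image_subset_iff)
  show "(r \<oplus> s) \<odot>\<^bsub>?F\<^esub> f = r \<odot>\<^bsub>?F\<^esub> f \<oplus>\<^bsub>?F\<^esub> s \<odot>\<^bsub>?F\<^esub> f"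
    "(r \<otimes> s) \<odot>\<^bsub>?F\<^esub> f = r \<odot>\<^bsub>?F\<^esub> (s \<odot>\<^bsub>?F\<^esub> f)"
    using cl rs by (simp_all add: free_module_def l_distr m_assoc)
next
  let ?F = "free_module R B"
  fix f assume f: "f \<in> carrier ?F"
  have cl: "f b \<in> carrier R" for b using f by (auto simp: free_module_def image_subset_iff)
  show "\<one> \<odot>\<^bsub>?F\<^esub> f = f"
    using cl by (simp add: free_module_def)
qed (rule is_cring)

end

lemma (in abelian_group) minus_zero_imp_eq:
  "x \<in> carrier G \<Longrightarrow> y \<in> carrier G \<Longrightarrow> x \<ominus> y = \<zero> \<Longrightarrow> x = y"
  using minus_equality[of x "\<ominus> y"] by (simp add: a_minus_def)

context module_quotient
begin

text \<open>The induced map evaluates \<Phi> at a chosen representative; any other differs by an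
  element of \<open>N\<close>, where \<Phi> vanishes.\<close>

lemma lift_linear:
  assumes cl: "\<And>x. x \<in> carrier M \<Longrightarrow> \<Phi> x \<in> carrier R"
    and add: "\<And>x y. x \<in> carrier M \<Longrightarrow> y \<in> carrier M \<Longrightarrow> \<Phi> (x \<oplus>\<^bsub>M\<^esub> y) = \<Phi> x \<oplus> \<Phi> y"
    and smult: "\<And>r x. r \<in> carrier R \<Longrightarrow> x \<in> carrier M \<Longrightarrow> \<Phi> (r \<odot>\<^bsub>M\<^esub> x) = r \<otimes> \<Phi> x"
    and ker: "\<And>x. x \<in> N \<Longrightarrow> \<Phi> x = \<zero>"
  obtains \<phi> where "\<phi> \<in> carrier quot \<rightarrow> carrier R"
    "\<And>x y. x \<in> carrier quot \<Longrightarrow> y \<in> carrier quot \<Longrightarrow> \<phi> (x \<oplus>\<^bsub>quot\<^esub> y) = \<phi> x \<oplus> \<phi> y"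
    "\<And>r x. r \<in> carrier R \<Longrightarrow> x \<in> carrier quot \<Longrightarrow> \<phi> (r \<odot>\<^bsub>quot\<^esub> x) = r \<otimes> \<phi> x"
    "\<And>x. x \<in> carrier M \<Longrightarrow> \<phi> (proj x) = \<Phi> x"
proof -
  define \<phi> where "\<phi> C = \<Phi> (SOME x. x \<in> carrier M \<and> proj x = C)" for C
  have \<phi>: "\<phi> (proj x) = \<Phi> x" if x: "x \<in> carrier M" for x
  proof -
    define y where "y = (SOME y. y \<in> carrier M \<and> proj y = proj x)"
    have "y \<in> carrier M \<and> proj y = proj x"
      unfolding y_def by (rule someI[of _ x]) (simp add: x)
    then have y: "y \<in> carrier M" "y \<ominus>\<^bsub>M\<^esub> x \<in> N" using proj_eq_iff x by auto
    have "y = (y \<ominus>\<^bsub>M\<^esub> x) \<oplus>\<^bsub>M\<^esub> x"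
      using x y by (simp add: a_minus_def M.a_assoc M.l_neg)
    then have "\<Phi> y = \<Phi> (y \<ominus>\<^bsub>M\<^esub> x) \<oplus> \<Phi> x" using add x y by (metis M.minus_closed)
    then show ?thesis using ker[OF y(2)] cl[OF x] by (simp add: \<phi>_def y_def)
  qed
  show ?thesis
    by (rule that[of \<phi>]) (auto simp: carrier_quot \<phi> cl add smult add_proj smult_proj)
qed

end

lemma (in cring) free_gen_closed: "b \<in> B \<Longrightarrow> free_gen R b \<in> carrier (free_module R B)"
proof -
  assume b: "b \<in> B"
  have "{c. free_gen R b c \<noteq> \<zero>} \<subseteq> {b}" by (auto simp: free_gen_def)
  then show ?thesis using b finite_subset by (fastforce simp: free_module_def free_gen_def)
qed

text \<open>Induction on a finite set containing the support: setting one coordinate to zero removes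
  a multiple of one generator.\<close>

lemma (in cring) free_module_span:
  assumes H: "submodule H R (free_module R B)" and gen: "\<And>b. b \<in> B \<Longrightarrow> free_gen R b \<in> H"
  shows "carrier (free_module R B) \<subseteq> H"
proof -
  let ?F = "free_module R B"
  interpret F: module R ?F by (rule free_module)
  note E = F.submoduleE[OF H]
  have zero: "\<zero>\<^bsub>?F\<^esub> \<in> H" using subgroup.one_closed[OF submodule.axioms(1)[OF H]] by simp
  have "f \<in> H" if "finite S" "f \<in> carrier ?F" "{b. f b \<noteq> \<zero>} \<subseteq> S" for S f
    using that
  proof (induction S arbitrary: f rule: finite_induct)
    case empty
    then have "f = \<zero>\<^bsub>?F\<^esub>" by (auto simp: free_module_def)
    then show ?case using zero by simp
  next
    case (insert b S)
    have cl: "f c \<in> carrier R" for c using insert.prems(1) by (auto simp: free_module_def image_subset_iff)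
    have fin: "finite {c. f c \<noteq> \<zero>}" "{c. f c \<noteq> \<zero>} \<subseteq> B" using insert.prems(1) by (auto simp: free_module_def)
    let ?g = "f(b := \<zero>)"
    have sub: "{c. ?g c \<noteq> \<zero>} \<subseteq> {c. f c \<noteq> \<zero>}" "{c. ?g c \<noteq> \<zero>} \<subseteq> S" using insert.prems(2) by auto
    have "?g \<in> carrier ?F"
      using cl fin finite_subset[OF sub(1) fin(1)] sub(1) by (auto simp: free_module_def image_subset_iff)
    then have g: "?g \<in> H" using insert.IH sub(2) by blast
    show ?case
    proof (cases "f b = \<zero>")
      case True
      then have "f = ?g" by auto
      then show ?thesis using g by metis
    next
      case False
      then have "b \<in> B" using fin(2) by auto
      then have "f b \<odot>\<^bsub>?F\<^esub> free_gen R b \<in> H" using E(4) cl gen by blast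
      then have "?g \<oplus>\<^bsub>?F\<^esub> f b \<odot>\<^bsub>?F\<^esub> free_gen R b \<in> H" using E(5) g by blast
      also have "?g \<oplus>\<^bsub>?F\<^esub> f b \<odot>\<^bsub>?F\<^esub> free_gen R b = f"
        using cl by (auto simp: free_module_def free_gen_def)
      finally show ?thesis .
    qed
  qed
  then show ?thesis by (auto simp: free_module_def)
qed

definition (in ring) free_extension :: "('c \<Rightarrow> 'a) \<Rightarrow> ('c \<Rightarrow> 'a) \<Rightarrow> 'a" where
  "free_extension D f = (\<Oplus>b\<in>{b. f b \<noteq> \<zero>}. f b \<otimes> D b)"

context cring
begin

text \<open>Allows two elements with different supports to be summed over one common index
  set.\<close>

lemma free_extension_superset:
  assumes f: "f \<in> carrier (free_module R B)" and D: "\<And>b. b \<in> B \<Longrightarrow> D b \<in> carrier R"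
    and S: "finite S" "{b. f b \<noteq> \<zero>} \<subseteq> S" "S \<subseteq> B"
  shows "free_extension D f = (\<Oplus>b\<in>S. f b \<otimes> D b)"
  unfolding free_extension_def
proof (rule add.finprod_mono_neutral_cong_left)
  have cl: "f c \<in> carrier R" for c using f by (auto simp: free_module_def image_subset_iff)
  show "(\<lambda>b. f b \<otimes> D b) \<in> S \<rightarrow> carrier R" using cl D S(3) by auto
  show "\<And>i. i \<in> S - {b. f b \<noteq> \<zero>} \<Longrightarrow> f i \<otimes> D i = \<zero>"
    using D S(3) by auto
qed (use S in auto)

lemma free_extension_linear:
  assumes D: "\<And>b. b \<in> B \<Longrightarrow> D b \<in> carrier R" and f: "f \<in> carrier (free_module R B)"
  shows "free_extension D f \<in> carrier R"
    and "g \<in> carrier (free_module R B) \<Longrightarrow>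
      free_extension D (f \<oplus>\<^bsub>free_module R B\<^esub> g) = free_extension D f \<oplus> free_extension D g"
    and "r \<in> carrier R \<Longrightarrow> free_extension D (r \<odot>\<^bsub>free_module R B\<^esub> f) = r \<otimes> free_extension D f"
proof -
  let ?F = "free_module R B"
  interpret F: module R ?F by (rule free_module)
  have props: "h c \<in> carrier R" "finite {b. h b \<noteq> \<zero>}" "{b. h b \<noteq> \<zero>} \<subseteq> B" if "h \<in> carrier ?F" for h c
    using that by (auto simp: free_module_def image_subset_iff)
  show "free_extension D f \<in> carrier R"
    unfolding free_extension_def using props[OF f] D by (intro finsum_closed) auto
  show "free_extension D (f \<oplus>\<^bsub>?F\<^esub> g) = free_extension D f \<oplus> free_extension D g" if g: "g \<in> carrier ?F"
  proof -
    let ?S = "{b. f b \<noteq> \<zero>} \<union> {b. g b \<noteq> \<zero>}"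
    have S: "finite ?S" "?S \<subseteq> B" using props[OF f] props[OF g] by auto
    have supp: "{b. (f \<oplus>\<^bsub>?F\<^esub> g) b \<noteq> \<zero>} \<subseteq> ?S" by (auto simp: free_module_def)
    have "free_extension D (f \<oplus>\<^bsub>?F\<^esub> g) = (\<Oplus>b\<in>?S. (f \<oplus>\<^bsub>?F\<^esub> g) b \<otimes> D b)"
      using f g by (intro free_extension_superset[of _ B] D S supp) auto
    also have "\<dots> = (\<Oplus>b\<in>?S. f b \<otimes> D b \<oplus> g b \<otimes> D b)"
      using props[OF f] props[OF g] D S(2)
      by (intro finsum_cong') (auto simp: free_module_def l_distr subset_iff)
    also have "\<dots> = (\<Oplus>b\<in>?S. f b \<otimes> D b) \<oplus> (\<Oplus>b\<in>?S. g b \<otimes> D b)"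
      using props[OF f] props[OF g] D S(2) by (intro finsum_addf) (auto simp: subset_iff)
    also have "\<dots> = free_extension D f \<oplus> free_extension D g"
      using free_extension_superset[OF f D S(1) _ S(2)] free_extension_superset[OF g D S(1) _ S(2)] by auto
    finally show ?thesis .
  qed
  show "free_extension D (r \<odot>\<^bsub>?F\<^esub> f) = r \<otimes> free_extension D f" if r: "r \<in> carrier R"
  proof -
    let ?S = "{b. f b \<noteq> \<zero>}"
    have S: "finite ?S" "?S \<subseteq> B" using props[OF f] by auto
    have supp: "{b. (r \<odot>\<^bsub>?F\<^esub> f) b \<noteq> \<zero>} \<subseteq> ?S" using r by (auto simp: free_module_def)
    have "free_extension D (r \<odot>\<^bsub>?F\<^esub> f) = (\<Oplus>b\<in>?S. (r \<odot>\<^bsub>?F\<^esub> f) b \<otimes> D b)"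
      using f r by (intro free_extension_superset[of _ B] D S supp) auto
    also have "\<dots> = (\<Oplus>b\<in>?S. r \<otimes> (f b \<otimes> D b))"
      using props[OF f] D S(2) r
      by (intro finsum_cong') (auto simp: free_module_def m_assoc subset_iff)
    also have "\<dots> = r \<otimes> free_extension D f"
      unfolding free_extension_def using props[OF f] D S r
      by (intro finsum_rdistr[symmetric]) (auto simp: subset_iff)
    finally show ?thesis .
  qed
qed

lemma free_extension_gen:
  assumes D: "\<And>b. b \<in> B \<Longrightarrow> D b \<in> carrier R" and b: "b \<in> B"
  shows "free_extension D (free_gen R b) = D b"
proof -
  have "free_extension D (free_gen R b) = (\<Oplus>c\<in>{b}. free_gen R b c \<otimes> D c)"
    by (rule free_extension_superset[OF free_gen_closed[OF b] D]) (use b in \<open>auto simp: free_gen_def\<close>)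
  also have "\<dots> = D b" using D[OF b] by (simp add: free_gen_def)
  finally show ?thesis .
qed

end

section \<open>The module of differentials and its universal property\<close>

locale kaehler = cring R for R (structure) +
  fixes s :: "'k \<Rightarrow> 'a"
  assumes scalar_closed: "s c \<in> carrier R"
begin

abbreviation "F \<equiv> free_module R (carrier R)"
abbreviation "K \<equiv> gen_submodule R F (kaehler_relations R s)"
abbreviation "\<Omega> \<equiv> kaehler_module R s"

sublocale F: module R F by (rule free_module)

lemma relations_closed: "kaehler_relations R s \<subseteq> carrier F"
  unfolding kaehler_relations_def Let_def
  using scalar_closed by (auto intro!: F.M.minus_closed F.M.a_closed F.smult_closed free_gen_closed)

sublocale Q: module_quotient R F K
  by (intro module_quotient.intro module_quotient_axioms.intro F.module_axioms
      gen_submodule(1) relations_closed)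

lemma kaehler_eq: "\<Omega> = quotient_module F K"
  by (simp add: kaehler_module_def Let_def)

sublocale Omega: module R \<Omega>
  unfolding kaehler_eq by (rule Q.module_quot)

definition differential :: "'a \<Rightarrow> ('a \<Rightarrow> 'a) set" where
  "differential x = Q.proj (free_gen R x)"

lemma relation_mem: "x \<in> kaehler_relations R s \<Longrightarrow> x \<in> K"
  using gen_submodule(2)[OF F.module_axioms relations_closed] by blast

lemma derivation_differential: "derivation R \<Omega> differential"
  unfolding derivation_def
proof (intro conjI ballI)
  note gen = free_gen_closed
  show "differential \<in> carrier R \<rightarrow> carrier \<Omega>"
    by (auto simp: differential_def kaehler_eq Q.carrier_quot gen)
  fix x y assume xy: "x \<in> carrier R" "y \<in> carrier R"
  have "free_gen R (x \<oplus> y) \<ominus>\<^bsub>F\<^esub> (free_gen R x \<oplus>\<^bsub>F\<^esub> free_gen R y) \<in> K"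
    by (rule relation_mem) (use xy in \<open>auto simp: kaehler_relations_def Let_def\<close>)
  then have "Q.proj (free_gen R (x \<oplus> y)) = Q.proj (free_gen R x \<oplus>\<^bsub>F\<^esub> free_gen R y)"
    using xy by (subst Q.proj_eq_iff) (auto simp: gen)
  then show "differential (x \<oplus> y) = differential x \<oplus>\<^bsub>\<Omega>\<^esub> differential y"
    using xy by (simp add: differential_def kaehler_eq Q.add_proj gen)
  have "free_gen R (x \<otimes> y) \<ominus>\<^bsub>F\<^esub> ((x \<odot>\<^bsub>F\<^esub> free_gen R y) \<oplus>\<^bsub>F\<^esub> (y \<odot>\<^bsub>F\<^esub> free_gen R x)) \<in> K"
    by (rule relation_mem) (use xy in \<open>auto simp: kaehler_relations_def Let_def\<close>)
  then have "Q.proj (free_gen R (x \<otimes> y)) = Q.proj ((x \<odot>\<^bsub>F\<^esub> free_gen R y) \<oplus>\<^bsub>F\<^esub> (y \<odot>\<^bsub>F\<^esub> free_gen R x))"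
    using xy by (subst Q.proj_eq_iff) (auto simp: gen)
  then show "differential (x \<otimes> y) = x \<odot>\<^bsub>\<Omega>\<^esub> differential y \<oplus>\<^bsub>\<Omega>\<^esub> y \<odot>\<^bsub>\<Omega>\<^esub> differential x"
    using xy by (simp add: differential_def kaehler_eq Q.add_proj Q.smult_proj gen)
qed

lemma differential_scalar: "differential (s c) = \<zero>\<^bsub>\<Omega>\<^esub>"
proof -
  have "free_gen R (s c) \<in> K"
    by (rule relation_mem) (auto simp: kaehler_relations_def Let_def)
  then show ?thesis
    unfolding differential_def kaehler_eq
    by (subst Q.proj_eq_zero_iff) (auto intro: free_gen_closed scalar_closed)
qed

text \<open>The preimage of \<open>H\<close> in the free module is a submodule containing all
  generators, hence everything.\<close>

lemma Omega_span:
  assumes H: "submodule H R \<Omega>" and gen: "\<And>x. x \<in> carrier R \<Longrightarrow> differential x \<in> H"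
  shows "carrier \<Omega> \<subseteq> H"
proof -
  note E = Omega.submoduleE[OF H]
  have zero: "\<zero>\<^bsub>\<Omega>\<^esub> \<in> H" using subgroup.one_closed[OF submodule.axioms(1)[OF H]] by simp
  let ?H = "{f \<in> carrier F. Q.proj f \<in> H}"
  have "submodule ?H R F"
  proof (rule F.submoduleI)
    show "\<ominus>\<^bsub>F\<^esub> a \<in> ?H" if a: "a \<in> ?H" for a
    proof -
      have "(\<ominus> \<one>) \<odot>\<^bsub>\<Omega>\<^esub> Q.proj a \<in> H" using a by (intro E(4)) auto
      then show ?thesis using a by (simp add: kaehler_eq Q.smult_proj F.smult_l_minus)
    qed
  qed (use zero E(4,5) in \<open>auto simp: kaehler_eq Q.zero_quot simp flip: Q.add_proj Q.smult_proj\<close>)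
  then have "carrier F \<subseteq> ?H"
    by (rule free_module_span) (use gen free_gen_closed in \<open>auto simp: differential_def\<close>)
  then show ?thesis by (auto simp: kaehler_eq Q.carrier_quot)
qed

text \<open>The linear extension of \<open>D\<close> to the free module kills the defining
  relations. Two such functionals serve as coordinate functions in
  \<open>fibre_dim_2\<close>.\<close>

lemma Omega_universal:
  assumes D: "ring_derivation R D" and s: "\<And>c. D (s c) = \<zero>"
  obtains \<phi> where "\<phi> \<in> carrier \<Omega> \<rightarrow> carrier R"
    "\<And>x y. x \<in> carrier \<Omega> \<Longrightarrow> y \<in> carrier \<Omega> \<Longrightarrow> \<phi> (x \<oplus>\<^bsub>\<Omega>\<^esub> y) = \<phi> x \<oplus> \<phi> y"
    "\<And>r x. r \<in> carrier R \<Longrightarrow> x \<in> carrier \<Omega> \<Longrightarrow> \<phi> (r \<odot>\<^bsub>\<Omega>\<^esub> x) = r \<otimes> \<phi> x"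
    "\<And>x. x \<in> carrier R \<Longrightarrow> \<phi> (differential x) = D x"
proof -
  have D': "D x \<in> carrier R" "D (x \<oplus> y) = D x \<oplus> D y" "D (x \<otimes> y) = x \<otimes> D y \<oplus> y \<otimes> D x"
    if "x \<in> carrier R" "y \<in> carrier R" for x y
    using D that by (auto simp: ring_derivation_def)
  have Dcl: "\<And>x. x \<in> carrier R \<Longrightarrow> D x \<in> carrier R" using D'(1) by blast
  let ?L = "free_extension D"
  have lin: "?L f \<in> carrier R" if "f \<in> carrier F" for f
    by (rule free_extension_linear(1)[OF Dcl that]) assumption
  have lin_add: "?L (f \<oplus>\<^bsub>F\<^esub> g) = ?L f \<oplus> ?L g" if "f \<in> carrier F" "g \<in> carrier F" for f g
    by (rule free_extension_linear(2)[OF Dcl that]) assumption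
  have lin_smult: "?L (r \<odot>\<^bsub>F\<^esub> f) = r \<otimes> ?L f" if "f \<in> carrier F" "r \<in> carrier R" for f r
    by (rule free_extension_linear(3)[OF Dcl that]) assumption
  have gen: "?L (free_gen R x) = D x" if "x \<in> carrier R" for x
    by (rule free_extension_gen[OF Dcl that]) assumption
  note gen = gen free_gen_closed
  note lin = lin lin_add lin_smult
  have zero: "?L \<zero>\<^bsub>F\<^esub> = \<zero>"
    using lin_smult[OF F.M.zero_closed zero_closed] lin(1)[OF F.M.zero_closed] by simp
  have neg: "?L (\<ominus>\<^bsub>F\<^esub> f) = \<ominus> ?L f" if "f \<in> carrier F" for f
    using lin_smult[OF that, of "\<ominus> \<one>"] lin(1)[OF that] that by (simp add: F.smult_l_minus l_minus)
  let ?H = "{f \<in> carrier F. ?L f = \<zero>}"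
  have "submodule ?H R F"
    by (rule F.submoduleI) (auto simp: zero neg lin)
  moreover have "kaehler_relations R s \<subseteq> ?H"
  proof
    fix f assume f: "f \<in> kaehler_relations R s"
    then consider
      (add) a b where "a \<in> carrier R" "b \<in> carrier R" "f = free_gen R (a \<oplus> b) \<ominus>\<^bsub>F\<^esub> (free_gen R a \<oplus>\<^bsub>F\<^esub> free_gen R b)"
      | (mult) a b where "a \<in> carrier R" "b \<in> carrier R"
        "f = free_gen R (a \<otimes> b) \<ominus>\<^bsub>F\<^esub> ((a \<odot>\<^bsub>F\<^esub> free_gen R b) \<oplus>\<^bsub>F\<^esub> (b \<odot>\<^bsub>F\<^esub> free_gen R a))"
      | (scalar) c where "f = free_gen R (s c)"
      unfolding kaehler_relations_def Let_def by blast
    then have "?L f = \<zero>"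
    proof cases
      case add
      then show ?thesis by (simp add: a_minus_def neg lin gen D' r_neg)
    next
      case mult
      then show ?thesis by (simp add: a_minus_def neg lin gen D' r_neg)
    next
      case scalar
      then show ?thesis by (simp add: gen s scalar_closed)
    qed
    then show "f \<in> ?H" using f relations_closed by blast
  qed
  ultimately have "K \<subseteq> ?H" by (rule gen_submodule(3)[OF F.module_axioms relations_closed])
  then have ker: "\<And>f. f \<in> K \<Longrightarrow> ?L f = \<zero>" by blast
  obtain \<phi> where "\<phi> \<in> carrier \<Omega> \<rightarrow> carrier R"
    "\<And>x y. x \<in> carrier \<Omega> \<Longrightarrow> y \<in> carrier \<Omega> \<Longrightarrow> \<phi> (x \<oplus>\<^bsub>\<Omega>\<^esub> y) = \<phi> x \<oplus> \<phi> y"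
    "\<And>r x. r \<in> carrier R \<Longrightarrow> x \<in> carrier \<Omega> \<Longrightarrow> \<phi> (r \<odot>\<^bsub>\<Omega>\<^esub> x) = r \<otimes> \<phi> x"
    and \<phi>: "\<And>x. x \<in> carrier F \<Longrightarrow> \<phi> (Q.proj x) = ?L x"
    by (rule Q.lift_linear[of ?L, folded kaehler_eq]) (use lin ker in auto)
  then show ?thesis
    by (intro that[of \<phi>]) (auto simp: differential_def gen)
qed

text \<open>The differentials \<open>d a0\<close>, \<open>d a1\<close> form a basis: for \<open>x\<close> in \<open>R\<close>, the difference of \<open>d x\<close> and
  \<open>D0 x d a0 + D1 x d a1\<close> is a derivation that vanishes on \<open>a0\<close> and \<open>a1\<close>.\<close>

lemma fibre_dim_2:
  assumes nonunits: "ideal (nonunits R) R" and a: "a0 \<in> carrier R" "a1 \<in> carrier R"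
    and D: "ring_derivation R D0" "ring_derivation R D1" "\<And>c. D0 (s c) = \<zero>" "\<And>c. D1 (s c) = \<zero>"
    and dual: "D0 a0 = \<one>" "D0 a1 = \<zero>" "D1 a0 = \<zero>" "D1 a1 = \<one>"
    and unique: "\<And>E x. derivation R \<Omega> E \<Longrightarrow> (\<And>c. E (s c) = \<zero>\<^bsub>\<Omega>\<^esub>) \<Longrightarrow> E a0 = \<zero>\<^bsub>\<Omega>\<^esub> \<Longrightarrow> E a1 = \<zero>\<^bsub>\<Omega>\<^esub> \<Longrightarrow>
      x \<in> carrier R \<Longrightarrow> E x = \<zero>\<^bsub>\<Omega>\<^esub>"
  shows "fibre_dim R \<Omega> 2"
proof -
  let ?d = differential
  have dcl: "?d x \<in> carrier \<Omega>" if "x \<in> carrier R" for x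
    using derivation_differential that by (auto simp: derivation_def)
  have Dcl: "D0 x \<in> carrier R" "D1 x \<in> carrier R" if "x \<in> carrier R" for x
    using D(1,2) that by (auto simp: ring_derivation_def)
  \<comment> \<open>The minus signs sit on the fixed elements \<open>?d a0\<close> and
    \<open>?d a1\<close>, so that \<open>derivation_smult\<close> covers each summand.\<close>
  define E where "E x = ?d x \<oplus>\<^bsub>\<Omega>\<^esub> (D0 x \<odot>\<^bsub>\<Omega>\<^esub> (\<ominus>\<^bsub>\<Omega>\<^esub> ?d a0) \<oplus>\<^bsub>\<Omega>\<^esub> D1 x \<odot>\<^bsub>\<Omega>\<^esub> (\<ominus>\<^bsub>\<Omega>\<^esub> ?d a1))" for x
  have "derivation R \<Omega> E"
    unfolding E_def
    by (intro Omega.derivation_add Omega.derivation_smult derivation_differential D Omega.M.a_inv_closed dcl a)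
  moreover have "E (s c) = \<zero>\<^bsub>\<Omega>\<^esub>" for c
    using dcl[OF a(1)] dcl[OF a(2)] by (simp add: E_def differential_scalar D)
  moreover have "E a0 = \<zero>\<^bsub>\<Omega>\<^esub>" "E a1 = \<zero>\<^bsub>\<Omega>\<^esub>"
    using dcl[OF a(1)] dcl[OF a(2)] by (simp_all add: E_def dual Omega.M.r_neg)
  ultimately have E0: "E x = \<zero>\<^bsub>\<Omega>\<^esub>" if "x \<in> carrier R" for x
    using unique that by blast
  have d: "?d x = D0 x \<odot>\<^bsub>\<Omega>\<^esub> ?d a0 \<oplus>\<^bsub>\<Omega>\<^esub> D1 x \<odot>\<^bsub>\<Omega>\<^esub> ?d a1" if x: "x \<in> carrier R" for x
  proof -
    have z: "?d x \<ominus>\<^bsub>\<Omega>\<^esub> (D0 x \<odot>\<^bsub>\<Omega>\<^esub> ?d a0 \<oplus>\<^bsub>\<Omega>\<^esub> D1 x \<odot>\<^bsub>\<Omega>\<^esub> ?d a1) = \<zero>\<^bsub>\<Omega>\<^esub>"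
      using E0[OF x] dcl[OF a(1)] dcl[OF a(2)] Dcl[OF x]
      by (simp add: E_def a_minus_def Omega.smult_r_minus Omega.M.minus_add)
    show ?thesis
      by (rule Omega.M.minus_zero_imp_eq[OF dcl[OF x] _ z]) (simp add: dcl a Dcl[OF x])
  qed
  have "\<exists>r\<in>carrier R. \<exists>t\<in>carrier R. x = r \<odot>\<^bsub>\<Omega>\<^esub> ?d a0 \<oplus>\<^bsub>\<Omega>\<^esub> t \<odot>\<^bsub>\<Omega>\<^esub> ?d a1" if x: "x \<in> carrier \<Omega>" for x
  proof -
    let ?H = "{r \<odot>\<^bsub>\<Omega>\<^esub> ?d a0 \<oplus>\<^bsub>\<Omega>\<^esub> t \<odot>\<^bsub>\<Omega>\<^esub> ?d a1 | r t. r \<in> carrier R \<and> t \<in> carrier R}"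
    note e = dcl[OF a(1)] dcl[OF a(2)]
    have "submodule ?H R \<Omega>"
    proof (rule Omega.submoduleI)
      show "?H \<subseteq> carrier \<Omega>" using e by auto
      show "\<zero>\<^bsub>\<Omega>\<^esub> \<in> ?H" using e by (intro CollectI exI[of _ \<zero>]) simp
      show "\<ominus>\<^bsub>\<Omega>\<^esub> x \<in> ?H" if xH: "x \<in> ?H" for x
      proof -
        obtain r t where x: "r \<in> carrier R" "t \<in> carrier R" "x = r \<odot>\<^bsub>\<Omega>\<^esub> ?d a0 \<oplus>\<^bsub>\<Omega>\<^esub> t \<odot>\<^bsub>\<Omega>\<^esub> ?d a1"
          using xH by blast
        then have "\<ominus>\<^bsub>\<Omega>\<^esub> x = (\<ominus> r) \<odot>\<^bsub>\<Omega>\<^esub> ?d a0 \<oplus>\<^bsub>\<Omega>\<^esub> (\<ominus> t) \<odot>\<^bsub>\<Omega>\<^esub> ?d a1"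
          using e by (simp add: Omega.smult_l_minus Omega.M.minus_add)
        then show ?thesis using x(1,2) by blast
      qed
      show "x \<oplus>\<^bsub>\<Omega>\<^esub> y \<in> ?H" if xy: "x \<in> ?H" "y \<in> ?H" for x y
      proof -
        obtain r t r' t' where x: "r \<in> carrier R" "t \<in> carrier R" "x = r \<odot>\<^bsub>\<Omega>\<^esub> ?d a0 \<oplus>\<^bsub>\<Omega>\<^esub> t \<odot>\<^bsub>\<Omega>\<^esub> ?d a1"
          and y: "r' \<in> carrier R" "t' \<in> carrier R" "y = r' \<odot>\<^bsub>\<Omega>\<^esub> ?d a0 \<oplus>\<^bsub>\<Omega>\<^esub> t' \<odot>\<^bsub>\<Omega>\<^esub> ?d a1"
          using xy by blast
        have "x \<oplus>\<^bsub>\<Omega>\<^esub> y = (r \<oplus> r') \<odot>\<^bsub>\<Omega>\<^esub> ?d a0 \<oplus>\<^bsub>\<Omega>\<^esub> (t \<oplus> t') \<odot>\<^bsub>\<Omega>\<^esub> ?d a1"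
          using e x y by (simp add: Omega.smult_l_distr Omega.M.a_ac)
        then show ?thesis using x(1,2) y(1,2) by blast
      qed
      show "u \<odot>\<^bsub>\<Omega>\<^esub> x \<in> ?H" if ux: "u \<in> carrier R" "x \<in> ?H" for u x
      proof -
        obtain r t where x: "r \<in> carrier R" "t \<in> carrier R" "x = r \<odot>\<^bsub>\<Omega>\<^esub> ?d a0 \<oplus>\<^bsub>\<Omega>\<^esub> t \<odot>\<^bsub>\<Omega>\<^esub> ?d a1"
          using ux by blast
        then have "u \<odot>\<^bsub>\<Omega>\<^esub> x = (u \<otimes> r) \<odot>\<^bsub>\<Omega>\<^esub> ?d a0 \<oplus>\<^bsub>\<Omega>\<^esub> (u \<otimes> t) \<odot>\<^bsub>\<Omega>\<^esub> ?d a1"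
          using e ux(1) by (simp add: Omega.smult_r_distr Omega.smult_assoc1)
        then show ?thesis using x(1,2) ux(1) by blast
      qed
    qed
    then have "carrier \<Omega> \<subseteq> ?H"
      by (rule Omega_span) (use d Dcl in blast)
    then show ?thesis using x by blast
  qed
  moreover obtain \<phi>0 where \<phi>0: "\<phi>0 \<in> carrier \<Omega> \<rightarrow> carrier R"
    "\<And>x y. x \<in> carrier \<Omega> \<Longrightarrow> y \<in> carrier \<Omega> \<Longrightarrow> \<phi>0 (x \<oplus>\<^bsub>\<Omega>\<^esub> y) = \<phi>0 x \<oplus> \<phi>0 y"
    "\<And>r x. r \<in> carrier R \<Longrightarrow> x \<in> carrier \<Omega> \<Longrightarrow> \<phi>0 (r \<odot>\<^bsub>\<Omega>\<^esub> x) = r \<otimes> \<phi>0 x"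
    "\<And>x. x \<in> carrier R \<Longrightarrow> \<phi>0 (?d x) = D0 x"
    by (rule Omega_universal[OF D(1,3)]) (rule that)
  moreover obtain \<phi>1 where \<phi>1: "\<phi>1 \<in> carrier \<Omega> \<rightarrow> carrier R"
    "\<And>x y. x \<in> carrier \<Omega> \<Longrightarrow> y \<in> carrier \<Omega> \<Longrightarrow> \<phi>1 (x \<oplus>\<^bsub>\<Omega>\<^esub> y) = \<phi>1 x \<oplus> \<phi>1 y"
    "\<And>r x. r \<in> carrier R \<Longrightarrow> x \<in> carrier \<Omega> \<Longrightarrow> \<phi>1 (r \<odot>\<^bsub>\<Omega>\<^esub> x) = r \<otimes> \<phi>1 x"
    "\<And>x. x \<in> carrier R \<Longrightarrow> \<phi>1 (?d x) = D1 x"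
    by (rule Omega_universal[OF D(2,4)]) (rule that)
  ultimately show ?thesis
    by (intro fibre_dim_free_2[where co = "\<lambda>i::nat. if i = 0 then \<phi>0 else \<phi>1", OF Omega.module_axioms nonunits
        dcl[OF a(1)] dcl[OF a(2)]]) (auto simp: a dual Pi_iff)
qed

end

section \<open>Quotients of subrings\<close>

locale subring_quotient =
  fixes A J :: "'a::comm_ring_1 set"
  assumes subring: "subring_set A"
    and J: "J \<subseteq> A" "0 \<in> J" "\<And>a b. a \<in> J \<Longrightarrow> b \<in> J \<Longrightarrow> a + b \<in> J" "\<And>a x. a \<in> J \<Longrightarrow> x \<in> A \<Longrightarrow> x * a \<in> J"
begin

definition sub :: "'a ring" where
  "sub = ring_of_type_algebra\<lparr>carrier := A\<rparr>"

abbreviation "Q \<equiv> sub Quot J"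

definition cl :: "'a \<Rightarrow> 'a set" where
  "cl x = J +>\<^bsub>sub\<^esub> x"

lemma sub_simps [simp]:
  "carrier sub = A" "x \<oplus>\<^bsub>sub\<^esub> y = x + y" "x \<otimes>\<^bsub>sub\<^esub> y = x * y" "\<zero>\<^bsub>sub\<^esub> = 0" "\<one>\<^bsub>sub\<^esub> = 1"
  by (simp_all add: sub_def ring_of_type_algebra_def)

lemmas A_closed = subring_setD[OF subring]

lemma cring_sub: "cring sub"
proof (rule cringI)
  show "abelian_group sub"
  proof (rule abelian_groupI)
    show "\<exists>y\<in>carrier sub. y \<oplus>\<^bsub>sub\<^esub> x = \<zero>\<^bsub>sub\<^esub>" if "x \<in> carrier sub" for x
      using that A_closed(7)[of x] by (intro bexI[of _ "- x"]) auto
  qed (auto intro: A_closed simp: add_ac)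
  show "Group.comm_monoid sub"
    by (rule comm_monoidI) (auto intro: A_closed simp: mult_ac)
qed (auto simp: distrib_right)

lemma ideal_subI:
  assumes "M \<subseteq> A" "0 \<in> M" "\<And>a b. a \<in> M \<Longrightarrow> b \<in> M \<Longrightarrow> a + b \<in> M" "\<And>a x. a \<in> M \<Longrightarrow> x \<in> A \<Longrightarrow> x * a \<in> M"
  shows "ideal M sub"
proof -
  interpret cring sub by (rule cring_sub)
  have neg: "\<ominus>\<^bsub>sub\<^esub> a \<in> M" if a: "a \<in> M" for a
  proof -
    have "- 1 \<in> A" by (intro A_closed)
    then have "- a \<in> M" using assms(4)[OF a, of "- 1"] by simp
    moreover have "\<ominus>\<^bsub>sub\<^esub> a = - a"
      using minus_equality[of "- a" a] a \<open>- a \<in> M\<close> assms(1) by auto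
    ultimately show ?thesis by simp
  qed
  show ?thesis
  proof (rule idealI[OF ring_axioms])
    show "subgroup M (add_monoid sub)"
    proof (rule add.subgroupI)
      show "\<ominus>\<^bsub>sub\<^esub> a \<in> M" if "a \<in> M" for a by (rule neg[OF that])
    qed (use assms in auto)
  qed (use assms in \<open>auto simp: mult.commute\<close>)
qed

lemma ideal_J: "ideal J sub"
  by (rule ideal_subI) (fact J)+

lemma cring_Q: "cring Q"
  by (rule ideal.quotient_is_cring[OF ideal_J cring_sub])

lemma carrier_Q: "carrier Q = cl ` A"
  by (auto simp: FactRing_def A_RCOSETS_def' cl_def)

lemma cl_mem: "x \<in> A \<Longrightarrow> cl x \<in> carrier Q"
  by (simp add: carrier_Q)

lemma cl_eq: "cl x = (\<lambda>h. h + x) ` J"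
  by (auto simp: cl_def a_r_coset_def')

lemma J_uminus: "a \<in> J \<Longrightarrow> - a \<in> J"
  using J(4)[of a "- 1"] A_closed(7)[OF A_closed(1)] by simp

lemma cl_eq_iff: "cl x = cl y \<longleftrightarrow> x - y \<in> J"
proof
  assume "cl x = cl y"
  moreover have "x \<in> cl x" using J(2) by (force simp: cl_eq)
  ultimately show "x - y \<in> J" by (auto simp: cl_eq)
next
  assume xy: "x - y \<in> J"
  have sub: "cl u \<subseteq> cl v" if "u - v \<in> J" for u v
  proof
    fix z assume "z \<in> cl u"
    then obtain h where "h \<in> J" "z = h + u" by (auto simp: cl_eq)
    then have "z = (h + (u - v)) + v" "h + (u - v) \<in> J" using J(3) that by simp_all
    then show "z \<in> cl v" unfolding cl_eq by blast
  qed
  show "cl x = cl y"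
    using sub[OF xy] sub[of y x] J_uminus[OF xy] by auto
qed

lemma cl_add: "x \<in> A \<Longrightarrow> y \<in> A \<Longrightarrow> cl x \<oplus>\<^bsub>Q\<^esub> cl y = cl (x + y)"
  using abelian_subgroup.a_rcos_sum[OF ideal.axioms(1)[OF ideal_J, THEN abelian_subgroupI3], of x y] cring_sub
  by (simp add: FactRing_def cl_def cring_def ring_def)

lemma cl_mult: "x \<in> A \<Longrightarrow> y \<in> A \<Longrightarrow> cl x \<otimes>\<^bsub>Q\<^esub> cl y = cl (x * y)"
  using ideal.rcoset_mult_add[OF ideal_J, of x y] by (simp add: FactRing_def cl_def)

lemma cl_one: "\<one>\<^bsub>Q\<^esub> = cl 1"
  by (simp add: FactRing_def cl_def)

lemma cl_zero: "\<zero>\<^bsub>Q\<^esub> = cl 0"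
  by (simp add: FactRing_def cl_eq)

text \<open>As \<delta> preserves \<open>J\<close>, its value modulo \<open>J\<close> does not
  depend on the chosen representative.\<close>

lemma lift_derivation:
  assumes cl: "\<And>x. x \<in> A \<Longrightarrow> \<delta> x \<in> A" "\<And>x. x \<in> J \<Longrightarrow> \<delta> x \<in> J"
    and add: "\<And>x y. x \<in> A \<Longrightarrow> y \<in> A \<Longrightarrow> \<delta> (x + y) = \<delta> x + \<delta> y"
    and mult: "\<And>x y. x \<in> A \<Longrightarrow> y \<in> A \<Longrightarrow> \<delta> (x * y) = x * \<delta> y + y * \<delta> x"
  obtains D where "ring_derivation Q D" "\<And>x. x \<in> A \<Longrightarrow> D (cl x) = cl (\<delta> x)"
proof -
  define D where "D C = cl (\<delta> (SOME x. x \<in> A \<and> cl x = C))" for C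
  have D: "D (cl x) = cl (\<delta> x)" if x: "x \<in> A" for x
  proof -
    define y where "y = (SOME y. y \<in> A \<and> cl y = cl x)"
    have "y \<in> A \<and> cl y = cl x"
      unfolding y_def by (rule someI[of _ x]) (simp add: x)
    then have y: "y \<in> A" "y - x \<in> J" using cl_eq_iff by auto
    have "\<delta> (y - x) = \<delta> y - \<delta> x"
      using add[of "y - x" x] y x J(1) by (auto simp: algebra_simps)
    then have "\<delta> y - \<delta> x \<in> J" using cl(2)[OF y(2)] by simp
    then show ?thesis by (simp add: D_def y_def cl_eq_iff)
  qed
  have "ring_derivation Q D"
    unfolding ring_derivation_def
    by (auto simp: carrier_Q D cl cl_add cl_mult add mult A_closed)
  then show ?thesis using that D by blast
qed

text \<open>\<open>M\<close> plays the maximal ideal: elements outside it are invertible in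
  \<open>A\<close>, and those inside are not invertible even modulo \<open>J\<close>. Hence the
  nonunits are the image of \<open>M\<close>.\<close>

lemma nonunits_ideal:
  assumes M: "M \<subseteq> A" "0 \<in> M" "\<And>a b. a \<in> M \<Longrightarrow> b \<in> M \<Longrightarrow> a + b \<in> M" "\<And>a x. a \<in> M \<Longrightarrow> x \<in> A \<Longrightarrow> x * a \<in> M"
    and unit: "\<And>x. x \<in> A \<Longrightarrow> x \<notin> M \<Longrightarrow> \<exists>y\<in>A. x * y = 1"
    and nonunit: "\<And>x y. x \<in> M \<Longrightarrow> y \<in> A \<Longrightarrow> x * y - 1 \<notin> J"
  shows "ideal (nonunits Q) Q"
proof -
  have "nonunits Q = cl ` M"
  proof
    show "nonunits Q \<subseteq> cl ` M"
    proof
      fix C assume C: "C \<in> nonunits Q"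
      then obtain x where x: "C = cl x" "x \<in> A" by (auto simp: nonunits_def carrier_Q)
      have "x \<in> M"
      proof (rule ccontr)
        assume "x \<notin> M"
        then obtain y where y: "y \<in> A" "x * y = 1" using unit x(2) by blast
        then have "cl x \<otimes>\<^bsub>Q\<^esub> cl y = \<one>\<^bsub>Q\<^esub>" "cl y \<otimes>\<^bsub>Q\<^esub> cl x = \<one>\<^bsub>Q\<^esub>"
          using x(2) by (simp_all add: cl_mult cl_one mult.commute)
        then have "C \<in> Units Q"
          unfolding Units_def using x y(1) cl_mem by blast
        then show False using C by (simp add: nonunits_def)
      qed
      then show "C \<in> cl ` M" using x(1) by blast
    qed
    show "cl ` M \<subseteq> nonunits Q"
    proof
      fix C assume "C \<in> cl ` M"
      then obtain x where x: "C = cl x" "x \<in> M" by blast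
      then have xA: "x \<in> A" using M(1) by blast
      have "C \<notin> Units Q"
      proof
        assume "C \<in> Units Q"
        then obtain y where y: "y \<in> A" "cl x \<otimes>\<^bsub>Q\<^esub> cl y = \<one>\<^bsub>Q\<^esub>"
          unfolding Units_def x(1) carrier_Q by blast
        then have "cl (x * y) = cl 1" using xA by (simp add: cl_mult cl_one)
        then show False using nonunit[OF x(2) y(1)] by (simp add: cl_eq_iff)
      qed
      then show "C \<in> nonunits Q" using xA x(1) by (simp add: nonunits_def carrier_Q)
    qed
  qed
  moreover have "ideal ((+>\<^bsub>sub\<^esub>) J ` M) Q"
    by (rule ring.ring_ideal_imp_quot_ideal[OF _ ideal_J ideal_subI[OF M]])
      (use cring_sub in \<open>simp add: cring_def\<close>)
  ultimately show ?thesis by (simp add: cl_def[abs_def])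
qed

end

section \<open>Derivations of polynomials and fractions\<close>

text \<open>Read off from \<open>f(x + v t)\<close> modulo \<open>t\<^sup>2\<close>.\<close>

definition mpoly_derivation ::
  "('v \<Rightarrow> ('k::field, 'v::{finite,linorder}) mpoly) \<Rightarrow> ('k, 'v) mpoly \<Rightarrow> ('k, 'v) mpoly" where
  "mpoly_derivation v f = coeff (meval (\<lambda>c. [:Const c:]) (\<lambda>i. [:Var i, v i:]) f) 1"

text \<open>The coefficient of degree 0 of the evaluation returns \<open>f\<close>, so the
  coefficient of degree 1 of a product is the Leibniz rule.\<close>

lemma mpoly_derivation:
  fixes v :: "'v::{finite,linorder} \<Rightarrow> ('k::field, 'v) mpoly"
  shows mpoly_derivation_add: "mpoly_derivation v (f + g) = mpoly_derivation v f + mpoly_derivation v g"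
    and mpoly_derivation_mult:
      "mpoly_derivation v (f * g) = f * mpoly_derivation v g + g * mpoly_derivation v f"
    and mpoly_derivation_Const: "mpoly_derivation v (Const c) = 0"
    and mpoly_derivation_Var: "mpoly_derivation v (Var i) = v i"
proof -
  interpret comm_ring_hom1 "\<lambda>c::'k. [:Const c :: ('k, 'v) mpoly:]"
    by unfold_locales (simp_all add: Const_add Const_mult one_pCons mult.commute)
  have c0: "coeff (meval (\<lambda>c. [:Const c:]) (\<lambda>i. [:Var i, v i:]) f) 0 = f" for f
    by (induction f rule: mpoly_induct) (simp_all add: meval_simps coeff_mult)
  show "mpoly_derivation v (f + g) = mpoly_derivation v f + mpoly_derivation v g"
    by (simp add: mpoly_derivation_def meval_add)
  show "mpoly_derivation v (f * g) = f * mpoly_derivation v g + g * mpoly_derivation v f"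
    by (simp add: mpoly_derivation_def meval_mult coeff_mult c0 mult.commute)
  show "mpoly_derivation v (Const c) = 0" "mpoly_derivation v (Var i) = v i"
    by (simp_all add: mpoly_derivation_def meval_Const meval_Var)
qed

lemma mpoly_derivation_homogeneous:
  assumes v: "\<And>i. homogeneous (Suc e) (v i)" and f: "homogeneous d f"
  shows "homogeneous (d + e) (mpoly_derivation v f)"
proof -
  have "homogeneous d f \<and> homogeneous (d + e) (mpoly_derivation v f)"
    using f
  proof (induction rule: homogeneous_induct)
    case (zero d)
    then show ?case using mpoly_derivation_Const[of v 0] by simp
  next
    case (Var i)
    then show ?case using v[of i] homogeneous_Var[of i] by (simp add: mpoly_derivation_Var)
  next
    case (add d f g)
    then show ?case by (simp add: mpoly_derivation_add homogeneous_add)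
  next
    case (mult d d' f g)
    have "homogeneous (d + (d' + e)) (f * mpoly_derivation v g)"
      "homogeneous (d' + (d + e)) (g * mpoly_derivation v f)" "homogeneous (d + d') (f * g)"
      using mult by (auto intro: homogeneous_mult)
    then show ?case
      by (simp add: mpoly_derivation_mult add.assoc add.left_commute homogeneous_add)
  qed (simp add: mpoly_derivation_Const)
  then show ?thesis ..
qed

section \<open>The quotient rule on a field of fractions\<close>

definition fract_derivation :: "('a::idom \<Rightarrow> 'a) \<Rightarrow> 'a fract \<Rightarrow> 'a fract" where
  "fract_derivation \<Delta> x = (SOME z. \<exists>f g. g \<noteq> 0 \<and> x = Fract f g \<and> z = Fract (g * \<Delta> f - f * \<Delta> g) (g * g))"

text \<open>Two representations satisfy \<open>f * g' = f' * g\<close>; applying \<Delta> to this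
  equation shows that the quotient rule gives the same fraction for both.\<close>

lemma fract_derivation:
  fixes \<Delta> :: "'a::idom \<Rightarrow> 'a"
  assumes mult: "\<And>f g. \<Delta> (f * g) = f * \<Delta> g + g * \<Delta> f" and g: "g \<noteq> 0"
  shows "fract_derivation \<Delta> (Fract f g) = Fract (g * \<Delta> f - f * \<Delta> g) (g * g)"
proof -
  have "\<exists>f' g'. g' \<noteq> 0 \<and> Fract f g = Fract f' g' \<and>
      fract_derivation \<Delta> (Fract f g) = Fract (g' * \<Delta> f' - f' * \<Delta> g') (g' * g')"
    unfolding fract_derivation_def by (rule someI_ex) (use g in blast)
  then obtain f' g' where *: "g' \<noteq> 0" "Fract f g = Fract f' g'"
      "fract_derivation \<Delta> (Fract f g) = Fract (g' * \<Delta> f' - f' * \<Delta> g') (g' * g')" by blast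
  have eq: "f * g' = f' * g" using *(1,2) g by (simp add: eq_fract)
  then have eq': "f * \<Delta> g' + g' * \<Delta> f = f' * \<Delta> g + g * \<Delta> f'" by (metis mult)
  \<comment> \<open>The difference of the cross products is a combination of \<open>eq\<close> and
    its derivative \<open>eq'\<close>.\<close>
  have "(g' * \<Delta> f' - f' * \<Delta> g') * (g * g) - (g * \<Delta> f - f * \<Delta> g) * (g' * g') =
      g * g' * ((f' * \<Delta> g + g * \<Delta> f') - (f * \<Delta> g' + g' * \<Delta> f))
      + (f * g' - f' * g) * (g * \<Delta> g' + g' * \<Delta> g)"
    by (simp add: algebra_simps)
  then have "(g' * \<Delta> f' - f' * \<Delta> g') * (g * g) = (g * \<Delta> f - f * \<Delta> g) * (g' * g')"
    using eq eq' by simp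
  then show ?thesis using * g by (simp add: eq_fract)
qed

lemma fract_derivation_add_mult:
  fixes \<Delta> :: "'a::idom \<Rightarrow> 'a"
  assumes mult: "\<And>f g. \<Delta> (f * g) = f * \<Delta> g + g * \<Delta> f" and add: "\<And>f g. \<Delta> (f + g) = \<Delta> f + \<Delta> g"
  shows "fract_derivation \<Delta> (x + y) = fract_derivation \<Delta> x + fract_derivation \<Delta> y"
    and "fract_derivation \<Delta> (x * y) = x * fract_derivation \<Delta> y + y * fract_derivation \<Delta> x"
proof -
  obtain a b where x: "x = Fract a b" "b \<noteq> 0" by (cases x)
  obtain c d where y: "y = Fract c d" "d \<noteq> 0" by (cases y)
  note D = fract_derivation[of \<Delta>, OF mult]
  show "fract_derivation \<Delta> (x + y) = fract_derivation \<Delta> x + fract_derivation \<Delta> y"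
    using x y by (simp add: D mult add eq_fract algebra_simps)
  show "fract_derivation \<Delta> (x * y) = x * fract_derivation \<Delta> y + y * fract_derivation \<Delta> x"
    using x y by (simp add: D mult add eq_fract algebra_simps)
qed

section \<open>Stalks\<close>

lemma Fract_add_same: "m \<noteq> 0 \<Longrightarrow> Fract f m + Fract g m = Fract (f + g) (m :: 'a::idom)"
  by (simp add: eq_fract algebra_simps)

locale proj_stalk =
  fixes I P :: "('k::field_char_0, 'v::{finite,linorder}) mpoly set"
  assumes ideal_I: "ideal I poly_ring" and P_point: "P \<in> proj_points I"
begin

lemmas prime_P = proj_pointsD(1)[OF P_point]
lemmas I_sub_P = proj_pointsD(3)[OF P_point]

definition A where
  "A = {Fract f g | f g d. homogeneous d f \<and> homogeneous d g \<and> g \<notin> P}"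

lemma nonzero: "g \<notin> P \<Longrightarrow> g \<noteq> 0"
  using ideal_zero[OF prime_ideal[OF prime_P]] by blast

lemma notin_mult: "f \<notin> P \<Longrightarrow> g \<notin> P \<Longrightarrow> f * g \<notin> P"
  using prime_mult_iff[OF prime_P] by blast

lemma notin_power: "f \<notin> P \<Longrightarrow> f ^ n \<notin> P"
  using prime_power[OF prime_P] by blast

lemma A_I: "homogeneous d f \<Longrightarrow> homogeneous d g \<Longrightarrow> g \<notin> P \<Longrightarrow> Fract f g \<in> A"
  unfolding A_def by blast

lemma A_E:
  assumes "x \<in> A"
  obtains f g d where "x = Fract f g" "homogeneous d f" "homogeneous d g" "g \<notin> P" "g \<noteq> 0"
  using assms nonzero unfolding A_def by blast

lemma localized_I:
  "f \<in> K \<Longrightarrow> homogeneous d f \<Longrightarrow> homogeneous d g \<Longrightarrow> g \<notin> P \<Longrightarrow> Fract f g \<in> localized_ideal K P"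
  unfolding localized_ideal_def by blast

lemma localized_E:
  assumes "x \<in> localized_ideal K P"
  obtains f g d where "x = Fract f g" "f \<in> K" "homogeneous d f" "homogeneous d g" "g \<notin> P" "g \<noteq> 0"
  using assms nonzero unfolding localized_ideal_def by blast

lemma subring_A: "subring_set A"
  unfolding subring_set_def
proof (intro conjI ballI)
  show "1 \<in> A"
    using A_I[OF homogeneous_1 homogeneous_1 prime_one[OF prime_P]] by (simp add: One_fract_def)
  fix x y assume "x \<in> A" "y \<in> A"
  then obtain f g d f' g' d' where x: "x = Fract f g" "homogeneous d f" "homogeneous d g" "g \<notin> P" "g \<noteq> 0"
    and y: "y = Fract f' g'" "homogeneous d' f'" "homogeneous d' g'" "g' \<notin> P" "g' \<noteq> 0"
    by (metis A_E)
  have h: "homogeneous (d + d') (f * g')" "homogeneous (d + d') (f' * g)" "homogeneous (d + d') (g * g')"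
    "homogeneous (d + d') (f * f')"
    using homogeneous_mult[OF x(2) y(3)] homogeneous_mult[OF y(2) x(3)] homogeneous_mult[OF x(3) y(3)]
      homogeneous_mult[OF x(2) y(2)] by (simp_all add: add.commute)
  have gg: "g * g' \<notin> P" using x y notin_mult by blast
  show "x + y \<in> A" "x - y \<in> A" "x * y \<in> A"
    using A_I[OF homogeneous_add[OF h(1,2)] h(3) gg] A_I[OF homogeneous_diff[OF h(1,2)] h(3) gg]
      A_I[OF h(4,3) gg] x y by simp_all
qed

text \<open>Stated for any \<open>K\<close>, since \<open>K = I\<close> gives the ideal divided out
  and \<open>K = P\<close> the maximal ideal.\<close>

lemma localized_ideal_closed:
  assumes K: "ideal K poly_ring"
  shows "localized_ideal K P \<subseteq> A" "0 \<in> localized_ideal K P"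
    "x \<in> localized_ideal K P \<Longrightarrow> y \<in> localized_ideal K P \<Longrightarrow> x + y \<in> localized_ideal K P"
    "x \<in> localized_ideal K P \<Longrightarrow> y \<in> A \<Longrightarrow> y * x \<in> localized_ideal K P"
proof -
  show "localized_ideal K P \<subseteq> A" unfolding localized_ideal_def A_def by blast
  show "0 \<in> localized_ideal K P"
    using localized_I[OF ideal_zero[OF K] homogeneous_0 homogeneous_1 prime_one[OF prime_P]]
    by (simp add: Zero_fract_def)
  show "x + y \<in> localized_ideal K P" if xK: "x \<in> localized_ideal K P" and yK: "y \<in> localized_ideal K P"
  proof -
    obtain f g d where x: "x = Fract f g" "f \<in> K" "homogeneous d f" "homogeneous d g" "g \<notin> P" "g \<noteq> 0"
      by (rule localized_E[OF xK])
    obtain f' g' d' where y: "y = Fract f' g'" "f' \<in> K" "homogeneous d' f'" "homogeneous d' g'" "g' \<notin> P" "g' \<noteq> 0"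
      by (rule localized_E[OF yK])
    have h: "homogeneous (d + d') (f * g')" "homogeneous (d + d') (f' * g)" "homogeneous (d + d') (g * g')"
      using homogeneous_mult[OF x(3) y(4)] homogeneous_mult[OF y(3) x(4)] homogeneous_mult[OF x(4) y(4)]
      by (simp_all add: add.commute)
    have "f * g' + f' * g \<in> K"
      by (intro ideal_add[OF K] ideal_mult_right[OF K] x y)
    then show ?thesis
      using localized_I[OF _ homogeneous_add[OF h(1,2)] h(3) notin_mult[OF x(5) y(5)]] x y by simp
  qed
  show "y * x \<in> localized_ideal K P" if xK: "x \<in> localized_ideal K P" and yA: "y \<in> A"
  proof -
    obtain f g d where x: "x = Fract f g" "f \<in> K" "homogeneous d f" "homogeneous d g" "g \<notin> P" "g \<noteq> 0"
      by (rule localized_E[OF xK])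
    obtain f' g' d' where y: "y = Fract f' g'" "homogeneous d' f'" "homogeneous d' g'" "g' \<notin> P" "g' \<noteq> 0"
      by (rule A_E[OF yA])
    show ?thesis
      using localized_I[OF ideal_mult_left[OF K x(2)] homogeneous_mult[OF y(2) x(3)]
          homogeneous_mult[OF y(3) x(4)] notin_mult[OF y(4) x(5)]] x y by simp
  qed
qed

sublocale subring_quotient A "localized_ideal I P"
  by unfold_locales (rule subring_A localized_ideal_closed[OF ideal_I]; assumption?)+

lemma homogeneous_localization_eq: "homogeneous_localization P = sub"
  unfolding homogeneous_localization_def sub_def by (simp add: A_def)

text \<open>A fraction with numerator outside \<open>P\<close> can be inverted. Conversely, clearing
  denominators in an inverse modulo \<open>I\<close> of a fraction with numerator in
  \<open>P\<close> would put a product of denominators into \<open>P\<close>.\<close>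

lemma ideal_nonunits: "ideal (nonunits Q) Q"
proof (rule nonunits_ideal)
  note id = localized_ideal_closed[OF prime_ideal[OF prime_P]]
  show "localized_ideal P P \<subseteq> A" "0 \<in> localized_ideal P P" by (rule id)+
  show "a + b \<in> localized_ideal P P" if "a \<in> localized_ideal P P" "b \<in> localized_ideal P P" for a b
    by (rule id(3)[OF that])
  show "x * a \<in> localized_ideal P P" if "a \<in> localized_ideal P P" "x \<in> A" for a x
    by (rule id(4)[OF that])
  show "\<exists>y\<in>A. x * y = 1" if xA: "x \<in> A" and xP: "x \<notin> localized_ideal P P" for x
  proof -
    obtain f g d where x: "x = Fract f g" "homogeneous d f" "homogeneous d g" "g \<notin> P" "g \<noteq> 0"
      by (rule A_E[OF xA])
    have f: "f \<notin> P" using xP x localized_I by blast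
    then have "x * Fract g f = 1"
      using x nonzero by (simp add: One_fract_def eq_fract mult.commute)
    then show ?thesis using A_I[OF x(3,2) f] by blast
  qed
  show "x * y - 1 \<notin> localized_ideal I P" if xP: "x \<in> localized_ideal P P" and yA: "y \<in> A" for x y
  proof
    assume xy: "x * y - 1 \<in> localized_ideal I P"
    obtain f g d where x: "x = Fract f g" "f \<in> P" "homogeneous d f" "homogeneous d g" "g \<notin> P" "g \<noteq> 0"
      by (rule localized_E[OF xP])
    obtain f' g' d' where y: "y = Fract f' g'" "homogeneous d' f'" "homogeneous d' g'" "g' \<notin> P" "g' \<noteq> 0"
      by (rule A_E[OF yA])
    obtain h k e where hk: "x * y - 1 = Fract h k" "h \<in> I" "homogeneous e h" "homogeneous e k" "k \<notin> P" "k \<noteq> 0"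
      by (rule localized_E[OF xy])
    have eq: "(f * f' - g * g') * k = h * (g * g')"
      using hk(1,6) x(1,6) y(1,5) by (simp add: One_fract_def eq_fract)
    have "g * g' * k = f * (f' * k) - h * (g * g')"
      using eq by (simp add: algebra_simps)
    also have "\<dots> \<in> P"
      using x(2) hk(2) I_sub_P prime_ideal[OF prime_P] by (intro idealD) auto
    finally show False using notin_mult[OF notin_mult[OF x(5) y(4)] hk(5)] by blast
  qed
qed

text \<open>The quotient rule for a \<Delta> that raises degrees by \<open>e\<close> yields
  fractions of degree \<open>e\<close>. Division by \<open>w\<close>, which has degree
  \<open>e\<close> and is invertible at \<open>P\<close>, returns them to degree 0.\<close>

lemma derivation_stalk:
  assumes add: "\<And>f g. \<Delta> (f + g) = \<Delta> f + \<Delta> g" and mult: "\<And>f g. \<Delta> (f * g) = f * \<Delta> g + g * \<Delta> f"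
    and I: "\<And>f. f \<in> I \<Longrightarrow> \<Delta> f \<in> I" and hom: "\<And>d f. homogeneous d f \<Longrightarrow> homogeneous (d + e) (\<Delta> f)"
    and w: "homogeneous e w" "w \<notin> P"
  obtains D where "ring_derivation Q D"
    "\<And>d f g. homogeneous d f \<Longrightarrow> homogeneous d g \<Longrightarrow> g \<notin> P \<Longrightarrow>
      D (cl (Fract f g)) = cl (Fract (g * \<Delta> f - f * \<Delta> g) (g * g * w))"
proof -
  define \<delta> where "\<delta> x = fract_derivation \<Delta> x * Fract 1 w" for x
  note fd = fract_derivation_add_mult[of \<Delta>, OF mult add]
  have \<delta>: "\<delta> (Fract f g) = Fract (g * \<Delta> f - f * \<Delta> g) (g * g * w)" if "g \<noteq> 0" for f g
    using fract_derivation[of \<Delta>, OF mult that] by (simp add: \<delta>_def)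
  have num: "homogeneous (d + d + e) (g * \<Delta> f - f * \<Delta> g)" "homogeneous (d + d + e) (g * g * w)"
    if fg: "homogeneous d f" "homogeneous d g" for d f g
    using homogeneous_mult[OF fg(2) hom[OF fg(1)]] homogeneous_mult[OF fg(1) hom[OF fg(2)]]
      homogeneous_mult[OF homogeneous_mult[OF fg(2,2)] w(1)]
    by (auto simp: add.assoc intro: homogeneous_diff)
  have den: "g * g * w \<notin> P" if "g \<notin> P" for g
    using that w(2) notin_mult by blast
  obtain D where D: "ring_derivation Q D" "\<And>x. x \<in> A \<Longrightarrow> D (cl x) = cl (\<delta> x)"
  proof (rule lift_derivation[of \<delta>])
    show "\<delta> x \<in> A" if xA: "x \<in> A" for x
    proof -
      obtain f g d where x: "x = Fract f g" "homogeneous d f" "homogeneous d g" "g \<notin> P" "g \<noteq> 0"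
        by (rule A_E[OF xA])
      show ?thesis unfolding x(1) \<delta>[OF x(5)] by (rule A_I[OF num[OF x(2,3)] den[OF x(4)]])
    qed
    show "\<delta> x \<in> localized_ideal I P" if xI: "x \<in> localized_ideal I P" for x
    proof -
      obtain f g d where x: "x = Fract f g" "f \<in> I" "homogeneous d f" "homogeneous d g" "g \<notin> P" "g \<noteq> 0"
        by (rule localized_E[OF xI])
      have "g * \<Delta> f - f * \<Delta> g \<in> I"
        by (intro idealD[OF ideal_I] I x(2))
      then show ?thesis
        unfolding x(1) \<delta>[OF x(6)] by (rule localized_I[OF _ num[OF x(3,4)] den[OF x(5)]])
    qed
    show "\<delta> (x + y) = \<delta> x + \<delta> y" "\<delta> (x * y) = x * \<delta> y + y * \<delta> x" for x y
      by (simp_all add: \<delta>_def fd algebra_simps)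
  qed (rule that)
  show ?thesis
    by (rule that[OF D(1)]) (simp add: D(2) A_I \<delta> nonzero)
qed

text \<open>With \<open>L = Var l\<close>, every element is
  \<open>f/g = (f / L^d) * (L^d / g)\<close>. The first factor is a polynomial in the coordinates
  \<open>Var i / L\<close>, and the second is the inverse of such a polynomial.\<close>

lemma derivation_zero:
  assumes M: "module Q M" and E: "derivation Q M E" and const: "\<And>c. E (cl (Fract (Const c) 1)) = \<zero>\<^bsub>M\<^esub>"
    and l: "Var l \<notin> P" and coords: "\<And>i. E (cl (Fract (Var i) (Var l))) = \<zero>\<^bsub>M\<^esub>"
    and x: "x \<in> carrier Q"
  shows "E x = \<zero>\<^bsub>M\<^esub>"
proof -
  interpret M: module Q M by fact
  have ker: "E (cl (x + y)) = \<zero>\<^bsub>M\<^esub>" "E (cl (x * y)) = \<zero>\<^bsub>M\<^esub>"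
    if "x \<in> A" "y \<in> A" "E (cl x) = \<zero>\<^bsub>M\<^esub>" "E (cl y) = \<zero>\<^bsub>M\<^esub>" for x y
    using M.derivation_kernel(2,3)[OF E cl_mem[OF that(1)] cl_mem[OF that(2)] that(3,4)] that(1,2)
    by (simp_all add: cl_add cl_mult)
  have inv: "E (cl y) = \<zero>\<^bsub>M\<^esub>" if "x \<in> A" "y \<in> A" "x * y = 1" "E (cl x) = \<zero>\<^bsub>M\<^esub>" for x y
    using M.derivation_kernel(4)[OF E cl_mem[OF that(1)] cl_mem[OF that(2)] _ that(4)] that
    by (simp add: cl_mult cl_one)
  let ?L = "Var l :: ('k, 'v) mpoly"
  have Lh: "homogeneous d (?L ^ d)" for d using homogeneous_power[OF homogeneous_Var, of d l] by simp
  have Lp: "?L ^ d \<notin> P" "?L ^ d \<noteq> 0" for d using notin_power[OF l] nonzero by blast+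
  have num: "homogeneous d f \<and> E (cl (Fract f (?L ^ d))) = \<zero>\<^bsub>M\<^esub>" if "homogeneous d f" for d f
    using that
  proof (induction rule: homogeneous_induct)
    case (zero d)
    have "Fract 0 (?L ^ d) = Fract (Const 0) 1" using Lp(2)[of d] by (simp add: eq_fract)
    then show ?case using const[of 0] by simp
  next
    case (Const c)
    then show ?case using const[of c] by simp
  next
    case (Var i)
    then show ?case using coords[of i] homogeneous_Var[of i] by simp
  next
    case (add d f g)
    then show ?case
      using ker(1)[of "Fract f (?L ^ d)" "Fract g (?L ^ d)"] A_I[OF _ Lh Lp(1)]
      by (simp add: Fract_add_same[OF Lp(2)] homogeneous_add)
  next
    case (mult d e f g)
    then show ?case
      using ker(2)[of "Fract f (?L ^ d)" "Fract g (?L ^ e)"] A_I[OF _ Lh Lp(1)]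
      by (simp add: power_add homogeneous_mult)
  qed
  obtain y where y: "x = cl y" "y \<in> A" using x by (auto simp: carrier_Q)
  obtain f g d where fg: "y = Fract f g" "homogeneous d f" "homogeneous d g" "g \<notin> P" "g \<noteq> 0"
    by (rule A_E[OF y(2)])
  have AA: "Fract f (?L ^ d) \<in> A" "Fract g (?L ^ d) \<in> A" "Fract (?L ^ d) g \<in> A"
    using A_I fg Lh Lp(1) by blast+
  have "Fract g (?L ^ d) * Fract (?L ^ d) g = 1"
    using fg(5) Lp(2)[of d] by (simp add: One_fract_def eq_fract mult.commute)
  then have "E (cl (Fract (?L ^ d) g)) = \<zero>\<^bsub>M\<^esub>"
    using inv AA num[OF fg(3)] by blast
  then have "E (cl (Fract f (?L ^ d) * Fract (?L ^ d) g)) = \<zero>\<^bsub>M\<^esub>"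
    using ker(2) AA num[OF fg(2)] by blast
  also have "Fract f (?L ^ d) * Fract (?L ^ d) g = y"
    using fg(1,5) Lp(2)[of d] by (simp add: eq_fract mult_ac)
  finally show ?thesis by (simp add: y(1))
qed

text \<open>The square of \<open>u p\<close> is a combination of the squares of the
  \<open>u k\<close> with \<open>k \<in> K\<close>, so \<open>E\<close> kills it. As
  \<open>2 * u p\<close> is a unit, by \<open>Var p \<notin> P\<close> and characteristic 0,
  \<open>E\<close> also kills \<open>u p\<close>.\<close>

lemma derivation_zero_pivot:
  assumes M: "module Q M" and E: "derivation Q M E" and const: "\<And>c. E (cl (Fract (Const c) 1)) = \<zero>\<^bsub>M\<^esub>"
    and l: "Var l \<notin> P" and p: "Var p \<notin> P"
    and rel: "Var p ^ 2 - (\<Sum>k\<in>K. Const (b k) * Var k ^ 2) \<in> I"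
    and coords: "\<And>k. k \<in> K \<Longrightarrow> E (cl (Fract (Var k) (Var l))) = \<zero>\<^bsub>M\<^esub>"
  shows "E (cl (Fract (Var p) (Var l))) = \<zero>\<^bsub>M\<^esub>"
proof -
  interpret M: module Q M by fact
  have ker: "E (cl (x + y)) = \<zero>\<^bsub>M\<^esub>" "E (cl (x * y)) = \<zero>\<^bsub>M\<^esub>"
    if "x \<in> A" "y \<in> A" "E (cl x) = \<zero>\<^bsub>M\<^esub>" "E (cl y) = \<zero>\<^bsub>M\<^esub>" for x y
    using M.derivation_kernel(2,3)[OF E cl_mem[OF that(1)] cl_mem[OF that(2)] that(3,4)] that(1,2)
    by (simp_all add: cl_add cl_mult)
  let ?L = "Var l :: ('k, 'v) mpoly"
  have L0: "?L \<noteq> 0" "Var p \<noteq> (0 :: ('k, 'v) mpoly)" using l p nonzero by blast+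
  define u where "u k = Fract (Var k) ?L" for k
  have uA: "u k \<in> A" for k
    unfolding u_def by (rule A_I[OF homogeneous_Var homogeneous_Var l])
  have cA: "Fract (Const c) 1 \<in> A" for c :: 'k
    by (rule A_I[OF homogeneous_Const homogeneous_1 prime_one[OF prime_P]])
  have sum: "(\<Sum>k\<in>B. Fract (Const (b k)) 1 * (u k * u k)) \<in> A \<and>
      E (cl (\<Sum>k\<in>B. Fract (Const (b k)) 1 * (u k * u k))) = \<zero>\<^bsub>M\<^esub> \<and>
      (\<Sum>k\<in>B. Fract (Const (b k)) 1 * (u k * u k)) = Fract (\<Sum>k\<in>B. Const (b k) * Var k ^ 2) (?L ^ 2)"
    if "finite B" "B \<subseteq> K" for B
    using that
  proof (induction rule: finite_induct)
    case empty
    have "Fract 0 1 = (0 :: ('k, 'v) mpoly fract)" by (simp add: Zero_fract_def)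
    then show ?case using const[of 0] A_closed(2) L0 by (simp add: Zero_fract_def eq_fract)
  next
    case (insert k B)
    let ?t = "Fract (Const (b k)) 1 * (u k * u k)"
    have t: "?t \<in> A" "E (cl ?t) = \<zero>\<^bsub>M\<^esub>"
      using insert.prems coords[of k] const
      by (auto intro!: A_closed cA uA ker simp flip: u_def)
    let ?r = "\<Sum>k\<in>B. Fract (Const (b k)) 1 * (u k * u k)"
    have r: "?r \<in> A" "E (cl ?r) = \<zero>\<^bsub>M\<^esub>" "?r = Fract (\<Sum>k\<in>B. Const (b k) * Var k ^ 2) (?L ^ 2)"
      using insert by auto
    have "?t = Fract (Const (b k) * Var k ^ 2) (?L ^ 2)"
      by (simp add: u_def power2_eq_square)
    moreover have "?L ^ 2 \<noteq> 0" using L0 by simp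
    ultimately have "?t + ?r = Fract (Const (b k) * Var k ^ 2 + (\<Sum>k\<in>B. Const (b k) * Var k ^ 2)) (?L ^ 2)"
      using r(3) by (simp only: Fract_add_same not_False_eq_True)
    then show ?case
      using A_closed(3)[OF t(1) r(1)] ker(1)[OF t(1) r(1) t(2) r(2)]
      by (simp only: sum.insert[OF insert.hyps] simp_thms)
  qed
  define v where "v = (\<Sum>k\<in>K. Fract (Const (b k)) 1 * (u k * u k))"
  have v: "v \<in> A" "E (cl v) = \<zero>\<^bsub>M\<^esub>" "v = Fract (\<Sum>k\<in>K. Const (b k) * Var k ^ 2) (?L ^ 2)"
    using sum[of K] by (auto simp: v_def)
  have hom2: "homogeneous 2 (Var k ^ 2 :: ('k, 'v) mpoly)" for k
    using homogeneous_power[OF homogeneous_Var, of 2 k] by simp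
  have "u p * u p - v = Fract (Var p ^ 2 - (\<Sum>k\<in>K. Const (b k) * Var k ^ 2)) (?L ^ 2)"
    unfolding v(3) using L0 by (simp add: u_def power2_eq_square eq_fract algebra_simps)
  also have "\<dots> \<in> localized_ideal I P"
  proof (rule localized_I[OF rel])
    have t: "homogeneous 2 (Const (b k) * Var k ^ 2 :: ('k, 'v) mpoly)" for k
      using homogeneous_mult[OF homogeneous_Const hom2] by (metis add_0)
    show "homogeneous 2 (Var p ^ 2 - (\<Sum>k\<in>K. Const (b k) * Var k ^ 2) :: ('k, 'v) mpoly)"
      by (intro homogeneous_diff homogeneous_sum hom2 t)
  qed (use hom2 notin_power[OF l] in auto)
  finally have "cl (u p * u p) = cl v" by (simp add: cl_eq_iff)
  then have sq: "E (cl (u p) \<otimes>\<^bsub>Q\<^esub> cl (u p)) = \<zero>\<^bsub>M\<^esub>" using v(2) uA by (simp add: cl_mult)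
  \<comment> \<open>The inverse of \<open>u p + u p\<close>.\<close>
  define y where "y = Fract (Const (1 / 2) * ?L) (Var p)"
  have yA: "y \<in> A"
    unfolding y_def using homogeneous_mult[OF homogeneous_Const[of "1 / 2"] homogeneous_Var[of l]]
    by (intro A_I[OF _ homogeneous_Var p]) simp
  have half: "2 * Const (1 / 2) = (1 :: ('k, 'v) mpoly)"
  proof -
    have "2 * Const (1 / 2) = (Const (1 / 2 + 1 / 2) :: ('k, 'v) mpoly)"
      unfolding Const_add by (rule mult_2)
    also have "1 / 2 + 1 / 2 = (1 :: 'k)" by simp
    finally show ?thesis by simp
  qed
  have "u p + u p = Fract (2 * Var p) ?L"
    unfolding u_def by (simp only: Fract_add_same[OF L0(1)] mult_2)
  then have "(u p + u p) * y = Fract ((2 * Var p) * (Const (1 / 2) * ?L)) (?L * Var p)"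
    by (simp only: y_def mult_fract)
  also have "\<dots> = Fract ((2 * Const (1 / 2)) * (Var p * ?L)) (Var p * ?L)"
    by (simp only: mult_ac)
  also have "\<dots> = 1" unfolding half using L0 by (simp add: One_fract_def eq_fract)
  finally have "(cl (u p) \<oplus>\<^bsub>Q\<^esub> cl (u p)) \<otimes>\<^bsub>Q\<^esub> cl y = \<one>\<^bsub>Q\<^esub>"
    unfolding cl_add[OF uA uA] cl_mult[OF A_closed(3)[OF uA uA] yA] cl_one by (rule arg_cong)
  then show ?thesis
    using M.derivation_kernel(5)[OF E cl_mem[OF uA] cl_mem[OF yA] _ sq] by (simp add: u_def)
qed

text \<open>The differentials of the two free coordinates span because a derivation killing them
  kills each pivot coordinate. They are independent because, for each free \<open>r\<close>, a
  derivation sends \<open>x_r / x_l\<close> to 1 and the other free coordinate to 0.\<close>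

lemma fibre_dim_diagonal:
  assumes I: "I = Idl\<^bsub>poly_ring\<^esub> ((\<lambda>p. Var p ^ 2 - (\<Sum>k\<in>-T. Const (b p k) * Var k ^ 2)) ` T)"
    and T: "- T = {l, r0, r1}" "l \<noteq> r0" "l \<noteq> r1" "r0 \<noteq> r1"
    and l: "Var l \<notin> P" and pivots: "\<And>p. p \<in> T \<Longrightarrow> Var p \<notin> P"
  shows "fibre_dim Q (kaehler_module Q (\<lambda>c. cl (Fract (Const c) 1))) 2"
proof -
  let ?e = "\<lambda>p. Var p ^ 2 - (\<Sum>k\<in>-T. Const (b p k) * Var k ^ 2) :: ('k, 'v) mpoly"
  have eI: "?e p \<in> I" if "p \<in> T" for p
    using genideal_superset_type[of "?e ` T"] that unfolding I by blast
  define w where "w B = (\<Prod>p\<in>B. Var p :: ('k, 'v) mpoly)" for B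
  have w_hom: "homogeneous (card B) (w B)" for B
    unfolding w_def
  proof (induction B rule: infinite_finite_induct)
    case (insert p B)
    then show ?case using homogeneous_mult[OF homogeneous_Var[of p] insert.IH] by simp
  qed simp_all
  have w_P: "w B \<notin> P" if "B \<subseteq> T" for B
    unfolding w_def using that
    by (induction B rule: infinite_finite_induct)
      (use pivots notin_mult prime_one[OF prime_P] in auto)
  have ex: "\<exists>D. ring_derivation Q D \<and> (\<forall>c. D (cl (Fract (Const c) 1)) = \<zero>\<^bsub>Q\<^esub>) \<and>
      D (cl (Fract (Var r) (Var l))) = \<one>\<^bsub>Q\<^esub> \<and>
      (\<forall>k. k \<notin> T \<longrightarrow> k \<noteq> r \<longrightarrow> D (cl (Fract (Var k) (Var l))) = \<zero>\<^bsub>Q\<^esub>)"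
    if r: "r \<notin> T" "r \<noteq> l" for r
  proof -
    \<comment> \<open>Implicit differentiation with \<open>x_l\<close> and the other free coordinate
      fixed: if \<open>x_r\<close> moves with speed \<open>x_l\<close>, then \<open>x_p\<close> must
      move with speed \<open>b p r * x_r * x_l / x_p\<close>. Multiplying by the product
      \<open>w T\<close> of all pivots clears the denominators.\<close>
    define v :: "'v \<Rightarrow> ('k, 'v) mpoly" where
      "v i = (if i = r then Var l * w T
        else if i \<in> T then Const (b i r) * (Var r * Var l * w (T - {i})) else 0)" for i
    let ?\<Delta> = "mpoly_derivation v"
    note \<Delta> = mpoly_derivation[of v]
    have lT: "l \<notin> T" using T(1) by blast
    have v_hom: "homogeneous (Suc (card T)) (v i)" for i
    proof -
      have 1: "homogeneous (Suc (card T)) (Var l * w T)"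
        using homogeneous_mult[OF homogeneous_Var[of l] w_hom[of T]] by simp
      have 2: "homogeneous (Suc (card T)) (Const (b i r) * (Var r * Var l * w (T - {i})))" if "i \<in> T"
      proof -
        have "card T = Suc (card (T - {i}))" by (rule card.remove) (use that in simp_all)
        then show ?thesis
          using homogeneous_mult[OF homogeneous_Const[of "b i r"] homogeneous_mult[OF homogeneous_mult[OF
            homogeneous_Var[of r] homogeneous_Var[of l]] w_hom[of "T - {i}"]]] by simp
      qed
      show ?thesis using 1 2 by (simp add: v_def)
    qed
    have sum: "?\<Delta> (\<Sum>k\<in>B. f k) = (\<Sum>k\<in>B. ?\<Delta> (f k))" for f and B :: "'v set"
      by (induction B rule: infinite_finite_induct)
        (use \<Delta>(3)[of 0] in \<open>simp_all add: \<Delta>(1)\<close>)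
    have diff: "?\<Delta> (f - g) = ?\<Delta> f - ?\<Delta> g" for f g
      using \<Delta>(1)[of "f - g" g] by simp
    have gen: "?\<Delta> (?e p) = 0" if p: "p \<in> T" for p
    proof -
      have pr: "p \<noteq> r" using p r(1) by blast
      have 1: "?\<Delta> (?e p) = 2 * Var p * v p - (\<Sum>k\<in>-T. Const (b p k) * (2 * Var k * v k))"
        by (simp add: diff sum \<Delta>(2,3,4) power2_eq_square algebra_simps)
      have 2: "(\<Sum>k\<in>-T. Const (b p k) * (2 * Var k * v k)) = Const (b p r) * (2 * Var r * v r)"
      proof -
        have "(\<Sum>k\<in>-T. Const (b p k) * (2 * Var k * v k)) = (\<Sum>k\<in>{r}. Const (b p k) * (2 * Var k * v k))"
          by (rule sum.mono_neutral_right) (use r(1) in \<open>auto simp: v_def\<close>)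
        then show ?thesis by simp
      qed
      have 3: "2 * Var p * v p = Const (b p r) * (2 * Var r * Var l * (Var p * w (T - {p})))"
        using p pr by (simp add: v_def mult_ac)
      have 4: "Var p * w (T - {p}) = w T"
        unfolding w_def using p by (simp add: prod.remove)
      have "v r = Var l * w T" by (simp add: v_def)
      then show ?thesis unfolding 1 2 3 4 by (simp add: mult_ac)
    qed
    \<comment> \<open>By the Leibniz rule the set on the right is an ideal, so it is enough that the
      derivation kills the generators.\<close>
    have "I \<subseteq> {f \<in> I. ?\<Delta> f \<in> I}"
    proof -
      have "ideal {f \<in> I. ?\<Delta> f \<in> I} poly_ring"
        unfolding ideal_type_algebra_iff
      proof (intro conjI ballI allI)
        show "0 \<in> {f \<in> I. ?\<Delta> f \<in> I}" using ideal_zero[OF ideal_I] \<Delta>(3)[of 0] by simp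
        show "f + g \<in> {f \<in> I. ?\<Delta> f \<in> I}" if "f \<in> {f \<in> I. ?\<Delta> f \<in> I}" "g \<in> {f \<in> I. ?\<Delta> f \<in> I}" for f g
          using that ideal_add[OF ideal_I] by (simp add: \<Delta>(1))
        show "g * f \<in> {f \<in> I. ?\<Delta> f \<in> I}" if "f \<in> {f \<in> I. ?\<Delta> f \<in> I}" for f g
          using that ideal_add[OF ideal_I] ideal_mult_left[OF ideal_I] ideal_mult_right[OF ideal_I]
          by (simp add: \<Delta>(2))
      qed
      moreover have "?e ` T \<subseteq> {f \<in> I. ?\<Delta> f \<in> I}"
        using eI gen ideal_zero[OF ideal_I] by (simp add: image_subset_iff)
      ultimately have "Idl\<^bsub>poly_ring\<^esub> (?e ` T) \<subseteq> {f \<in> I. ?\<Delta> f \<in> I}" by (rule genideal_least_type)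
      then show ?thesis by (subst (1) I)
    qed
    then have \<Delta>I: "?\<Delta> f \<in> I" if "f \<in> I" for f using that by blast
    obtain D where D: "ring_derivation Q D"
      "\<And>d f g. homogeneous d f \<Longrightarrow> homogeneous d g \<Longrightarrow> g \<notin> P \<Longrightarrow>
        D (cl (Fract f g)) = cl (Fract (g * ?\<Delta> f - f * ?\<Delta> g) (g * g * w T))"
      by (rule derivation_stalk[of ?\<Delta> "card T" "w T", OF \<Delta>(1,2) \<Delta>I mpoly_derivation_homogeneous[OF v_hom]
        w_hom w_P[OF subset_refl]]) (assumption, assumption, rule that)
    have wl: "Var l \<noteq> (0 :: ('k, 'v) mpoly)" "w T \<noteq> 0"
      using l w_P[of T] nonzero by auto
    have vl: "v l = 0" using r lT by (simp add: v_def)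
    have zero: "Fract 0 g = (0 :: ('k, 'v) mpoly fract)" if "g \<noteq> 0" for g
      using that by (simp add: Zero_fract_def eq_fract)
    have "D (cl (Fract (Const c) 1)) = \<zero>\<^bsub>Q\<^esub>" for c
      using D(2)[OF homogeneous_Const[of c] homogeneous_1 prime_one[OF prime_P]] \<Delta>(3)[of c] \<Delta>(3)[of 1] wl
      by (simp add: cl_zero zero)
    moreover have "D (cl (Fract (Var r) (Var l))) = \<one>\<^bsub>Q\<^esub>"
    proof -
      have "D (cl (Fract (Var r) (Var l))) = cl (Fract (Var l * (Var l * w T)) (Var l * Var l * w T))"
        using D(2)[OF homogeneous_Var[of r] homogeneous_Var[of l] l] by (simp add: \<Delta>(4) vl) (simp add: v_def)
      also have "Fract (Var l * (Var l * w T)) (Var l * Var l * w T) = 1"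
        using wl by (simp add: One_fract_def eq_fract)
      finally show ?thesis by (simp add: cl_one)
    qed
    moreover have "D (cl (Fract (Var k) (Var l))) = \<zero>\<^bsub>Q\<^esub>" if "k \<notin> T" "k \<noteq> r" for k
    proof -
      have "v k = 0" using that by (simp add: v_def)
      then show ?thesis
        using D(2)[OF homogeneous_Var[of k] homogeneous_Var[of l] l] wl by (simp add: \<Delta>(4) vl cl_zero zero)
    qed
    ultimately show ?thesis using D(1) by blast
  qed
  have r: "r0 \<notin> T" "r0 \<noteq> l" "r1 \<notin> T" "r1 \<noteq> l" using T by blast+
  obtain D0 where D0: "ring_derivation Q D0" "\<And>c. D0 (cl (Fract (Const c) 1)) = \<zero>\<^bsub>Q\<^esub>"
    "D0 (cl (Fract (Var r0) (Var l))) = \<one>\<^bsub>Q\<^esub>" "D0 (cl (Fract (Var r1) (Var l))) = \<zero>\<^bsub>Q\<^esub>"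
    using ex[OF r(1,2)] r(3) T(4) by metis
  obtain D1 where D1: "ring_derivation Q D1" "\<And>c. D1 (cl (Fract (Const c) 1)) = \<zero>\<^bsub>Q\<^esub>"
    "D1 (cl (Fract (Var r1) (Var l))) = \<one>\<^bsub>Q\<^esub>" "D1 (cl (Fract (Var r0) (Var l))) = \<zero>\<^bsub>Q\<^esub>"
    using ex[OF r(3,4)] r(1) T(4) by metis
  have scalar: "cl (Fract (Const c) 1) \<in> carrier Q" for c :: 'k
    by (intro cl_mem A_I[OF homogeneous_Const homogeneous_1 prime_one[OF prime_P]])
  interpret kd: kaehler Q "\<lambda>c. cl (Fract (Const c) 1)"
    by (intro kaehler.intro kaehler_axioms.intro cring_Q scalar)
  show ?thesis
  proof (rule kd.fibre_dim_2[OF ideal_nonunits _ _ D0(1) D1(1) D0(2) D1(2) D0(3,4) D1(4,3)])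
    show "cl (Fract (Var r0) (Var l)) \<in> carrier Q" "cl (Fract (Var r1) (Var l)) \<in> carrier Q"
      by (intro cl_mem A_I[OF homogeneous_Var homogeneous_Var l])+
    fix E x
    assume E: "derivation Q kd.\<Omega> E" "\<And>c. E (cl (Fract (Const c) 1)) = \<zero>\<^bsub>kd.\<Omega>\<^esub>"
      "E (cl (Fract (Var r0) (Var l))) = \<zero>\<^bsub>kd.\<Omega>\<^esub>" "E (cl (Fract (Var r1) (Var l))) = \<zero>\<^bsub>kd.\<Omega>\<^esub>"
      and x: "x \<in> carrier Q"
    \<comment> \<open>The remaining index outside \<open>T\<close> is \<open>l\<close> itself, whose
      affine coordinate is the constant 1.\<close>
    have "Fract (Var l) (Var l) = (Fract (Const 1) 1 :: ('k, 'v) mpoly fract)"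
      using l nonzero by (simp add: eq_fract)
    then have "E (cl (Fract (Var l) (Var l))) = \<zero>\<^bsub>kd.\<Omega>\<^esub>" using E(2)[of 1] by simp
    then have K: "E (cl (Fract (Var k) (Var l))) = \<zero>\<^bsub>kd.\<Omega>\<^esub>" if "k \<in> - T" for k
      using that E(3,4) unfolding T(1) by auto
    have "E (cl (Fract (Var i) (Var l))) = \<zero>\<^bsub>kd.\<Omega>\<^esub>" for i
    proof (cases "i \<in> T")
      case True
      show ?thesis
        by (rule derivation_zero_pivot[OF kd.Omega.module_axioms E(1,2) l pivots[OF True] eI[OF True] K])
    qed (use K in auto)
    then show "E x = \<zero>\<^bsub>kd.\<Omega>\<^esub>"
      by (rule derivation_zero[OF kd.Omega.module_axioms E(1,2) l _ x])
  qed
qed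

end

section \<open>Diagonal quadrics in general position\<close>

lemma UNIV_6: "(UNIV :: 6 set) = {1, 2, 3, 4, 5, 6}"
proof -
  have "card ({1, 2, 3, 4, 5, 6} :: 6 set) = 6" by simp
  then show ?thesis by (intro card_subset_eq[symmetric]) auto
qed

lemma all_6: "(\<forall>i::6. P i) \<longleftrightarrow> P 1 \<and> P 2 \<and> P 3 \<and> P 4 \<and> P 5 \<and> P 6"
proof -
  have "(\<forall>i::6. P i) \<longleftrightarrow> (\<forall>i\<in>UNIV. P i)" by simp
  also have "\<dots> \<longleftrightarrow> P 1 \<and> P 2 \<and> P 3 \<and> P 4 \<and> P 5 \<and> P 6" unfolding UNIV_6 by simp
  finally show ?thesis .
qed

definition det3 :: "('v \<Rightarrow> 'k::field) \<Rightarrow> ('v \<Rightarrow> 'k) \<Rightarrow> ('v \<Rightarrow> 'k) \<Rightarrow> 'v \<Rightarrow> 'v \<Rightarrow> 'v \<Rightarrow> 'k" where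
  "det3 \<alpha> \<beta> \<gamma> i j k = \<alpha> i * (\<beta> j * \<gamma> k - \<beta> k * \<gamma> j) - \<alpha> j * (\<beta> i * \<gamma> k - \<beta> k * \<gamma> i)
    + \<alpha> k * (\<beta> i * \<gamma> j - \<beta> j * \<gamma> i)"

definition diag_form :: "('v \<Rightarrow> 'k) \<Rightarrow> ('k::field, 'v::{finite,linorder}) mpoly" where
  "diag_form a = (\<Sum>i\<in>UNIV. Const (a i) * Var i ^ 2)"

lemma diag_form_comb:
  "diag_form (\<lambda>i. r * a i + s * b i + t * c i) =
    Const r * diag_form a + Const s * diag_form b + Const t * diag_form c"
  by (simp add: diag_form_def Const_add Const_mult distrib_right sum.distrib sum_distrib_left mult.assoc)

lemma homogeneous_diag_form: "homogeneous 2 (diag_form a)"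
proof -
  have "homogeneous (0 + 2 * 1) (Const (a i) * Var i ^ 2)" for i
    by (intro homogeneous_mult homogeneous_Const homogeneous_power homogeneous_Var)
  then have "homogeneous 2 (Const (a i) * Var i ^ 2)" for i
    by (metis add_0 mult_1_right)
  then show ?thesis unfolding diag_form_def by (rule homogeneous_sum)
qed

locale diag_system =
  fixes \<alpha> \<beta> \<gamma> :: "'v::{finite,linorder} \<Rightarrow> 'k::field_char_0"
  assumes minors: "i \<noteq> j \<Longrightarrow> i \<noteq> k \<Longrightarrow> j \<noteq> k \<Longrightarrow> det3 \<alpha> \<beta> \<gamma> i j k \<noteq> 0"
begin

definition forms :: "('k, 'v) mpoly set" where
  "forms = {diag_form \<alpha>, diag_form \<beta>, diag_form \<gamma>}"

definition I :: "('k, 'v) mpoly set" where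
  "I = Idl\<^bsub>poly_ring\<^esub> forms"

lemma ideal_I: "ideal I poly_ring"
  unfolding I_def by (rule genideal_ideal_type)

lemma forms_I: "diag_form \<alpha> \<in> I" "diag_form \<beta> \<in> I" "diag_form \<gamma> \<in> I"
  using genideal_superset_type[of forms] unfolding I_def forms_def by auto

text \<open>Gaussian elimination; the entries of the reduced matrix are quotients of minors by Cramer's rule.\<close>

lemma pivots:
  assumes p: "p1 \<noteq> p2" "p1 \<noteq> p3" "p2 \<noteq> p3"
  obtains b where
    "I = Idl\<^bsub>poly_ring\<^esub> ((\<lambda>p. Var p ^ 2 - (\<Sum>k\<in>-{p1,p2,p3}. Const (b p k) * Var k ^ 2)) ` {p1,p2,p3})"
proof -
  let ?T = "{p1, p2, p3}"
  define D where "D = det3 \<alpha> \<beta> \<gamma> p1 p2 p3"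
  have D: "D \<noteq> 0" unfolding D_def by (rule minors[OF p])
  \<comment> \<open>Column \<open>i\<close> takes the place of one pivot column: the determinant is
    \<open>D\<close> at that pivot and zero at the other two, where columns repeat.\<close>
  define e1 where "e1 i = det3 \<alpha> \<beta> \<gamma> i p2 p3 / D" for i
  define e2 where "e2 i = det3 \<alpha> \<beta> \<gamma> p1 i p3 / D" for i
  define e3 where "e3 i = det3 \<alpha> \<beta> \<gamma> p1 p2 i / D" for i
  define b where "b p i = - (if p = p1 then e1 i else if p = p2 then e2 i else e3 i)" for p i
  have unit: "e1 p1 = 1" "e1 p2 = 0" "e1 p3 = 0" "e2 p1 = 0" "e2 p2 = 1" "e2 p3 = 0"
    "e3 p1 = 0" "e3 p2 = 0" "e3 p3 = 1"
    using D unfolding e1_def e2_def e3_def by (auto simp: det3_def D_def algebra_simps)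
  have expand: "diag_form e = Var p ^ 2 - (\<Sum>k\<in>-?T. Const (- e k) * Var k ^ 2)"
    if "p \<in> ?T" "e p = 1" "\<And>q. q \<in> ?T \<Longrightarrow> q \<noteq> p \<Longrightarrow> e q = 0" for p and e :: "'v \<Rightarrow> 'k"
  proof -
    have "diag_form e = (\<Sum>i\<in>?T. Const (e i) * Var i ^ 2) + (\<Sum>i\<in>-?T. Const (e i) * Var i ^ 2)"
      unfolding diag_form_def by (subst sum.union_disjoint[symmetric]) (auto intro: sum.cong)
    also have "(\<Sum>i\<in>?T. Const (e i) * Var i ^ 2) = (\<Sum>i\<in>{p}. Const (e i) * Var i ^ 2 :: ('k, 'v) mpoly)"
      by (rule sum.mono_neutral_right) (use that in auto)
    finally show ?thesis using that(2) by (simp add: Const_uminus sum_negf)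
  qed
  have gens: "(\<lambda>p. Var p ^ 2 - (\<Sum>k\<in>-?T. Const (b p k) * Var k ^ 2)) ` ?T =
      {diag_form e1, diag_form e2, diag_form e3}"
  proof -
    have "diag_form e1 = Var p1 ^ 2 - (\<Sum>k\<in>-?T. Const (b p1 k) * Var k ^ 2)"
      "diag_form e2 = Var p2 ^ 2 - (\<Sum>k\<in>-?T. Const (b p2 k) * Var k ^ 2)"
      "diag_form e3 = Var p3 ^ 2 - (\<Sum>k\<in>-?T. Const (b p3 k) * Var k ^ 2)"
      using expand[of p1 e1] expand[of p2 e2] expand[of p3 e3] unit p by (auto simp: b_def)
    then show ?thesis by simp
  qed
  let ?E = "Idl\<^bsub>poly_ring\<^esub> {diag_form e1, diag_form e2, diag_form e3} :: ('k, 'v) mpoly set"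
  have idE: "ideal ?E poly_ring" by (rule genideal_ideal_type)
  have EE: "diag_form e1 \<in> ?E" "diag_form e2 \<in> ?E" "diag_form e3 \<in> ?E"
    using genideal_superset_type[of "{diag_form e1, diag_form e2, diag_form e3}"] by auto
  have row: "diag_form a \<in> ?E" if a: "a = \<alpha> \<or> a = \<beta> \<or> a = \<gamma>" for a
  proof -
    have "D * a i = a p1 * det3 \<alpha> \<beta> \<gamma> i p2 p3 + a p2 * det3 \<alpha> \<beta> \<gamma> p1 i p3 + a p3 * det3 \<alpha> \<beta> \<gamma> p1 p2 i" for i
      using a unfolding D_def det3_def by (elim disjE) (simp_all add: algebra_simps)
    then have "a i = a p1 * e1 i + a p2 * e2 i + a p3 * e3 i" for i
      using D unfolding e1_def e2_def e3_def by (simp add: field_simps)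
    then have "a = (\<lambda>i. a p1 * e1 i + a p2 * e2 i + a p3 * e3 i)" by (rule ext)
    then have "diag_form a = Const (a p1) * diag_form e1 + Const (a p2) * diag_form e2 + Const (a p3) * diag_form e3"
      using diag_form_comb[of "a p1" e1 "a p2" e2 "a p3" e3] by metis
    then show ?thesis
      by (simp only:) (intro ideal_add[OF idE] ideal_mult_left[OF idE] EE)
  qed
  have "I \<subseteq> ?E"
    unfolding I_def by (rule genideal_least_type[OF idE]) (use row in \<open>auto simp: forms_def\<close>)
  moreover have "?E \<subseteq> I"
  proof (rule genideal_least_type[OF ideal_I])
    have comb: "diag_form (\<lambda>i. r * \<alpha> i + s * \<beta> i + t * \<gamma> i) \<in> I" for r s t
      unfolding diag_form_comb by (intro ideal_add[OF ideal_I] ideal_mult_left[OF ideal_I] forms_I)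
    \<comment> \<open>The coefficients are the cofactors of the replaced column.\<close>
    have c1: "e1 = (\<lambda>i. ((\<beta> p2 * \<gamma> p3 - \<beta> p3 * \<gamma> p2) / D) * \<alpha> i + ((\<gamma> p2 * \<alpha> p3 - \<gamma> p3 * \<alpha> p2) / D) * \<beta> i
        + ((\<alpha> p2 * \<beta> p3 - \<alpha> p3 * \<beta> p2) / D) * \<gamma> i)"
      using D by (auto simp: e1_def det3_def field_simps)
    have c2: "e2 = (\<lambda>i. ((\<beta> p3 * \<gamma> p1 - \<beta> p1 * \<gamma> p3) / D) * \<alpha> i + ((\<gamma> p3 * \<alpha> p1 - \<gamma> p1 * \<alpha> p3) / D) * \<beta> i
        + ((\<alpha> p3 * \<beta> p1 - \<alpha> p1 * \<beta> p3) / D) * \<gamma> i)"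
      using D by (auto simp: e2_def det3_def field_simps)
    have c3: "e3 = (\<lambda>i. ((\<beta> p1 * \<gamma> p2 - \<beta> p2 * \<gamma> p1) / D) * \<alpha> i + ((\<gamma> p1 * \<alpha> p2 - \<gamma> p2 * \<alpha> p1) / D) * \<beta> i
        + ((\<alpha> p1 * \<beta> p2 - \<alpha> p2 * \<beta> p1) / D) * \<gamma> i)"
      using D by (auto simp: e3_def det3_def field_simps)
    have "diag_form e1 \<in> I" "diag_form e2 \<in> I" "diag_form e3 \<in> I"
      unfolding c1 c2 c3 by (rule comb)+
    then show "{diag_form e1, diag_form e2, diag_form e3} \<subseteq> I" by simp
  qed
  ultimately show ?thesis using that[of b] unfolding gens by blast
qed

lemma eliminable:
  assumes "p1 \<noteq> p2" "p1 \<noteq> p3" "p2 \<noteq> p3"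
  shows "eliminable I {p1, p2, p3}"
proof -
  let ?T = "{p1, p2, p3}"
  obtain b where b: "I = Idl\<^bsub>poly_ring\<^esub> ((\<lambda>p. Var p ^ 2 - (\<Sum>k\<in>-?T. Const (b p k) * Var k ^ 2)) ` ?T)"
    by (rule pivots[OF assms])
  have mem: "Var j ^ 2 - (\<Sum>k\<in>-?T. Const (b j k) * Var k ^ 2) \<in> I" if "j \<in> ?T" for j
    using subsetD[OF genideal_superset_type imageI[OF that, of "\<lambda>p. Var p ^ 2 - (\<Sum>k\<in>-?T. Const (b p k) * Var k ^ 2)"]]
    unfolding b[symmetric] .
  show ?thesis
    by (intro eliminable.intro ideal_I) (rule exI, erule mem)
qed

text \<open>If every coordinate outside the triple lay in \<open>P\<close>, the relation for
  \<open>Var a ^ 2\<close> in terms of them would put \<open>Var a\<close> into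
  \<open>P\<close>.\<close>

lemma nonzero_coordinate:
  assumes P: "P \<in> proj_points I" and abc: "a \<noteq> b" "a \<noteq> c" "b \<noteq> c" and a: "Var a \<notin> P"
  shows "\<exists>i. i \<notin> {a, b, c} \<and> Var i \<notin> P"
proof (rule ccontr)
  assume no: "\<not> (\<exists>i. i \<notin> {a, b, c} \<and> Var i \<notin> P)"
  interpret eliminable I "{a, b, c}" by (rule eliminable[OF abc])
  obtain f where f: "Var a ^ 2 - (\<Sum>k\<in>-{a, b, c}. Const (f k) * Var k ^ 2) \<in> I"
    using eliminate[of a] by auto
  note id = prime_ideal[OF proj_pointsD(1)[OF P]]
  have "(\<Sum>k\<in>-{a, b, c}. Const (f k) * Var k ^ 2) \<in> P"
  proof (rule ideal_sum[OF id])
    fix k assume "k \<in> - {a, b, c}"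
    then have "Var k \<in> P" using no by blast
    then show "Const (f k) * Var k ^ 2 \<in> P"
      unfolding power2_eq_square by (intro ideal_mult_left[OF id])
  qed
  from ideal_add[OF id subsetD[OF proj_pointsD(3)[OF P] f] this] have "Var a ^ 2 \<in> P" by simp
  then have "Var a \<in> P" by (rule prime_power[OF proj_pointsD(1)[OF P]])
  then show False using a by contradiction
qed

lemma fibre_dim_stalk:
  assumes card: "CARD('v) = 6" and P: "P \<in> proj_points I"
  shows "fibre_dim (stalk (proj_subscheme forms) P)
    (kaehler_module (stalk (proj_subscheme forms) P) (scalar (proj_subscheme forms) P)) 2"
proof -
  interpret proj_stalk I P by (intro proj_stalk.intro ideal_I P)
  have other: "\<exists>j. j \<notin> B" if "card B < 6" for B :: "'v set"
    using that card by (metis UNIV_eq_I less_irrefl)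
  have bound: "card {a, b} < 6" "card {a} < 6" for a b :: 'v
    by (auto simp: card_insert_if)
  obtain l where l: "Var l \<notin> P" using proj_pointsD(4)[OF P] by blast
  \<comment> \<open>The indices \<open>j\<close>, \<open>j'\<close>, \<open>j''\<close> only fill up
    triples containing \<open>l\<close>. Each triple also contains the pivots found so far, so
    \<open>nonzero_coordinate\<close> yields a new one each time.\<close>
  obtain j where j: "j \<notin> {l}" using other[of "{l}"] by auto
  obtain j' where j': "j' \<notin> {l, j}" using other[of "{l, j}"] bound by blast
  obtain p1 where p1: "p1 \<notin> {l, j, j'}" "Var p1 \<notin> P"
    using nonzero_coordinate[OF P, of l j j'] l j j' by auto
  obtain j'' where j'': "j'' \<notin> {l, p1}" using other[of "{l, p1}"] bound by blast
  obtain p2 where p2: "p2 \<notin> {l, p1, j''}" "Var p2 \<notin> P"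
    using nonzero_coordinate[OF P, of l p1 j''] l p1 j'' by auto
  obtain p3 where p3: "p3 \<notin> {l, p1, p2}" "Var p3 \<notin> P"
    using nonzero_coordinate[OF P, of l p1 p2] l p1 p2 by auto
  let ?T = "{p1, p2, p3}"
  have "card {l, p1, p2, p3} = 4"
    using p1(1) p2(1) p3(1) by (auto simp: card_insert_if)
  moreover have "- ?T - {l} = - {l, p1, p2, p3}" by blast
  ultimately have "card (- ?T - {l}) = 2"
    using card by (simp add: Compl_eq_Diff_UNIV card_Diff_subset)
  then obtain r0 r1 where r: "- ?T - {l} = {r0, r1}" "r0 \<noteq> r1" by (auto simp: card_2_iff)
  have T: "- ?T = {l, r0, r1}" using r(1) p1(1) p2(1) p3(1) by blast
  have lr: "l \<noteq> r0" "l \<noteq> r1" using r(1) by blast+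
  obtain b where b: "I = Idl\<^bsub>poly_ring\<^esub> ((\<lambda>p. Var p ^ 2 - (\<Sum>k\<in>-?T. Const (b p k) * Var k ^ 2)) ` ?T)"
    by (rule pivots[of p1 p2 p3]) (use p1 p2 p3 in auto)
  have "fibre_dim Q (kaehler_module Q (\<lambda>c. cl (Fract (Const c) 1))) 2"
    by (rule fibre_dim_diagonal[OF b T lr r(2) l]) (use p1 p2 p3 in auto)
  then show ?thesis
    by (simp add: proj_subscheme_def Let_def homogeneous_localization_eq cl_def[abs_def] flip: I_def)
qed

lemma smooth_if_dim_2:
  assumes "CARD('v) = 6" "I \<in> proj_points I" "krull_dim (zariski_topology I) = 2"
  shows "smooth (proj_subscheme forms)"
proof -
  let ?Y = "proj_subscheme forms"
  have sp: "space ?Y = zariski_topology I" by (simp add: proj_subscheme_def Let_def I_def)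
  have whole: "open_subscheme ?Y (topspace (space ?Y)) = ?Y"
    by (simp add: open_subscheme_def)
  have "smooth_of_rel_dim ?Y 2"
    unfolding smooth_of_rel_dim_def
  proof (intro conjI allI impI ballI)
    fix Z assume "irreducible_component (space ?Y) Z"
    then have "Z = topspace (zariski_topology I)"
      using irreducible_component_irreducible_space[OF irreducible_space_zariski[OF assms(2)]] by (simp add: sp)
    then show "krull_dim (subtopology (space ?Y) Z) = enat 2"
      using assms(3) by (simp add: sp numeral_eq_enat)
  next
    fix P assume "P \<in> topspace (space ?Y)"
    then show "fibre_dim (stalk ?Y P) (kaehler_module (stalk ?Y P) (scalar ?Y P)) 2"
      using fibre_dim_stalk[OF assms(1)] by (simp add: sp topspace_zariski)
  qed
  then show ?thesis
    unfolding smooth_def by (intro ballI exI[of _ "topspace (space ?Y)"] exI[of _ 2]) (simp add: whole)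
qed

end

section \<open>The surface\<close>

text \<open>Supplies characteristic 0 for the field of functions in \<open>prime_I\<close>, where
  \<open>nonsquare_quad_ext\<close> cancels 2.\<close>

instance fract :: ("{idom,ring_char_0}") field_char_0
proof
  show "inj (of_nat :: nat \<Rightarrow> 'a fract)"
    by (rule injI) (simp add: of_nat_fract eq_fract)
qed

lemma hom_simps_iff:
  "comm_ring_hom1 h \<longleftrightarrow> (\<forall>x y. h (x + y) = h x + h y \<and> h (x * y) = h x * h y) \<and> h 1 = 1"
  unfolding comm_ring_hom1_def by blast

lemma const_poly_hom:
  fixes g :: "'a::comm_ring_1 poly \<Rightarrow> 'b::comm_ring_1"
  assumes "comm_ring_hom1 g"
  shows "comm_ring_hom1 (\<lambda>c. g [:c:])"
proof -
  interpret g: comm_ring_hom1 g by fact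
  interpret i: comm_ring_hom1 "\<lambda>c::'a. c" by unfold_locales simp_all
  interpret p: comm_ring_hom1 "\<lambda>c::'a. [:c:]" by (rule i.hom_const_poly)
  show ?thesis by unfold_locales (simp_all only: p.hom_simps g.hom_simps)
qed

section \<open>The three quadrics with coefficient \<open>c\<close>\<close>

locale barth_hulek =
  fixes c :: complex
  assumes c: "c * c = c + 1"
begin

lemma c_nz: "c \<noteq> 0" "c \<noteq> - 1" "1 + c \<noteq> 0" "c \<noteq> 1"
  using c by (auto simp: add_eq_0_iff)

definition row1 :: "6 \<Rightarrow> complex" where
  "row1 i = (if i = 1 \<or> i = 4 then 1 else if i = 5 then - c else if i = 6 then c else 0)"

definition row2 :: "6 \<Rightarrow> complex" where
  "row2 i = (if i = 2 \<or> i = 5 then 1 else if i = 4 \<or> i = 6 then - c else 0)"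

definition row3 :: "6 \<Rightarrow> complex" where
  "row3 i = (if i = 3 \<or> i = 6 then 1 else if i = 4 then c else if i = 5 then - c else 0)"

lemma rows:
  "row1 1 = 1" "row1 2 = 0" "row1 3 = 0" "row1 4 = 1" "row1 5 = - c" "row1 6 = c"
  "row2 1 = 0" "row2 2 = 1" "row2 3 = 0" "row2 4 = - c" "row2 5 = 1" "row2 6 = - c"
  "row3 1 = 0" "row3 2 = 0" "row3 3 = 1" "row3 4 = c" "row3 5 = - c" "row3 6 = 1"
  by (simp_all add: row1_def row2_def row3_def)

text \<open>Three columns are unit vectors, so the minors are, up to sign, the minors of all sizes
  of the block of columns 4, 5, 6. By \<open>c * c = c + 1\<close> each of them is \<open>1\<close>
  or \<open>c\<close> up to sign.\<close>

lemma det_rows: "\<forall>i j k. i \<noteq> j \<longrightarrow> i \<noteq> k \<longrightarrow> j \<noteq> k \<longrightarrow> det3 row1 row2 row3 i j k \<noteq> 0"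
proof -
  \<comment> \<open>Lowers powers of \<open>c\<close> inside longer products, so that simplification
    ends with expressions linear in \<open>c\<close>.\<close>
  have cc: "c * (c * x) = (c + 1) * x" for x using c by (simp add: mult.assoc[symmetric])
  show ?thesis
    unfolding all_6 det3_def rows
    using c_nz by (simp add: c cc algebra_simps)
qed

sublocale diag_system row1 row2 row3
  by unfold_locales (use det_rows in blast)

lemma diag_form_6:
  "diag_form a = Const (a 1) * Var 1 ^ 2 + Const (a 2) * Var 2 ^ 2 + Const (a 3) * Var 3 ^ 2
    + Const (a 4) * Var 4 ^ 2 + Const (a 5) * Var 5 ^ 2 + Const (a 6) * Var (6::6) ^ 2"
  unfolding diag_form_def UNIV_6 by (simp add: add_ac)

text \<open>The function field is generated by the square roots of \<open>s1\<close>, \<open>s2\<close>, \<open>s3\<close> over the field of rational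
  functions in \<open>x4\<close>, \<open>x5\<close>, \<open>x6\<close>. In the iterated polynomial ring, \<open>x4\<close> is the outermost variable and
  \<open>x5\<close> the innermost.\<close>

abbreviation (input) "Y \<equiv> [:0, 1:] :: complex poly poly poly"
abbreviation (input) "W \<equiv> [:[:0, 1:]:] :: complex poly poly poly"
abbreviation (input) "U \<equiv> [:[:[:0, 1:]:]:] :: complex poly poly poly"
abbreviation (input) "cst a \<equiv> [:[:[:a:]:]:] :: complex poly poly poly"

definition "s1 = - (Y ^ 2) + cst c * U ^ 2 - cst c * W ^ 2"
definition "s2 = cst c * Y ^ 2 - U ^ 2 + cst c * W ^ 2"
definition "s3 = - (cst c) * Y ^ 2 + cst c * U ^ 2 - W ^ 2"

text \<open>The two evaluations set \<open>x4 = 1\<close> and then \<open>x6 = 0\<close>, leaving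
  polynomials in \<open>x5\<close>.\<close>

lemma specialize:
  "poly (poly s1 1) 0 = [:- 1, 0, c:]" "poly (poly s2 1) 0 = [:c, 0, - 1:]" "poly (poly s3 1) 0 = [:- c, 0, c:]"
  by (simp_all add: s1_def s2_def s3_def power2_eq_square one_pCons)

text \<open>After specialization the squares of the roots are \<open>1/c\<close>, \<open>c\<close>
  and \<open>1\<close>, which are distinct. So each product has a simple root that is no root of its
  other factors.\<close>

lemma nonsquare_forms:
  "nonsquare UNIV s1" "nonsquare UNIV s2" "nonsquare UNIV s3" "nonsquare UNIV (s1 * s2)"
  "nonsquare UNIV (s1 * s3)" "nonsquare UNIV (s2 * s3)" "nonsquare UNIV (s1 * s2 * s3)"
proof -
  have red: "nonsquare UNIV l" if "nonsquare UNIV (poly (poly l 1) 0)" for l :: "complex poly poly poly"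
    by (rule nonsquare_poly_eval[where c = 1], rule nonsquare_poly_eval[where c = 0], rule that)
  obtain r where r: "r * r = c" using power2_csqrt[of c] by (metis power2_eq_square)
  have r0: "r \<noteq> 0" using r c_nz by auto
  let ?m2 = "[:c, 0, - 1:]" and ?m3 = "[:- c, 0, c:]"
  have f1: "[:- 1, 0, c:] = [:- inverse r, 1:] * [:r, c:]"
    using r r0 by (simp add: field_simps)
  have f2: "?m2 = [:- r, 1:] * [:- r, - 1:]" using r by simp
  have f3: "?m3 = [:- 1, 1:] * [:c, c:]" by simp
  have ir: "inverse r * inverse r = inverse c" by (simp flip: r)
  have cc: "c - inverse c \<noteq> 0" "c * inverse c = 1" "c * c - c \<noteq> 0"
    using c c_nz by (auto simp: field_simps)
  have e1: "poly [:r, c:] (inverse r) \<noteq> 0" using r0 r by (simp add: field_simps flip: r)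
  have e2: "poly ?m2 (inverse r) \<noteq> 0" using cc(1) by (simp add: mult.assoc[symmetric] ir algebra_simps)
  have e3: "poly ?m3 (inverse r) \<noteq> 0"
  proof -
    have "poly ?m3 (inverse r) = - c + c * (inverse r * inverse r)" by (simp add: algebra_simps)
    then show ?thesis using cc(2) c_nz by (simp add: ir)
  qed
  have e4: "poly [:- r, - 1:] r \<noteq> 0" using r0 by simp
  have e5: "poly ?m3 r \<noteq> 0"
  proof -
    have "poly ?m3 r = - c + c * (r * r)" by (simp add: algebra_simps)
    then show ?thesis using cc(3) by (simp add: r)
  qed
  have e6: "poly [:c, c:] 1 \<noteq> 0" using c_nz by simp
  show "nonsquare UNIV s1"
    by (rule red) (simp only: specialize f1 nonsquare_simple_root[OF e1])
  show "nonsquare UNIV s2"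
    by (rule red) (simp only: specialize f2 nonsquare_simple_root[OF e4])
  show "nonsquare UNIV s3"
    by (rule red) (simp only: specialize f3 nonsquare_simple_root[OF e6])
  show "nonsquare UNIV (s1 * s2)"
    by (rule red) (simp only: specialize poly_mult f1 mult.assoc,
        rule nonsquare_simple_root, use e1 e2 in \<open>simp only: poly_mult\<close>, simp)
  show "nonsquare UNIV (s1 * s3)"
    by (rule red) (simp only: specialize poly_mult f1 mult.assoc,
        rule nonsquare_simple_root, use e1 e3 in \<open>simp only: poly_mult\<close>, simp)
  show "nonsquare UNIV (s2 * s3)"
    by (rule red) (simp only: specialize poly_mult f2 mult.assoc,
        rule nonsquare_simple_root, use e4 e5 in \<open>simp only: poly_mult\<close>, simp)
  show "nonsquare UNIV (s1 * s2 * s3)"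
    by (rule red) (simp only: specialize poly_mult f1 mult.assoc,
        rule nonsquare_simple_root, use e1 e2 e3 in \<open>simp only: poly_mult\<close>, simp)
qed

text \<open>The variables are sent to a generic point whose first three coordinates are square roots
  in an algebraic closure. The kernel of this evaluation \<theta> is prime and contains
  \<open>I\<close>; \<open>kernel_three_square_roots\<close> gives the converse inclusion.\<close>

lemma prime_I: "primeideal I poly_ring" and Var_6_I: "Var 6 \<notin> I"
proof -
  define \<iota> :: "complex poly poly poly \<Rightarrow> complex poly poly poly fract alg_closure"
    where "\<iota> p = to_ac (to_fract p)" for p
  have \<iota>: "comm_ring_hom1 \<iota>" by (simp add: hom_simps_iff \<iota>_def)
  interpret \<iota>: comm_ring_hom1 \<iota> by (rule \<iota>)
  have inj: "inj \<iota>" by (rule injI) (simp add: \<iota>_def)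
  obtain t1 t2 t3 where t: "t1 ^ 2 = \<iota> s1" "t2 ^ 2 = \<iota> s2" "t3 ^ 2 = \<iota> s3"
    using nth_root_exists[of 2] by (metis pos2)
  define a where "a i = (if i = 1 then t1 else if i = 2 then t2 else if i = 3 then t3
    else if i = 4 then \<iota> Y else if i = 5 then \<iota> U else \<iota> W)" for i :: 6
  have a: "a 1 = t1" "a 2 = t2" "a 3 = t3" "a 4 = \<iota> Y" "a 5 = \<iota> U" "a 6 = \<iota> W"
    by (simp_all add: a_def)
  define \<kappa> where "\<kappa> z = \<iota> (cst z)" for z
  have \<kappa>: "comm_ring_hom1 \<kappa>"
    unfolding \<kappa>_def by (rule const_poly_hom[OF const_poly_hom[OF const_poly_hom[OF \<iota>]]])
  interpret \<kappa>: comm_ring_hom1 \<kappa> by (rule \<kappa>)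
  define \<theta> where "\<theta> = (meval \<kappa> a :: (complex, 6) mpoly \<Rightarrow> _)"
  have \<theta>: "comm_ring_hom1 \<theta>" unfolding \<theta>_def by (rule \<kappa>.meval_hom)
  interpret \<theta>: comm_ring_hom1 \<theta> by (rule \<theta>)
  have \<theta>_Var: "\<theta> (Var i) = a i" and \<theta>_Const: "\<theta> (Const z) = \<kappa> z" for i z
    by (simp_all add: \<theta>_def \<kappa>.meval_Var \<kappa>.meval_Const)
  have Const: "comm_ring_hom1 (Const :: complex \<Rightarrow> (complex, 6) mpoly)"
    by (simp add: hom_simps_iff Const_add Const_mult)
  \<comment> \<open>Reads nested polynomials as polynomials in \<open>x5\<close>, \<open>x6\<close>,
    \<open>x4\<close>, from the innermost variable outwards. Composition with \<theta> gives back
    the embedding \<iota>.\<close>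
  define \<beta>1 :: "complex poly \<Rightarrow> (complex, 6) mpoly" where "\<beta>1 p = poly (map_poly Const p) (Var 5)" for p
  define \<beta>2 :: "complex poly poly \<Rightarrow> (complex, 6) mpoly" where "\<beta>2 p = poly (map_poly \<beta>1 p) (Var 6)" for p
  define \<beta> :: "complex poly poly poly \<Rightarrow> (complex, 6) mpoly" where "\<beta> p = poly (map_poly \<beta>2 p) (Var 4)" for p
  have b1: "comm_ring_hom1 \<beta>1" unfolding \<beta>1_def by (rule poly_eval_hom[OF Const])
  have b2: "comm_ring_hom1 \<beta>2" unfolding \<beta>2_def by (rule poly_eval_hom[OF b1])
  have b3: "comm_ring_hom1 \<beta>" unfolding \<beta>_def by (rule poly_eval_hom[OF b2])
  interpret b1: comm_ring_hom1 \<beta>1 by (rule b1)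
  interpret b2: comm_ring_hom1 \<beta>2 by (rule b2)
  interpret \<beta>: comm_ring_hom1 \<beta> by (rule b3)
  have \<beta>1_vals: "\<beta>1 [:z:] = Const z" "\<beta>1 [:0, 1:] = Var 5" for z
    by (simp_all add: \<beta>1_def map_poly_pCons)
  have \<beta>2_vals: "\<beta>2 [:p:] = \<beta>1 p" "\<beta>2 [:0, 1:] = Var 6" for p
    by (simp_all add: \<beta>2_def map_poly_pCons b1.hom_0 b1.hom_1)
  have \<beta>_vals: "\<beta> [:p:] = \<beta>2 p" "\<beta> [:0, 1:] = Var 4" for p
    by (simp_all add: \<beta>_def map_poly_pCons b2.hom_0 b2.hom_1)
  have \<theta>\<beta>1: "\<theta> (\<beta>1 p) = \<iota> [:[:p:]:]" for p
  proof (rule poly_hom_eqI[where p = p])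
    show "comm_ring_hom1 (\<lambda>p. \<theta> (\<beta>1 p))" by (simp add: hom_simps_iff b1.hom_simps \<theta>.hom_simps)
    show "comm_ring_hom1 (\<lambda>p. \<iota> [:[:p:]:])"
      by (rule const_poly_hom[OF const_poly_hom[OF \<iota>]])
  qed (simp_all add: \<beta>1_vals \<theta>_Const \<theta>_Var a \<kappa>_def)
  have \<theta>\<beta>2: "\<theta> (\<beta>2 p) = \<iota> [:p:]" for p
  proof (rule poly_hom_eqI[where p = p])
    show "comm_ring_hom1 (\<lambda>p. \<theta> (\<beta>2 p))" by (simp add: hom_simps_iff b2.hom_simps \<theta>.hom_simps)
    show "comm_ring_hom1 (\<lambda>p. \<iota> [:p:])"
      by (rule const_poly_hom[OF \<iota>])
  qed (simp_all add: \<beta>2_vals \<theta>\<beta>1 \<theta>_Var a)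
  have \<theta>\<beta>: "\<theta> (\<beta> p) = \<iota> p" for p
  proof (rule poly_hom_eqI[where p = p])
    show "comm_ring_hom1 (\<lambda>p. \<theta> (\<beta> p))" by (simp add: hom_simps_iff \<beta>.hom_simps \<theta>.hom_simps)
  qed (simp_all add: \<beta>_vals \<theta>\<beta>2 \<theta>_Var a \<iota>)
  have \<beta>_cst: "\<beta> (cst z) = Const z" "\<beta> U = Var 5" "\<beta> W = Var 6" "\<beta> Y = Var 4" for z
    by (simp_all add: \<beta>_vals \<beta>2_vals \<beta>1_vals)
  have sq: "Var 1 ^ 2 - \<beta> s1 = diag_form row1" "Var 2 ^ 2 - \<beta> s2 = diag_form row2"
    "Var 3 ^ 2 - \<beta> s3 = diag_form row3"
    unfolding s1_def s2_def s3_def \<beta>.hom_simps \<beta>_cst diag_form_6 rows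
    by (simp_all add: Const_uminus)
  have \<theta>_sq: "\<theta> (Var 1 ^ 2) = \<iota> s1" "\<theta> (Var 2 ^ 2) = \<iota> s2" "\<theta> (Var 3 ^ 2) = \<iota> s3"
    by (simp_all add: \<theta>.hom_power \<theta>_Var a t)
  have \<theta>_I: "\<theta> f = 0" if "f \<in> I" for f
  proof -
    have "I \<subseteq> {f. \<theta> f = 0}"
      unfolding I_def
    proof (rule genideal_least_type)
      show "ideal {f. \<theta> f = 0} poly_ring"
        unfolding \<theta>_def by (rule prime_ideal[OF primeideal_meval_kernel[OF \<kappa>]])
      show "forms \<subseteq> {f. \<theta> f = 0}"
        unfolding forms_def sq[symmetric] by (simp add: \<theta>.hom_diff \<theta>_sq \<theta>\<beta>)
    qed
    then show ?thesis using that by blast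
  qed
  \<comment> \<open>Polynomials in \<open>x4\<close>, \<open>x5\<close>, \<open>x6\<close> up to
    congruence modulo \<open>I\<close>; the congruence puts the squares of \<open>x1\<close>,
    \<open>x2\<close>, \<open>x3\<close> into the base ring of the tower.\<close>
  define T0 where "T0 = {f. \<exists>p. f - \<beta> p \<in> I}"
  have T0_I: "f \<in> T0" if "f - \<beta> p \<in> I" for f p
    unfolding T0_def using that by blast
  have T0: "subring_set T0"
    unfolding subring_set_def
  proof (intro conjI ballI)
    show "1 \<in> T0" by (rule T0_I[of _ 1]) (simp add: \<beta>.hom_1 ideal_zero[OF ideal_I])
    fix f g assume "f \<in> T0" "g \<in> T0"
    then obtain p q where pq: "f - \<beta> p \<in> I" "g - \<beta> q \<in> I" by (auto simp: T0_def)
    have eq: "f + g - \<beta> (p + q) = (f - \<beta> p) + (g - \<beta> q)" "f - g - \<beta> (p - q) = (f - \<beta> p) - (g - \<beta> q)"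
      "f * g - \<beta> (p * q) = f * (g - \<beta> q) + (f - \<beta> p) * \<beta> q"
      by (simp_all add: \<beta>.hom_simps algebra_simps)
    show "f + g \<in> T0"
      by (rule T0_I[of _ "p + q"]) (unfold eq, rule ideal_add[OF ideal_I pq])
    show "f - g \<in> T0"
      by (rule T0_I[of _ "p - q"]) (unfold eq, rule ideal_diff[OF ideal_I pq])
    show "f * g \<in> T0"
      by (rule T0_I[of _ "p * q"])
        (unfold eq, intro ideal_add[OF ideal_I] ideal_mult_left[OF ideal_I] ideal_mult_right[OF ideal_I] pq)
  qed
  have \<beta>_T0: "\<beta> p \<in> T0" for p
    by (rule T0_I[of _ p]) (simp add: ideal_zero[OF ideal_I])
  have sq_T0: "Var 1 ^ 2 \<in> T0" "Var 2 ^ 2 \<in> T0" "Var 3 ^ 2 \<in> T0"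
    using T0_I[of "Var 1 ^ 2" s1] T0_I[of "Var 2 ^ 2" s2] T0_I[of "Var 3 ^ 2" s3] forms_I
    unfolding sq by blast+
  have \<theta>_T0: "\<theta> ` T0 \<subseteq> range \<iota>"
  proof
    fix x assume "x \<in> \<theta> ` T0"
    then obtain f p where "x = \<theta> f" "f - \<beta> p \<in> I" by (auto simp: T0_def)
    then have "x = \<iota> p" using \<theta>_I[of "f - \<beta> p"] by (simp add: \<theta>.hom_diff \<theta>\<beta>)
    then show "x \<in> range \<iota>" by blast
  qed
  have nsq: "nonsquare (\<theta> ` T0) (\<iota> l)" if "nonsquare UNIV l" for l
    using nonsquare_image[OF \<iota> inj that] \<theta>_T0 unfolding nonsquare_def by blast
  have ker0: "f \<in> I" if f: "f \<in> T0" "\<theta> f = 0" for f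
  proof -
    obtain p where p: "f - \<beta> p \<in> I" using f(1) by (auto simp: T0_def)
    then have "\<iota> p = \<iota> 0" using \<theta>_I[OF p] f(2) by (simp add: \<theta>.hom_diff \<theta>\<beta> \<iota>.hom_0)
    then have "p = 0" using inj by (simp add: inj_eq)
    then show ?thesis using p by (simp add: \<beta>.hom_0)
  qed
  let ?E1 = "quad_ext T0 (Var 1)"
  let ?E2 = "quad_ext ?E1 (Var 2)"
  let ?E3 = "quad_ext ?E2 (Var 3)"
  have E1: "subring_set ?E1" by (rule subring_quad_ext[OF T0 sq_T0(1)])
  have sub1: "T0 \<subseteq> ?E1" by (rule quad_ext_superset[OF T0])
  have E2: "subring_set ?E2" by (rule subring_quad_ext[OF E1 subsetD[OF sub1 sq_T0(2)]])
  have sub2: "?E1 \<subseteq> ?E2" by (rule quad_ext_superset[OF E1])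
  have E3: "subring_set ?E3" by (rule subring_quad_ext[OF E2 subsetD[OF sub2 subsetD[OF sub1 sq_T0(3)]]])
  have sub3: "?E2 \<subseteq> ?E3" by (rule quad_ext_superset[OF E2])
  have all: "f \<in> ?E3" for f
  proof (induction f rule: mpoly_induct)
    case (Const z)
    show ?case using sub1 sub2 sub3 \<beta>_T0[of "cst z"] by (auto simp: \<beta>_cst)
  next
    case (Var i)
    have "\<forall>i. Var i \<in> ?E3"
      unfolding all_6
      using quad_ext_root[OF T0, of "Var 1"] quad_ext_root[OF E1, of "Var 2"] quad_ext_root[OF E2, of "Var 3"]
        sub1 sub2 sub3 \<beta>_T0[of Y] \<beta>_T0[of U] \<beta>_T0[of W] by (auto simp: \<beta>_cst)
    then show ?case by blast
  qed (use subring_setD[OF E3] in blast)+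
  have ker: "\<theta> f = 0 \<longleftrightarrow> f \<in> I" for f
  proof
    assume "\<theta> f = 0"
    show "f \<in> I"
    proof (rule kernel_three_square_roots[OF \<theta> ideal_I T0 sq_T0])
      show "g \<in> I" if "g \<in> T0" "\<theta> g = 0" for g by (rule ker0[OF that])
      show "f \<in> ?E3" by (rule all)
      show "\<theta> f = 0" by fact
    qed (simp_all add: \<theta>.hom_mult \<theta>_sq nsq[OF nonsquare_forms(1)] nsq[OF nonsquare_forms(2)]
        nsq[OF nonsquare_forms(3)] nsq[OF nonsquare_forms(4), unfolded \<iota>.hom_mult]
        nsq[OF nonsquare_forms(5), unfolded \<iota>.hom_mult] nsq[OF nonsquare_forms(6), unfolded \<iota>.hom_mult]
        nsq[OF nonsquare_forms(7), unfolded \<iota>.hom_mult])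
  qed (rule \<theta>_I)
  then have "I = {f. meval \<kappa> a f = 0}" by (auto simp: \<theta>_def)
  then show "primeideal I poly_ring"
    using primeideal_meval_kernel[OF \<kappa>, of a] by simp
  have "\<iota> W \<noteq> \<iota> 0" using inj by (simp add: inj_eq)
  then show "Var 6 \<notin> I" using ker[of "Var 6"] by (simp add: \<theta>_Var a \<iota>.hom_0)
qed

section \<open>Generic point and dimension of the surface\<close>

lemma I_point: "I \<in> proj_points I"
  by (rule generated_proj_points[OF I_def _ prime_I Var_6_I])
    (auto simp: forms_def intro: homogeneous_diag_form)

lemma krull_dim_le: "krull_dim (zariski_topology I) \<le> 2"
proof -
  interpret eliminable I "{1, 2, 3}" by (rule eliminable) simp_all
  have "card (- {1, 2, 3} :: 6 set) = 3"
    by (simp add: Compl_eq_Diff_UNIV card_Diff_subset)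
  note le = chain_length_le[OF this]
  show ?thesis
    unfolding krull_dim_def
  proof (rule Sup_least, clarify)
    fix n and Z :: "nat \<Rightarrow> (complex, 6) mpoly set set"
    assume "\<forall>i\<le>n. closedin (zariski_topology I) (Z i) \<and> irreducible_subset (zariski_topology I) (Z i)"
      "\<forall>i<n. Z i \<subset> Z (Suc i)"
    then have "n \<le> 2" using le[of n Z] by blast
    then show "enat n \<le> 2" by (simp add: numeral_eq_enat)
  qed
qed

text \<open>Near a point with \<open>x4 = 1\<close> and \<open>x5 = x6 = 0\<close>, the curve \<open>x6 = 0\<close> has a power series parametrization
  with parameter \<open>x5\<close>. Its generic point lies strictly between the generic point and a closed point.\<close>

lemma krull_dim_ge: "2 \<le> krull_dim (zariski_topology I)"
proof -
  let ?sq = "\<lambda>f::complex fps. fps_radical (\<lambda>_. csqrt) 2 f"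
  have sq: "?sq f ^ 2 = f" if "f $ 0 \<noteq> 0" for f
    using power_radical[OF that, of "\<lambda>_. csqrt" 1] power2_csqrt[of "f $ 0"] unfolding Suc_1 by blast
  let ?X = "fps_X :: complex fps" and ?c = "fps_const c"
  \<comment> \<open>The squares of \<open>x1\<close>, \<open>x2\<close>, \<open>x3\<close> forced by
    the quadrics at \<open>x4 = 1\<close>, \<open>x5 = X\<close>, \<open>x6 = 0\<close>.\<close>
  let ?t1 = "?c * ?X ^ 2 - 1" and ?t2 = "?c - ?X ^ 2" and ?t3 = "?c * ?X ^ 2 - ?c"
  \<comment> \<open>The constant terms are \<open>-1\<close>, \<open>c\<close> and
    \<open>-c\<close>; being nonzero, they allow square roots as power series.\<close>
  have c0: "?t1 $ 0 \<noteq> 0" "?t2 $ 0 \<noteq> 0" "?t3 $ 0 \<noteq> 0"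
    using c_nz by (simp_all add: power2_eq_square)
  define a where "a i = (if i = 1 then ?sq ?t1 else if i = 2 then ?sq ?t2 else if i = 3 then ?sq ?t3
    else if i = 4 then 1 else if i = 5 then ?X else 0)" for i :: 6
  have a: "a 1 = ?sq ?t1" "a 2 = ?sq ?t2" "a 3 = ?sq ?t3" "a 4 = 1" "a 5 = ?X" "a 6 = 0"
    by (simp_all add: a_def)
  have h: "comm_ring_hom1 (fps_const :: complex \<Rightarrow> _)"
    by (simp add: hom_simps_iff fps_const_add fps_const_mult)
  have g: "comm_ring_hom1 (\<lambda>f::complex fps. f $ 0)" by (simp add: hom_simps_iff)
  interpret h: comm_ring_hom1 "fps_const :: complex \<Rightarrow> _" by (rule h)
  have gh: "comm_ring_hom1 (\<lambda>z::complex. fps_const z $ 0)" by (simp add: hom_simps_iff)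
  interpret gh: comm_ring_hom1 "\<lambda>z::complex. fps_const z $ 0" by (rule gh)
  define P1 where "P1 = (point_ideal fps_const a :: (complex, 6) mpoly set)"
  \<comment> \<open>Taking constant terms sets \<open>x5 = 0\<close> on the curve, which gives the
    closed point.\<close>
  define P2 where "P2 = (point_ideal (\<lambda>z. fps_const z $ 0) (\<lambda>i. a i $ 0) :: (complex, 6) mpoly set)"
  have sub: "P1 \<subseteq> P2"
    unfolding P1_def P2_def by (rule point_ideal_specialize[OF h g, of a 4]) (simp add: a)
  have "forms \<subseteq> P1"
  proof -
    have "meval fps_const a (diag_form row1) = 0" "meval fps_const a (diag_form row2) = 0"
      "meval fps_const a (diag_form row3) = 0"
      unfolding diag_form_6 rows h.meval_simps a sq[OF c0(1)] sq[OF c0(2)] sq[OF c0(3)]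
      by (simp_all flip: fps_const_neg)
    then show ?thesis
      unfolding forms_def P1_def using point_ideal_homogeneous_iff[OF h homogeneous_diag_form] by blast
  qed
  moreover have "ideal P1 poly_ring"
    unfolding P1_def point_ideal_def
    by (rule prime_ideal[OF primeideal_meval_kernel[OF h.hom_const_poly]])
  ultimately have IP1: "I \<subseteq> P1" unfolding I_def by (intro genideal_least_type)
  have P1: "P1 \<in> proj_points I"
    using IP1 unfolding P1_def by (rule point_ideal_proj_points[OF h, of _ _ 4]) (simp add: a)
  have "I \<subseteq> P2" using IP1 sub by blast
  then have P2: "P2 \<in> proj_points I"
    unfolding P2_def by (rule point_ideal_proj_points[OF gh, of _ _ 4]) (simp add: a)
  \<comment> \<open>The inclusions are strict: \<open>Var 6\<close> separates \<open>I\<close> from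
    \<open>P1\<close>, and \<open>Var 5\<close> separates \<open>P1\<close> from
    \<open>P2\<close>.\<close>
  have "Var 6 \<in> P1"
    unfolding P1_def point_ideal_homogeneous_iff[OF h homogeneous_Var] by (simp add: h.meval_Var a)
  then have "I \<subset> P1" using IP1 Var_6_I by blast
  moreover have "Var 5 \<notin> P1"
    unfolding P1_def point_ideal_homogeneous_iff[OF h homogeneous_Var] by (simp add: h.meval_Var a)
  moreover have "Var 5 \<in> P2"
    unfolding P2_def point_ideal_homogeneous_iff[OF gh homogeneous_Var] gh.meval_Var a by simp
  ultimately show ?thesis
    using krull_dim_ge_2[OF I_point P1 P2] sub by (auto simp: numeral_eq_enat)
qed

lemma krull_dim_eq: "krull_dim (zariski_topology I) = 2"
  using krull_dim_le krull_dim_ge by (rule antisym)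

end

theorem proposition5p1:
  fixes \<phi> :: real and c :: "(complex, 6) mpoly" and x :: "6 \<Rightarrow> (complex, 6) mpoly"
    and q\<^sub>1 q\<^sub>2 q\<^sub>3 :: "(complex, 6) mpoly"
  assumes "\<phi> = (1 + sqrt 5) / 2"
    and "c = Const (complex_of_real \<phi>)"
    and "x = Var"
    and "q\<^sub>1 = x 1 ^ 2 + x 4 ^ 2 - c * x 5 ^ 2 + c * x 6 ^ 2"
    and "q\<^sub>2 = x 2 ^ 2 - c * x 4 ^ 2 + x 5 ^ 2 - c * x 6 ^ 2"
    and "q\<^sub>3 = x 3 ^ 2 + c * x 4 ^ 2 - c * x 5 ^ 2 + x 6 ^ 2"
  shows "smooth (proj_subscheme {q\<^sub>1, q\<^sub>2, q\<^sub>3})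
       \<and> irreducible_space (space (proj_subscheme {q\<^sub>1, q\<^sub>2, q\<^sub>3}))
       \<and> krull_dim (space (proj_subscheme {q\<^sub>1, q\<^sub>2, q\<^sub>3})) = 2"
proof -
  have "\<phi> * \<phi> = \<phi> + 1"
    unfolding assms(1) by (simp add: field_simps)
  then have "complex_of_real \<phi> * complex_of_real \<phi> = complex_of_real \<phi> + 1"
    by (metis of_real_1 of_real_add of_real_mult)
  then interpret barth_hulek "complex_of_real \<phi>" by unfold_locales
  have Q: "{q\<^sub>1, q\<^sub>2, q\<^sub>3} = forms"
    unfolding forms_def diag_form_6 rows assms(2-) by (simp add: Const_uminus)
  have "space (proj_subscheme forms) = zariski_topology I"
    by (simp add: proj_subscheme_def Let_def I_def)
  then show ?thesis
    unfolding Q using smooth_if_dim_2[OF _ I_point krull_dim_eq] irreducible_space_zariski[OF I_point] krull_dim_eq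
    by simp
qed

end
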